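(* Let $m=(m_0,m_1,\ldots)$ be a bounded sequence of integers $m_k\ge 2$, let $G_m$ be the associated bounded Vilenkin group, and let $0<p\leq 1$. Then there is a constant $c_p>0$, independent of $f$, such that for every $f\in H_{p}^{\square }(G_{m}^{2})$, $$\sum_{n=1}^{\infty }\frac{\left\Vert S_{n,n}f\right\Vert _{p}^{p}}{n^{3-2p}\,\log ^{2[p]}(n+1)}\leq c_{p}\left\Vert f\right\Vert _{H_{p}^{\square }}^{p},$$ where $[p]$ denotes the integer part of $p$.
   Context: Setting. $m=(m_0,m_1,\ldots)$ is a sequence of integers $m_k\ge 2$ with $\sup_k m_k<\infty$; $Z_{m_k}=\{0,\ldots,m_k-1\}$ is the additive group of integers mod $m_k$ with the discrete topology; $G_m=\prod_{k\ge0}Z_{m_k}$ is the compact product group, with elements $x=(x_0,x_1,\ldots)$, and $\mu$ is its normalized Haar measure (product of the uniform measures). $I_0(x)=G_m$ and $I_n(x)=\{y\in G_m: y_0=x_0,\ldots,y_{n-1}=x_{n-1}\}$. $M_0=1$, $M_{k+1}=m_kM_k$; each $n\in\mathbb N=\{0,1,2,\ldots\}$ is uniquely $n=\sum_{j\ge0}n_jM_j$ with $n_j\in Z_{m_j}$. Vilenkin system: $r_k(x)=\exp(2\pi i x_k/m_k)$ and $\psi_n(x)=\prod_{k\ge0}r_k(x)^{n_k}$. Norms: $\|g\|_p=\left(\int_{G_m^2}|g|^p\,d(\mu\times\mu)\right)^{1/p}$ for $0<p<\infty$ (a quasi-norm if $p<1$). Martingales and Hardy spaces: $\mathcal F_{n,n}$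 is the $\sigma$-algebra on $G_m^2$ generated by the squares $I_n(x)\times I_n(y)$, $x,y\in G_m$. A martingale $f=(f_{n,n})_{n\in\mathbb N}$ is a martingale with respect to $(\mathcal F_{n,n})_{n\in\mathbb N}$; its maximal function is $f^*=\sup_{n}|f_{n,n}|$. $H_p^{\square}(G_m^2)$ is the set of such martingales with $\|f\|_{H_p^\square}:=\|f^*\|_p<\infty$. A function $f\in L_1(G_m^2)$ is identified with the martingale of its conditional expectations $(S_{M_n,M_n}f)_n$. Fourier coefficients of a martingale: $\widehat f(i,j)=\lim_{k\to\infty}\int_{G_m^2}f_{k,k}(x,y)\overline{\psi_i(x)}\,\overline{\psi_j(y)}\,d\mu(x)\,d\mu(y)$ (for $f\in L_1$ these are the usual coefficients). Rectangular partial sums: $S_{M,N}f(x,y)=\sum_{i=0}^{M-1}\sum_{j=0}^{N-1}\widehat f(i,j)\psi_i(x)\psi_j(y)$. *)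

theory Defs
  imports "HOL-Probability.Probability"
begin

section \<open>Vilenkin groups and Vilenkin systems\<close>

text \<open>
  The residues modulo \<open>m k\<close> are represented by the numbers below \<open>m k\<close>, so a point of the Vilenkin
  group is a sequence \<open>x\<close> with \<open>x k < m k\<close> for all \<open>k\<close>. The carrier is the space of the following
  measure, which is the normalized Haar measure on the Borel sets.
\<close>

definition vilenkin_measure :: "(nat \<Rightarrow> nat) \<Rightarrow> (nat \<Rightarrow> nat) measure" where
  "vilenkin_measure m = PiM UNIV (\<lambda>k. uniform_count_measure {..<m k})"

abbreviation vilenkin_measure2 :: "(nat \<Rightarrow> nat) \<Rightarrow> ((nat \<Rightarrow> nat) \<times> (nat \<Rightarrow> nat)) measure" where
  "vilenkin_measure2 m \<equiv> vilenkin_measure m \<Otimes>\<^sub>M vilenkin_measure m"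

definition vilenkin_interval :: "(nat \<Rightarrow> nat) \<Rightarrow> nat \<Rightarrow> (nat \<Rightarrow> nat) \<Rightarrow> (nat \<Rightarrow> nat) set" where
  "vilenkin_interval m n x = {y \<in> space (vilenkin_measure m). \<forall>k<n. y k = x k}"

definition vilenkin_base :: "(nat \<Rightarrow> nat) \<Rightarrow> nat \<Rightarrow> nat" where
  "vilenkin_base m k = (\<Prod>i<k. m i)"

text \<open>
  The digit \<open>n\<^sub>j\<close> in the expansion of \<open>n\<close> with respect to the bases \<open>vilenkin_base m j\<close>; see
  \<open>vilenkin_digit_less\<close>, \<open>vilenkin_expansion\<close> and \<open>vilenkin_digit_unique\<close> below.
\<close>

definition vilenkin_digit :: "(nat \<Rightarrow> nat) \<Rightarrow> nat \<Rightarrow> nat \<Rightarrow> nat" where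
  "vilenkin_digit m n j = n div vilenkin_base m j mod m j"

definition rademacher :: "(nat \<Rightarrow> nat) \<Rightarrow> nat \<Rightarrow> (nat \<Rightarrow> nat) \<Rightarrow> complex" where
  "rademacher m k x = exp (2 * of_real pi * \<i> * of_nat (x k) / of_nat (m k))"

text \<open>
  Only finitely many digits of \<open>n\<close> are nonzero (\<open>finite_vilenkin_digit\<close>), so this is the full
  product over all \<open>k\<close>.
\<close>

definition vilenkin_fun :: "(nat \<Rightarrow> nat) \<Rightarrow> nat \<Rightarrow> (nat \<Rightarrow> nat) \<Rightarrow> complex" where
  "vilenkin_fun m n x =
     (\<Prod>k | vilenkin_digit m n k \<noteq> 0. rademacher m k x ^ vilenkin_digit m n k)"

lemma vilenkin_base_Suc: "vilenkin_base m (Suc k) = m k * vilenkin_base m k"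
  by (simp add: vilenkin_base_def mult.commute)

lemma vilenkin_digit_less: "2 \<le> m j \<Longrightarrow> vilenkin_digit m n j < m j"
  by (simp add: vilenkin_digit_def)

lemma vilenkin_base_gt:
  assumes "\<And>k. 2 \<le> m k"
  shows "j < vilenkin_base m j"
proof (induction j)
  case 0
  show ?case by (simp add: vilenkin_base_def)
next
  case (Suc j)
  have "Suc j < 2 * vilenkin_base m j" using Suc by simp
  also have "\<dots> \<le> m j * vilenkin_base m j" using assms[of j] by simp
  finally show ?case by (simp add: vilenkin_base_Suc)
qed

lemma vilenkin_expansion_mod:
  "(\<Sum>j<K. vilenkin_digit m n j * vilenkin_base m j) = n mod vilenkin_base m K"
proof (induction K)
  case 0
  show ?case by (simp add: vilenkin_base_def)
next
  case (Suc K)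
  then show ?case
    by (simp add: vilenkin_digit_def vilenkin_base_Suc mult.commute[of "m K"] mod_mult2_eq)
qed

lemma vilenkin_digit_eq_0:
  assumes "\<And>k. 2 \<le> m k" "n \<le> j"
  shows "vilenkin_digit m n j = 0"
  using vilenkin_base_gt[of m j] assms by (simp add: vilenkin_digit_def)

lemma finite_vilenkin_digit:
  assumes "\<And>k. 2 \<le> m k"
  shows "finite {k. vilenkin_digit m n k \<noteq> 0}"
proof (rule finite_subset)
  show "{k. vilenkin_digit m n k \<noteq> 0} \<subseteq> {..<n}"
    using vilenkin_digit_eq_0[of m n, OF assms] by (metis (mono_tags, lifting) lessThan_iff linorder_not_le mem_Collect_eq subsetI)
qed simp

lemma vilenkin_expansion:
  assumes "\<And>k. 2 \<le> m k"
  shows "n = (\<Sum>j | vilenkin_digit m n j \<noteq> 0. vilenkin_digit m n j * vilenkin_base m j)"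
proof -
  have "(\<Sum>j | vilenkin_digit m n j \<noteq> 0. vilenkin_digit m n j * vilenkin_base m j)
      = (\<Sum>j<n. vilenkin_digit m n j * vilenkin_base m j)"
  proof (rule sum.mono_neutral_left)
    show "{j. vilenkin_digit m n j \<noteq> 0} \<subseteq> {..<n}"
      using vilenkin_digit_eq_0[of m n, OF assms] by (metis (mono_tags, lifting) lessThan_iff linorder_not_le mem_Collect_eq subsetI)
  qed auto
  also have "\<dots> = n"
    using vilenkin_base_gt[OF assms] by (simp add: vilenkin_expansion_mod)
  finally show ?thesis by simp
qed

lemma vilenkin_partial_less:
  assumes "\<And>k. d k < m k"
  shows "(\<Sum>j<K. d j * vilenkin_base m j) < vilenkin_base m K"
proof (induction K)
  case 0
  show ?case by (simp add: vilenkin_base_def)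
next
  case (Suc K)
  have "(\<Sum>j<Suc K. d j * vilenkin_base m j) < Suc (d K) * vilenkin_base m K"
    using Suc by simp
  also have "\<dots> \<le> m K * vilenkin_base m K"
    using assms[of K] by (intro mult_right_mono) auto
  finally show ?case by (simp add: vilenkin_base_Suc)
qed

lemma vilenkin_digit_unique:
  assumes d: "\<And>k. d k < m k" and n: "n = (\<Sum>j<K. d j * vilenkin_base m j)" and "j < K"
  shows "vilenkin_digit m n j = d j"
  using n \<open>j < K\<close>
proof (induction K arbitrary: n)
  case (Suc K)
  have pos: "0 < vilenkin_base m K"
    using vilenkin_partial_less[of d m K, OF d] by simp
  define r where "r = (\<Sum>j<K. d j * vilenkin_base m j)"
  have r: "r < vilenkin_base m K"
    unfolding r_def by (rule vilenkin_partial_less[OF d])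
  have n: "n = r + d K * vilenkin_base m K"
    using Suc.prems by (simp add: r_def)
  show ?case
  proof (cases "j = K")
    case True
    then show ?thesis
      using r pos d[of K] by (simp add: n vilenkin_digit_def)
  next
    case False
    then have "j < K" using Suc.prems by simp
    then have "Suc j \<le> K" by simp
    then have "vilenkin_base m (Suc j) dvd vilenkin_base m K"
      unfolding vilenkin_base_def by (intro prod_dvd_prod_subset) auto
    then obtain q where "vilenkin_base m K = vilenkin_base m (Suc j) * q"
      by (rule dvdE)
    then have q: "vilenkin_base m K = vilenkin_base m j * (m j * q)"
      by (simp add: vilenkin_base_Suc mult_ac)
    have posj: "0 < vilenkin_base m j" using pos q by (cases "vilenkin_base m j") auto
    have "n = r + vilenkin_base m j * (m j * (d K * q))"
      by (simp add: n q mult_ac)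
    then have "n div vilenkin_base m j = r div vilenkin_base m j + m j * (d K * q)"
      using posj by simp
    then have "vilenkin_digit m n j = vilenkin_digit m r j"
      by (simp add: vilenkin_digit_def)
    then show ?thesis using Suc.IH[OF r_def \<open>j < K\<close>] by simp
  qed
qed simp


section \<open>Quasi-norms\<close>

definition ennreal_powr :: "ennreal \<Rightarrow> real \<Rightarrow> ennreal" (infixr "epowr" 80) where
  "x epowr a = (if x = \<infinity> then \<infinity> else ennreal (enn2real x powr a))"

text \<open>
  The values are extended nonnegative reals, because maximal functions may be infinite. The
  definition is meant for \<open>p > 0\<close> only.
\<close>

definition Lp_norm :: "real \<Rightarrow> 'a measure \<Rightarrow> ('a \<Rightarrow> ennreal) \<Rightarrow> ennreal" where
  "Lp_norm p M g = (\<integral>\<^sup>+z. g z epowr p \<partial>M) epowr (1 / p)"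


section \<open>Martingales and Hardy spaces\<close>

definition square_algebra ::
    "(nat \<Rightarrow> nat) \<Rightarrow> nat \<Rightarrow> ((nat \<Rightarrow> nat) \<times> (nat \<Rightarrow> nat)) measure" where
  "square_algebra m n = sigma (space (vilenkin_measure2 m))
     {vilenkin_interval m n x \<times> vilenkin_interval m n y | x y.
        x \<in> space (vilenkin_measure m) \<and> y \<in> space (vilenkin_measure m)}"

definition complex_cond_exp ::
    "'a measure \<Rightarrow> 'a measure \<Rightarrow> ('a \<Rightarrow> complex) \<Rightarrow> 'a \<Rightarrow> complex" where
  "complex_cond_exp M F f z =
     Complex (real_cond_exp M F (\<lambda>w. Re (f w)) z) (real_cond_exp M F (\<lambda>w. Im (f w)) z)"

definition square_martingale ::
    "(nat \<Rightarrow> nat) \<Rightarrow> (nat \<Rightarrow> (nat \<Rightarrow> nat) \<times> (nat \<Rightarrow> nat) \<Rightarrow> complex) \<Rightarrow> bool" where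
  "square_martingale m f \<longleftrightarrow>
     (\<forall>n. f n \<in> borel_measurable (square_algebra m n)) \<and>
     (\<forall>n. integrable (vilenkin_measure2 m) (f n)) \<and>
     (\<forall>n k. n \<le> k \<longrightarrow>
        (AE z in vilenkin_measure2 m.
           complex_cond_exp (vilenkin_measure2 m) (square_algebra m n) (f k) z = f n z))"

definition maximal_fun :: "(nat \<Rightarrow> 'a \<Rightarrow> complex) \<Rightarrow> 'a \<Rightarrow> ennreal" where
  "maximal_fun f z = (SUP n. ennreal (cmod (f n z)))"

definition hardy_norm ::
    "(nat \<Rightarrow> nat) \<Rightarrow> real \<Rightarrow> (nat \<Rightarrow> (nat \<Rightarrow> nat) \<times> (nat \<Rightarrow> nat) \<Rightarrow> complex) \<Rightarrow> ennreal" where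
  "hardy_norm m p f = Lp_norm p (vilenkin_measure2 m) (maximal_fun f)"

definition hardy_space ::
    "(nat \<Rightarrow> nat) \<Rightarrow> real \<Rightarrow> (nat \<Rightarrow> (nat \<Rightarrow> nat) \<times> (nat \<Rightarrow> nat) \<Rightarrow> complex) set" where
  "hardy_space m p = {f. square_martingale m f \<and> hardy_norm m p f < \<infinity>}"


section \<open>Fourier coefficients and rectangular partial sums of martingales\<close>

definition fourier_coeff ::
    "(nat \<Rightarrow> nat) \<Rightarrow> (nat \<Rightarrow> (nat \<Rightarrow> nat) \<times> (nat \<Rightarrow> nat) \<Rightarrow> complex) \<Rightarrow> nat \<Rightarrow> nat \<Rightarrow> complex" where
  "fourier_coeff m f i j =
     lim (\<lambda>k. LINT (x, y)|vilenkin_measure2 m.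
                f k (x, y) * cnj (vilenkin_fun m i x) * cnj (vilenkin_fun m j y))"

definition partial_sum ::
    "(nat \<Rightarrow> nat) \<Rightarrow> nat \<Rightarrow> nat \<Rightarrow> (nat \<Rightarrow> (nat \<Rightarrow> nat) \<times> (nat \<Rightarrow> nat) \<Rightarrow> complex) \<Rightarrow>
      (nat \<Rightarrow> nat) \<times> (nat \<Rightarrow> nat) \<Rightarrow> complex" where
  "partial_sum m M N f = (\<lambda>(x, y).
     \<Sum>i<M. \<Sum>j<N. fourier_coeff m f i j * vilenkin_fun m i x * vilenkin_fun m j y)"

end

theory Submission
  imports Defs
begin

text \<open>
  The squares of level \<open>n\<close> form a regular filtration of \<open>G_m^2\<close>: since \<open>m\<close> is bounded, a square has
  at most a bounded multiple of the measure of each of its children. Hence the maximal function of a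
  martingale controls an atomic decomposition. The left-hand side of the theorem is \<open>p\<close>-subadditive,
  because \<open>p \<le> 1\<close>, and so it is enough to bound it by a constant times \<open>|Q| * A^p\<close> for every function
  \<open>a\<close> of mean zero that is supported in a square \<open>Q = I_N(t0) \<times> I_N(s0)\<close> and bounded by \<open>A\<close>.

  Let \<open>a\<close> be such a function. The characters of index below \<open>M_N\<close> are constant on cylinders of
  level \<open>N\<close>, so \<open>S_{n,n} a = 0\<close> for \<open>n \<le> M_N\<close>. For larger \<open>n\<close> the Dirichlet kernel has the following
  structure: if \<open>x\<close> separates from the cylinder \<open>I_N(t0)\<close> at coordinate \<open>r\<close>, then all complete blocks of
  \<open>M_{r+1}\<close> characters cancel, and what is left integrates functions on \<open>I_N(t0)\<close> to their \<open>n\<close>-th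
  Fourier coefficient, up to a factor of at most \<open>M_{r+1}\<close> (\<open>kernel_block\<close>). This splits the estimate
  into three regions. On \<open>Q\<close> itself the \<open>L^2\<close> contraction and the power mean inequality suffice.
  With one variable in its cylinder and the other outside, the kernel structure is used in the outer
  variable and the \<open>L^2\<close> contraction in the inner one. With both variables outside, only the
  diagonal Fourier coefficient of index \<open>(n, n)\<close> survives (\<open>atom_term_bound\<close>).

  For \<open>p < 1\<close> the weights decay fast enough for the trivial bound on that coefficient
  (\<open>strong_total_atom_less_1\<close>). For \<open>p = 1\<close> the trivial bound would lose a factor \<open>N\<close>. Instead,
  the diagonal coefficients are square summable with the gain \<open>|I_N|\<close> over the plain Bessel
  inequality in two variables, because the character in the second variable has modulus one and
  the Cauchy-Schwarz inequality can be applied there before Bessel in the first variable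
  (\<open>sum_dcoeff_square_le\<close>). The two logarithms in the weight absorb the
  remaining factor \<open>N^2\<close> (\<open>strong_total_atom_1\<close>).

  Only the first \<open>M_K\<close> frequencies matter for a finite part of the series, and then \<open>f\<close> may be replaced
  by \<open>f_{K,K}\<close>, which depends on \<open>K\<close> coordinates in each variable. The analysis is therefore carried
  out with finite sums over residues modulo \<open>M_K\<close>, where a residue stands for the sequence of its
  digits, and a cylinder of level \<open>n\<close> is a residue class modulo \<open>M_n\<close>. The constants do not depend
  on \<open>K\<close>.
\<close>


section \<open>Inequalities for powers and tails of series\<close>

text \<open>The concave function \<open>u powr \<theta>\<close> lies below its tangent at \<open>1\<close>.\<close>
lemma powr_le_affine:
  fixes u \<theta> :: real
  assumes "0 \<le> u" "0 < \<theta>" "\<theta> \<le> 1"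
  shows "u powr \<theta> \<le> \<theta> * u + (1 - \<theta>)"
proof (cases "u = 0")
  case False
  then show ?thesis
    using Youngs_inequality_0[of \<theta> "1 - \<theta>" u 1] assms by simp
qed (use assms in simp)

text \<open>
  The power mean inequality, in the form in which an \<open>L^2\<close> bound on a set of known size is converted
  into a bound for the exponent \<open>p\<close>: the tangent inequality is applied to \<open>(b x / D)\<^sup>2\<close> and summed.
\<close>
lemma sum_powr_le_of_sum_square_le:
  fixes b :: "'a \<Rightarrow> real"
  assumes J: "finite J" and b: "\<And>x. x \<in> J \<Longrightarrow> 0 \<le> b x" and p: "0 < p" "p \<le> 2" and D: "0 \<le> D"
    and l2: "(\<Sum>x\<in>J. (b x)\<^sup>2) \<le> real (card J) * D\<^sup>2"
  shows "(\<Sum>x\<in>J. b x powr p) \<le> real (card J) * D powr p"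
proof (cases "D = 0")
  case True
  then have "(\<Sum>x\<in>J. (b x)\<^sup>2) = 0" using l2 by (simp add: order_antisym sum_nonneg)
  then have "b x = 0" if "x \<in> J" for x
    using J that by (simp add: sum_nonneg_eq_0_iff)
  then show ?thesis using True by simp
next
  case False
  then have D: "0 < D" using D by simp
  have "b x powr p \<le> D powr p * (p / 2 * (b x)\<^sup>2 / D\<^sup>2 + (1 - p / 2))" if "x \<in> J" for x
  proof -
    have "b x powr p = D powr p * (b x / D) powr p"
      using b[OF that] D by (simp add: powr_divide)
    also have "(b x / D) powr p = ((b x / D)\<^sup>2) powr (p / 2)"
    proof (cases "b x = 0")
      case False
      then have "0 < b x / D" using b[OF that] D by simp
      then show ?thesis by (simp add: powr_powr flip: powr_numeral)
    qed simp
    also have "\<dots> \<le> p / 2 * (b x / D)\<^sup>2 + (1 - p / 2)"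
      using p by (intro powr_le_affine) auto
    finally show ?thesis by (simp add: power_divide mult_left_mono)
  qed
  then have "(\<Sum>x\<in>J. b x powr p) \<le> (\<Sum>x\<in>J. D powr p * (p / 2 * (b x)\<^sup>2 / D\<^sup>2 + (1 - p / 2)))"
    by (rule sum_mono)
  also have "\<dots> = D powr p * (p / 2 / D\<^sup>2 * (\<Sum>x\<in>J. (b x)\<^sup>2) + (1 - p / 2) * real (card J))"
    unfolding sum_distrib_left[symmetric] sum.distrib
    by (simp add: sum_divide_distrib sum_distrib_left)
  also have "\<dots> \<le> D powr p * (p / 2 / D\<^sup>2 * (real (card J) * D\<^sup>2) + (1 - p / 2) * real (card J))"
    using l2 p D by (intro mult_left_mono add_right_mono) auto
  also have "\<dots> = real (card J) * D powr p"
    using D by (simp add: field_simps)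
  finally show ?thesis .
qed

text \<open>
  After division by \<open>(a + b) powr p\<close> this says that numbers in the unit interval do not decrease
  when raised to a power \<open>p \<le> 1\<close>.
\<close>
lemma powr_add_le_add_powr:
  fixes a b p :: real
  assumes "0 \<le> a" "0 \<le> b" "0 < p" "p \<le> 1"
  shows "(a + b) powr p \<le> a powr p + b powr p"
proof (cases "a + b = 0")
  case False
  then have s: "0 < a + b" using assms by simp
  have ge: "u \<le> u powr p" if "0 \<le> u" "u \<le> 1" for u :: real
  proof (cases "u = 0")
    case False
    then have "u powr 1 \<le> u powr p" using that assms by (intro powr_mono') auto
    then show ?thesis using that by simp
  qed simp
  have "1 = a / (a + b) + b / (a + b)" using s by (simp add: add_divide_distrib[symmetric])
  also have "\<dots> \<le> (a / (a + b)) powr p + (b / (a + b)) powr p"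
    using s assms by (intro add_mono ge) auto
  also have "\<dots> = (a powr p + b powr p) / (a + b) powr p"
    using s assms by (simp add: powr_divide add_divide_distrib)
  finally show ?thesis using s by (simp add: field_simps)
qed (use assms in simp)

text \<open>
  Each term is at most a difference of consecutive values of \<open>s powr - q / q\<close>, by the inequalities
  \<open>1 + y \<le> exp y\<close> and \<open>- ln (1 - 1 / s) \<ge> 1 / s\<close>; the differences telescope.
\<close>
lemma sum_powr_tail_le:
  fixes q :: real
  assumes q: "0 < q" and P: "1 \<le> P"
  shows "(\<Sum>n\<in>{P<..<X}. real n powr - (1 + q)) \<le> real P powr - q / q"
proof -
  have step: "real n powr - (1 + q) \<le> (real (n - 1) powr - q - real n powr - q) / q" if n: "1 < n" for n
  proof -
    define s where "s = real n"
    have s: "1 < s" and s1: "real (n - 1) = s - 1" using n unfolding s_def by auto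
    have "- (ln (1 - 1 / s)) \<ge> 1 / s"
      using ln_add_one_self_le_self2[of "- (1 / s)"] s by (simp add: field_simps)
    then have "1 + q / s \<le> 1 + q * - ln (1 - 1 / s)"
      using mult_left_mono[of "1 / s" "- ln (1 - 1 / s)" q] q by simp
    also have "\<dots> \<le> exp (q * - ln (1 - 1 / s))"
      by (rule exp_ge_add_one_self)
    also have "\<dots> = (1 - 1 / s) powr - q"
      using s by (simp add: powr_def)
    also have "\<dots> = (s - 1) powr - q / s powr - q"
      using s by (simp add: powr_divide[symmetric] diff_divide_distrib)
    finally have "(1 + q / s) * s powr - q \<le> (s - 1) powr - q"
      using s by (simp add: field_simps)
    then have "s powr - q / s * q \<le> (s - 1) powr - q - s powr - q"
      by (simp add: algebra_simps)
    then have "s powr - q / s \<le> ((s - 1) powr - q - s powr - q) / q"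
      using q by (simp only: pos_le_divide_eq)
    moreover have "s powr - (1 + q) = s powr - q / s"
    proof -
      have "- (1 + q) = - q - 1" by simp
      then show ?thesis using s by (simp only: powr_diff) simp
    qed
    ultimately show ?thesis
      unfolding s1 s_def[symmetric] by simp
  qed
  have "(\<Sum>n\<in>{P<..<X}. real n powr - (1 + q)) \<le> (real P powr - q - real (X - 1) powr - q) / q" if "P < X"
    using that
  proof (induction X)
    case (Suc X)
    show ?case
    proof (cases "P = X")
      case False
      then have "P < X" using Suc.prems by simp
      then have "{P<..<Suc X} = insert X {P<..<X}" by auto
      then show ?thesis using Suc.IH[OF \<open>P < X\<close>] step[of X] \<open>P < X\<close> P
        by (simp add: diff_divide_distrib)
    next
      case True
      then have "{P<..<Suc X} = {}" by auto
      then show ?thesis using True q by simp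
    qed
  qed simp
  also have "\<dots> \<le> real P powr - q / q" using q by (simp add: divide_right_mono)
  finally show ?thesis
    using q by (cases "P < X") (simp_all add: greaterThanLessThan_empty_iff[THEN iffD2])
qed

text \<open>
  The differences of \<open>2 / ln s\<close> dominate the terms, because \<open>ln (s + 1) - ln s \<ge> 1 / (s + 1)\<close>. The
  factor \<open>2\<close> pays for replacing \<open>1 / s\<close> by \<open>1 / (s + 1)\<close>.
\<close>
lemma sum_log_tail_le:
  assumes P: "2 \<le> P"
  shows "(\<Sum>n\<in>{P<..<X}. 1 / (real n * (ln (real n + 1))\<^sup>2)) \<le> 2 / ln (real P)"
proof -
  have step: "1 / (real n * (ln (real n + 1))\<^sup>2) \<le> 2 / ln (real n) - 2 / ln (real (Suc n))" if n: "2 \<le> n" for n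
  proof -
    define s where "s = real n"
    have s: "2 \<le> s" using n unfolding s_def by simp
    define a where "a = ln s"
    define b where "b = ln (s + 1)"
    have a: "0 < a" unfolding a_def using s by simp
    have ab: "a \<le> b" unfolding a_def b_def using s by simp
    have "a - b = ln (1 + - (1 / (s + 1)))"
    proof -
      have "1 + - (1 / (s + 1)) = s / (s + 1)" using s by (simp add: field_simps)
      then show ?thesis using s ln_div[of s "s + 1"] unfolding a_def b_def by simp
    qed
    also have "\<dots> \<le> - (1 / (s + 1))"
      using s by (intro ln_add_one_self_le_self2) simp
    finally have "a - b \<le> - (1 / (s + 1))" .
    then have d: "1 / (s + 1) \<le> b - a" by simp
    have "1 / s \<le> 2 * (1 / (s + 1))"
      using s by (simp add: field_simps)
    then have "1 / (s * b\<^sup>2) \<le> 2 * (1 / (s + 1)) / b\<^sup>2"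
      using divide_right_mono[of "1 / s" "2 * (1 / (s + 1))" "b\<^sup>2"] by simp
    also have "\<dots> \<le> 2 * (b - a) / b\<^sup>2"
      using d by (intro divide_right_mono mult_left_mono) auto
    also have "\<dots> \<le> 2 * (b - a) / (a * b)"
      using a ab by (intro divide_left_mono) (auto simp: power2_eq_square intro: mult_right_mono)
    also have "\<dots> = 2 / a - 2 / b" using a ab by (simp add: field_simps)
    finally show ?thesis unfolding a_def b_def s_def by (simp add: add.commute)
  qed
  have "(\<Sum>n\<in>{P<..<X}. 1 / (real n * (ln (real n + 1))\<^sup>2)) \<le> 2 / ln (real P) - 2 / ln (real X)" if "P < X"
    using that
  proof (induction X)
    case (Suc X)
    show ?case
    proof (cases "P = X")
      case True
      have "ln (real X) \<le> ln (real (Suc X))" "0 < ln (real X)" using P True by auto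
      moreover from this have "0 < ln (real (Suc X))" by linarith
      ultimately have "2 / ln (real (Suc X)) \<le> 2 / ln (real X)" by (intro divide_left_mono mult_pos_pos) auto
      moreover have "{P<..<Suc X} = {}" using True by auto
      ultimately show ?thesis using True by simp
    next
      case False
      then have "P < X" using Suc.prems by simp
      then have "{P<..<Suc X} = insert X {P<..<X}" by auto
      then show ?thesis using Suc.IH[OF \<open>P < X\<close>] step[of X] \<open>P < X\<close> P by simp
    qed
  qed simp
  then have main: "(\<Sum>n\<in>{P<..<X}. 1 / (real n * (ln (real n + 1))\<^sup>2)) \<le> 2 / ln (real P) - 2 / ln (real X)" if "P < X"
    using that by blast
  show ?thesis
  proof (cases "P < X")
    case True
    have "0 \<le> 2 / ln (real X)" using True P by simp
    then show ?thesis using main[OF True] by linarith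
  next
    case False
    then have "{P<..<X} = {}" by auto
    then show ?thesis using P by simp
  qed
qed

section \<open>Atomic decomposition for regular filtrations of a finite set\<close>

lemma sum_switch:
  assumes "\<And>j. P (Suc j) \<Longrightarrow> P j"
  shows "(\<Sum>j<i. if P j \<and> \<not> P (Suc j) then d else 0) = (if P 0 \<and> \<not> P i then d else 0)"
proof (induction i)
  case (Suc i)
  have "P j \<Longrightarrow> P 0" for j by (induction j) (use assms in blast)+
  then show ?case using Suc assms[of i] by auto
qed simp

text \<open>
  The sets \<open>{w \<in> \<Omega>. q k w = q k z}\<close> are the atoms of the \<open>k\<close>-th sigma-algebra for the counting
  measure. Labels make the refinement of partitions a statement about equality only.
\<close>
locale regular_filtration =
  fixes \<Omega> :: "'a set" and q :: "nat \<Rightarrow> 'a \<Rightarrow> 'b" and K :: nat and R :: real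
  assumes fin: "finite \<Omega>"
    and trivial_bottom: "\<And>z w. z \<in> \<Omega> \<Longrightarrow> w \<in> \<Omega> \<Longrightarrow> q 0 z = q 0 w"
    and refine: "\<And>k z w. z \<in> \<Omega> \<Longrightarrow> w \<in> \<Omega> \<Longrightarrow> q (Suc k) z = q (Suc k) w \<Longrightarrow> q k z = q k w"
    and discrete_top: "\<And>z w. z \<in> \<Omega> \<Longrightarrow> w \<in> \<Omega> \<Longrightarrow> q K z = q K w \<Longrightarrow> z = w"
    and regular: "\<And>k z. k < K \<Longrightarrow> z \<in> \<Omega> \<Longrightarrow>
      real (card {w\<in>\<Omega>. q k w = q k z}) \<le> R * real (card {w\<in>\<Omega>. q (Suc k) w = q (Suc k) z})"
begin

definition cell :: "nat \<Rightarrow> 'a \<Rightarrow> 'a set" where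
  "cell k z = {w\<in>\<Omega>. q k w = q k z}"

definition cexp :: "nat \<Rightarrow> ('a \<Rightarrow> complex) \<Rightarrow> 'a \<Rightarrow> complex" where
  "cexp k g z = (\<Sum>w\<in>cell k z. g w) / of_nat (card (cell k z))"

definition maxf :: "('a \<Rightarrow> complex) \<Rightarrow> 'a \<Rightarrow> real" where
  "maxf g z = (MAX k\<in>{..K}. cmod (cexp k g z))"

lemma finite_cell [simp]: "finite (cell k z)"
  using fin by (simp add: cell_def)

lemma cell_subset: "cell k z \<subseteq> \<Omega>"
  by (auto simp: cell_def)

lemma self_in_cell: "z \<in> \<Omega> \<Longrightarrow> z \<in> cell k z"
  by (simp add: cell_def)

lemma cell_eq: "w \<in> cell k z \<Longrightarrow> cell k w = cell k z"
  by (auto simp: cell_def)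

lemma refine_le:
  assumes "z \<in> \<Omega>" "w \<in> \<Omega>" "j \<le> k" "q k z = q k w"
  shows "q j z = q j w"
  using assms(3,4) by (induction k rule: dec_induct) (auto dest: refine[OF assms(1,2)])

lemma cell_antimono: "z \<in> \<Omega> \<Longrightarrow> j \<le> k \<Longrightarrow> cell k z \<subseteq> cell j z"
  unfolding cell_def by (auto intro: refine_le)

lemma cexp_cell: "w \<in> cell k z \<Longrightarrow> cexp k g w = cexp k g z"
  by (simp add: cexp_def cell_eq)

lemma cexp_top:
  assumes "z \<in> \<Omega>" shows "cexp K g z = g z"
proof -
  have "cell K z = {z}"
    using assms discrete_top by (auto simp: cell_def)
  then show ?thesis by (simp add: cexp_def)
qed

lemma cmod_cexp_le_maxf: "k \<le> K \<Longrightarrow> cmod (cexp k g z) \<le> maxf g z"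
  unfolding maxf_def by (rule Max_ge) auto

lemma maxf_nonneg: "0 \<le> maxf g z"
  using cmod_cexp_le_maxf[of 0 g z] norm_ge_zero order_trans by blast

text \<open>Conditional expectation is self-adjoint and fixes functions that are constant on the cells.\<close>
lemma sum_cexp_mult:
  fixes g h :: "'a \<Rightarrow> complex"
  assumes "\<And>z w. z \<in> \<Omega> \<Longrightarrow> w \<in> cell k z \<Longrightarrow> h w = h z"
  shows "(\<Sum>z\<in>\<Omega>. cexp k g z * h z) = (\<Sum>z\<in>\<Omega>. g z * h z)"
proof -
  have "(\<Sum>z\<in>\<Omega>. cexp k g z * h z)
      = (\<Sum>z\<in>\<Omega>. \<Sum>w\<in>\<Omega>. if w \<in> cell k z then g w * h z / of_nat (card (cell k z)) else 0)"
  proof (rule sum.cong[OF refl])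
    fix z assume "z \<in> \<Omega>"
    have "cexp k g z * h z = (\<Sum>w\<in>cell k z. g w * h z / of_nat (card (cell k z)))"
      by (simp add: cexp_def sum_divide_distrib sum_distrib_right)
    also have "\<dots> = (\<Sum>w\<in>\<Omega>. if w \<in> cell k z then g w * h z / of_nat (card (cell k z)) else 0)"
      using fin cell_subset[of k z] by (subst sum.inter_restrict[symmetric]) (auto simp: Int_absorb1)
    finally show "cexp k g z * h z = \<dots>" .
  qed
  also have "\<dots> = (\<Sum>w\<in>\<Omega>. \<Sum>z\<in>\<Omega>. if w \<in> cell k z then g w * h z / of_nat (card (cell k z)) else 0)"
    by (rule sum.swap)
  also have "\<dots> = (\<Sum>w\<in>\<Omega>. g w * h w)"
  proof (rule sum.cong[OF refl])
    fix w assume w: "w \<in> \<Omega>"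
    have "(\<Sum>z\<in>\<Omega>. if w \<in> cell k z then g w * h z / of_nat (card (cell k z)) else 0)
        = (\<Sum>z\<in>\<Omega>. if z \<in> cell k w then g w * h w / of_nat (card (cell k w)) else 0)"
    proof (rule sum.cong[OF refl])
      fix z assume z: "z \<in> \<Omega>"
      have "w \<in> cell k z \<longleftrightarrow> z \<in> cell k w" using z w by (auto simp: cell_def)
      moreover have "h z = h w" if "z \<in> cell k w" using assms[OF w that] .
      moreover have "cell k z = cell k w" if "z \<in> cell k w" using cell_eq[OF that] .
      ultimately show "(if w \<in> cell k z then g w * h z / of_nat (card (cell k z)) else 0)
        = (if z \<in> cell k w then g w * h w / of_nat (card (cell k w)) else 0)" by auto
    qed
    also have "\<dots> = (\<Sum>z\<in>cell k w. g w * h w / of_nat (card (cell k w)))"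
      using fin cell_subset[of k w] by (subst sum.inter_restrict[symmetric]) (auto simp: Int_absorb1)
    also have "\<dots> = g w * h w"
      using self_in_cell[OF w, of k] by auto
    finally show "(\<Sum>z\<in>\<Omega>. if w \<in> cell k z then g w * h z / of_nat (card (cell k z)) else 0) = g w * h w" .
  qed
  finally show ?thesis .
qed

lemma sum_increment_mult:
  fixes g h :: "'a \<Rightarrow> complex"
  assumes h: "\<And>z w. z \<in> \<Omega> \<Longrightarrow> w \<in> cell k z \<Longrightarrow> h w = h z"
  shows "(\<Sum>z\<in>\<Omega>. (cexp (Suc k) g z - cexp k g z) * h z) = 0"
proof -
  have h': "h w = h z" if "z \<in> \<Omega>" "w \<in> cell (Suc k) z" for z w
    using h[OF that(1)] cell_antimono[OF that(1), of k "Suc k"] that(2) by auto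
  show ?thesis
    by (simp add: left_diff_distrib sum_subtractf sum_cexp_mult[of _ h, OF h] sum_cexp_mult[of _ h, OF h'])
qed

text \<open>
  A stopping condition of the predictable kind: it looks at the children of the ancestors of \<open>z\<close>, not
  only at the ancestors. Therefore it depends only on the cell of \<open>z\<close> at level \<open>k\<close>, and as long as it
  fails, the next martingale value is still at most \<open>t\<close>.
\<close>
definition large :: "('a \<Rightarrow> complex) \<Rightarrow> real \<Rightarrow> nat \<Rightarrow> 'a \<Rightarrow> bool" where
  "large g t k z \<longleftrightarrow>
     (\<exists>k'\<le>k. \<exists>w\<in>cell k' z. t < cmod (cexp k' g w) \<or> t < cmod (cexp (Suc k') g w))"

definition first_large :: "('a \<Rightarrow> complex) \<Rightarrow> real \<Rightarrow> nat \<Rightarrow> 'a \<Rightarrow> bool" where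
  "first_large g t n z \<longleftrightarrow> large g t n z \<and> (\<forall>k<n. \<not> large g t k z)"

text \<open>
  The part of the martingale between the stopping times for the heights \<open>t\<close> and \<open>2 * t\<close>.
\<close>
definition layer :: "('a \<Rightarrow> complex) \<Rightarrow> real \<Rightarrow> 'a \<Rightarrow> complex" where
  "layer g t z = (\<Sum>k | k < K \<and> large g t k z \<and> \<not> large g (2 * t) k z. cexp (Suc k) g z - cexp k g z)"

definition stopping_cells :: "('a \<Rightarrow> complex) \<Rightarrow> real \<Rightarrow> 'a set set" where
  "stopping_cells g t = {cell n z | n z. n < K \<and> z \<in> \<Omega> \<and> first_large g t n z}"

lemma large_mono: "large g t j z \<Longrightarrow> j \<le> k \<Longrightarrow> large g t k z"
  unfolding large_def by (meson le_trans)

lemma large_antimono: "large g t k z \<Longrightarrow> s \<le> t \<Longrightarrow> large g s k z"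
  unfolding large_def by (meson le_less_trans)

lemma large_cell_aux:
  assumes "z \<in> \<Omega>" "w \<in> cell k z" "k' \<le> k"
  shows "cell k' w = cell k' z"
  using cell_eq cell_antimono[OF assms(1,3)] assms(2) by blast

lemma large_cell:
  assumes "z \<in> \<Omega>" "w \<in> cell k z"
  shows "large g t k w \<longleftrightarrow> large g t k z"
  unfolding large_def using large_cell_aux[OF assms] by auto

lemma large_cell':
  assumes "z \<in> \<Omega>" "w \<in> cell n z" "k \<le> n"
  shows "large g t k w \<longleftrightarrow> large g t k z"
  using large_cell[OF assms(1)] cell_antimono[OF assms(1,3)] assms(2) by blast

lemma first_large_cell:
  assumes "z \<in> \<Omega>" "w \<in> cell n z"
  shows "first_large g t n w \<longleftrightarrow> first_large g t n z"
  unfolding first_large_def using large_cell'[OF assms] by auto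

lemma first_large_unique: "first_large g t n z \<Longrightarrow> first_large g t n' z \<Longrightarrow> n = n'"
  unfolding first_large_def by (metis linorder_neqE_nat)

lemma finite_stopping_cells: "finite (stopping_cells g t)"
proof (rule finite_subset)
  show "stopping_cells g t \<subseteq> Pow \<Omega>"
    unfolding stopping_cells_def using cell_subset by auto
qed (use fin in auto)

lemma stopping_cells_disjoint:
  assumes "Q \<in> stopping_cells g t" "Q' \<in> stopping_cells g t" "x \<in> Q" "x \<in> Q'"
  shows "Q = Q'"
proof -
  obtain n z n' z' where Q: "Q = cell n z" "z \<in> \<Omega>" "first_large g t n z"
    and Q': "Q' = cell n' z'" "z' \<in> \<Omega>" "first_large g t n' z'"
    using assms(1,2) unfolding stopping_cells_def by blast
  have "first_large g t n x" "first_large g t n' x"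
    using first_large_cell Q Q' assms(3,4) by blast+
  then have "n = n'" by (rule first_large_unique)
  then show ?thesis using cell_eq Q Q' assms(3,4) by metis
qed

text \<open>
  Where the filtration stops for the first time, the cell itself or one of its children has a large
  average, so the maximal function is large on at least one child. By regularity that child carries
  a fixed proportion of the cell.
\<close>
lemma card_stopping_cell_le:
  assumes "Q \<in> stopping_cells g t" "0 \<le> R"
  shows "real (card Q) \<le> R * real (card {w\<in>Q. t < maxf g w})"
proof -
  obtain n z where Q: "Q = cell n z" "n < K" "z \<in> \<Omega>" "first_large g t n z"
    using assms(1) unfolding stopping_cells_def by blast
  obtain k' w where k': "k' \<le> n" "w \<in> cell k' z" "t < cmod (cexp k' g w) \<or> t < cmod (cexp (Suc k') g w)"
    using Q(4) unfolding first_large_def large_def by blast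
  have "large g t k' z" unfolding large_def using k' by blast
  then have "k' = n" using Q(4) k'(1) unfolding first_large_def by (metis le_neq_implies_less)
  note k' = k'[unfolded this]
  have w: "w \<in> \<Omega>" using k'(2) cell_subset by blast
  have "cell (Suc n) w \<subseteq> {v\<in>Q. t < maxf g v}"
  proof
    fix v assume v: "v \<in> cell (Suc n) w"
    have vn: "v \<in> cell n w" using v cell_antimono[OF w, of n "Suc n"] by auto
    have "t < cmod (cexp n g v) \<or> t < cmod (cexp (Suc n) g v)"
      using k'(3) cexp_cell[OF v] cexp_cell[OF vn] by simp
    then have "t < maxf g v"
      using cmod_cexp_le_maxf[of n g v] cmod_cexp_le_maxf[of "Suc n" g v] Q(2) by auto
    moreover have "v \<in> Q" using vn cell_eq[OF k'(2)] Q(1) by simp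
    ultimately show "v \<in> {v\<in>Q. t < maxf g v}" by simp
  qed
  then have "card (cell (Suc n) w) \<le> card {v\<in>Q. t < maxf g v}"
    using Q(1) by (intro card_mono) auto
  moreover have "real (card (cell n w)) \<le> R * real (card (cell (Suc n) w))"
    using regular[OF Q(2) w] unfolding cell_def .
  moreover have "cell n w = Q" using cell_eq[OF k'(2)] Q(1) by simp
  ultimately show ?thesis
    using assms(2) mult_left_mono[of "real (card (cell (Suc n) w))" "real (card {v\<in>Q. t < maxf g v})" R]
    by simp
qed

text \<open>
  The levels that contribute at a given point form an interval, because the stopping condition is
  monotone in the level. So the increments telescope to a difference of two martingale values, both of
  them at most \<open>2 * t\<close>.
\<close>
lemma cmod_layer_le:
  assumes z: "z \<in> \<Omega>" and t: "0 \<le> t"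
  shows "cmod (layer g t z) \<le> 4 * t"
proof -
  define S where "S = {k. k < K \<and> large g t k z \<and> \<not> large g (2 * t) k z}"
  have fS: "finite S" unfolding S_def by simp
  show ?thesis
  proof (cases "S = {}")
    case True
    then show ?thesis using t unfolding layer_def S_def[symmetric] by simp
  next
    case False
    define a b where "a = Min S" and "b = Max S"
    have ab: "a \<in> S" "b \<in> S" "a \<le> b"
      unfolding a_def b_def using fS False by auto
    have "S = {a..b}"
    proof (intro equalityI subsetI)
      fix k assume "k \<in> S"
      then show "k \<in> {a..b}" using fS unfolding a_def b_def by simp
    next
      fix k assume "k \<in> {a..b}"
      then show "k \<in> S" using ab large_mono[of g t a z k] large_mono[of g "2*t" k z b]
        unfolding S_def by auto
    qed
    then have "layer g t z = (\<Sum>k=a..b. cexp (Suc k) g z - cexp k g z)"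
      unfolding layer_def S_def by simp
    also have "\<dots> = cexp (Suc b) g z - cexp a g z"
      using ab(3) by (subst sum_Suc_diff) auto
    finally have eq: "layer g t z = cexp (Suc b) g z - cexp a g z" .
    have small: "cmod (cexp k g z) \<le> 2 * t \<and> cmod (cexp (Suc k) g z) \<le> 2 * t"
      if "\<not> large g (2 * t) k z" for k
    proof (rule ccontr)
      assume "\<not> ?thesis"
      then have "large g (2 * t) k z"
        unfolding large_def using self_in_cell[OF z, of k]
        by (intro exI[of _ k] conjI bexI[of _ z]) auto
      then show False using that by simp
    qed
    have "cmod (layer g t z) \<le> cmod (cexp (Suc b) g z) + cmod (cexp a g z)"
      unfolding eq by (rule norm_triangle_ineq4)
    also have "\<dots> \<le> 2 * t + 2 * t"
      using small[of a] small[of b] ab unfolding S_def by auto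
    finally show ?thesis by simp
  qed
qed

text \<open>
  Before the stopping level nothing contributes on \<open>Q\<close>. From then on the selection of an increment
  is constant on the cells of its level, and increments are orthogonal to such functions.
\<close>
lemma sum_layer_stopping_cell:
  assumes "Q \<in> stopping_cells g t"
  shows "(\<Sum>z\<in>Q. layer g t z) = 0"
proof -
  obtain n z where Q: "Q = cell n z" "n < K" "z \<in> \<Omega>" "first_large g t n z"
    using assms(1) unfolding stopping_cells_def by blast
  define h where "h k w = (if w \<in> Q \<and> large g t k w \<and> \<not> large g (2 * t) k w then 1 else 0 :: complex)" for k w
  have Qsub: "Q \<subseteq> \<Omega>" using Q(1) cell_subset by simp
  have "(\<Sum>w\<in>Q. layer g t w)
      = (\<Sum>w\<in>Q. \<Sum>k<K. (cexp (Suc k) g w - cexp k g w) * h k w)"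
  proof (rule sum.cong[OF refl])
    fix w assume "w \<in> Q"
    have *: "{k. k < K \<and> large g t k w \<and> \<not> large g (2 * t) k w} = {k \<in> {..<K}. large g t k w \<and> \<not> large g (2 * t) k w}"
      by auto
    show "layer g t w = (\<Sum>k<K. (cexp (Suc k) g w - cexp k g w) * h k w)"
      unfolding layer_def h_def * using \<open>w \<in> Q\<close>
      by (subst sum.inter_filter) (auto intro!: sum.cong)
  qed
  also have "\<dots> = (\<Sum>w\<in>\<Omega>. \<Sum>k<K. (cexp (Suc k) g w - cexp k g w) * h k w)"
    using fin Qsub by (intro sum.mono_neutral_left) (auto simp: h_def)
  also have "\<dots> = (\<Sum>k<K. \<Sum>w\<in>\<Omega>. (cexp (Suc k) g w - cexp k g w) * h k w)"
    by (rule sum.swap)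
  also have "\<dots> = 0"
  proof (rule sum.neutral, rule ballI)
    fix k
    show "(\<Sum>w\<in>\<Omega>. (cexp (Suc k) g w - cexp k g w) * h k w) = 0"
    proof (cases "k < n")
      case True
      have "h k w = 0" if "w \<in> \<Omega>" for w
      proof (cases "w \<in> Q")
        case wQ: True
        then have "\<not> large g t k w"
          using Q True large_cell'[of z w n k] unfolding first_large_def by auto
        then show ?thesis by (simp add: h_def)
      qed (simp add: h_def)
      then show ?thesis by simp
    next
      case False
      show ?thesis
      proof (rule sum_increment_mult)
        fix v w assume v: "v \<in> \<Omega>" and w: "w \<in> cell k v"
        have "w \<in> cell n v" using w cell_antimono[OF v, of n k] False by auto
        then have "w \<in> Q \<longleftrightarrow> v \<in> Q"
          using Q(1) v by (auto simp: cell_def)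
        then show "h k w = h k v"
          unfolding h_def using large_cell[OF v w] by simp
      qed
    qed
  qed
  finally show ?thesis .
qed

lemma first_large_exists:
  assumes "large g t k z"
  shows "\<exists>n\<le>k. first_large g t n z"
proof -
  define n where "n = (LEAST n. large g t n z)"
  have "large g t n z" unfolding n_def using assms by (rule LeastI)
  moreover have "n \<le> k" unfolding n_def using assms by (rule Least_le)
  moreover have "\<not> large g t j z" if "j < n" for j
    using that unfolding n_def by (rule not_less_Least)
  ultimately show ?thesis unfolding first_large_def by blast
qed

lemma layer_eq_sum_atoms:
  assumes z: "z \<in> \<Omega>"
  shows "layer g t z = (\<Sum>Q\<in>stopping_cells g t. if z \<in> Q then layer g t z else 0)"
proof (cases "\<exists>Q0\<in>stopping_cells g t. z \<in> Q0")
  case True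
  then obtain Q0 where Q0: "Q0 \<in> stopping_cells g t" "z \<in> Q0" by blast
  have iff: "z \<in> Q \<longleftrightarrow> Q = Q0" if "Q \<in> stopping_cells g t" for Q
    using stopping_cells_disjoint[OF that Q0(1) _ Q0(2)] Q0(2) by metis
  have "(\<Sum>Q\<in>stopping_cells g t. if z \<in> Q then layer g t z else 0)
      = (\<Sum>Q\<in>stopping_cells g t. if Q = Q0 then layer g t z else 0)"
    by (rule sum.cong[OF refl]) (simp only: iff)
  also have "\<dots> = layer g t z"
    unfolding sum.delta[OF finite_stopping_cells] using Q0(1) by (rule if_P)
  finally show ?thesis by (rule sym)
next
  case False
  have "\<not> large g t k z" if "k < K" for k
  proof
    assume "large g t k z"
    then obtain n where "n \<le> k" "first_large g t n z" using first_large_exists by blast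
    then have "n < K" "first_large g t n z" using that by auto
    then have "cell n z \<in> stopping_cells g t"
      using z unfolding stopping_cells_def by blast
    moreover have "z \<in> cell n z" using z by (rule self_in_cell)
    ultimately show False using False by blast
  qed
  then have "{k. k < K \<and> large g t k z \<and> \<not> large g (2 * t) k z} = {}" by blast
  then have zero: "layer g t z = 0" unfolding layer_def by (simp only: sum.empty)
  show ?thesis unfolding zero if_cancel sum.neutral_const ..
qed

text \<open>
  Summation over the heights \<open>\<theta> * 2 ^ j\<close> recovers all increments when \<open>\<theta>\<close> is below every nonzero value
  of the martingale and \<open>\<theta> * 2 ^ J\<close> is above all values: an increment is missed only if both its
  values vanish.
\<close>
lemma sum_layers:
  assumes z: "z \<in> \<Omega>"
    and lo: "\<And>k w. k \<le> K \<Longrightarrow> w \<in> \<Omega> \<Longrightarrow> cmod (cexp k g w) \<le> \<theta> \<Longrightarrow> cexp k g w = 0"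
    and hi: "\<And>k w. k \<le> K \<Longrightarrow> w \<in> \<Omega> \<Longrightarrow> cmod (cexp k g w) \<le> \<theta> * 2 ^ J"
    and \<theta>: "0 \<le> \<theta>"
  shows "g z = cexp 0 g z + (\<Sum>j<J. layer g (\<theta> * 2 ^ j) z)"
proof -
  let ?d = "\<lambda>k. cexp (Suc k) g z - cexp k g z"
  let ?H = "\<lambda>j k. large g (\<theta> * 2 ^ j) k z"
  have ind: "(\<Sum>j<i. if ?H j k \<and> \<not> ?H (Suc j) k then ?d k else 0)
      = (if ?H 0 k \<and> \<not> ?H i k then ?d k else 0)" for i k
    by (rule sum_switch) (erule large_antimono, use \<theta> in simp)
  have top: "(if ?H 0 k \<and> \<not> ?H J k then ?d k else 0) = ?d k" if k: "k < K" for k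
  proof -
    have "\<not> ?H J k"
    proof
      assume "?H J k"
      then obtain k' w where "k' \<le> k" "w \<in> cell k' z"
        "\<theta> * 2 ^ J < cmod (cexp k' g w) \<or> \<theta> * 2 ^ J < cmod (cexp (Suc k') g w)"
        unfolding large_def by blast
      then show False using hi[of k' w] hi[of "Suc k'" w] cell_subset[of k' z] k by force
    qed
    moreover have "?d k = 0" if "\<not> ?H 0 k"
    proof -
      have "cmod (cexp k g z) \<le> \<theta> \<and> cmod (cexp (Suc k) g z) \<le> \<theta>"
        using that self_in_cell[OF z, of k] unfolding large_def by force
      then show ?thesis using lo[of k z] lo[of "Suc k" z] k z by simp
    qed
    ultimately show ?thesis by auto
  qed
  have "(\<Sum>j<J. layer g (\<theta> * 2 ^ j) z)
      = (\<Sum>j<J. \<Sum>k<K. if ?H j k \<and> \<not> ?H (Suc j) k then ?d k else 0)"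
  proof (rule sum.cong[OF refl])
    fix j
    have *: "{k. k < K \<and> large g (\<theta> * 2 ^ j) k z \<and> \<not> large g (2 * (\<theta> * 2 ^ j)) k z}
        = {k \<in> {..<K}. ?H j k \<and> \<not> ?H (Suc j) k}"
      by (auto simp: mult_ac)
    show "layer g (\<theta> * 2 ^ j) z = (\<Sum>k<K. if ?H j k \<and> \<not> ?H (Suc j) k then ?d k else 0)"
      unfolding layer_def * by (subst sum.inter_filter) auto
  qed
  also have "\<dots> = (\<Sum>k<K. \<Sum>j<J. if ?H j k \<and> \<not> ?H (Suc j) k then ?d k else 0)"
    by (rule sum.swap)
  also have "\<dots> = (\<Sum>k<K. ?d k)"
    unfolding ind using top by (intro sum.cong) auto
  also have "\<dots> = cexp K g z - cexp 0 g z"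
    by (rule sum_lessThan_telescope)
  finally show ?thesis using cexp_top[OF z] by simp
qed

end

text \<open>A geometric sum is comparable to its largest term, here the last height below \<open>t\<close>.\<close>
lemma geometric_threshold_sum:
  fixes \<theta> p t :: real
  assumes "0 < \<theta>" "0 < p" "0 \<le> t"
  shows "(\<Sum>j | j < J \<and> \<theta> * 2 ^ j < t. (\<theta> * 2 ^ j) powr p) \<le> (2 * t) powr p / (2 powr p - 1)"
proof -
  have pp: "2 powr p > 1" using assms(2) by simp
  have geo: "(\<Sum>j<i. (\<theta> * 2 ^ j) powr p) \<le> (\<theta> * 2 ^ i) powr p / (2 powr p - 1)" for i
  proof (induction i)
    case (Suc i)
    have "(\<theta> * 2 ^ Suc i) powr p = 2 powr p * (\<theta> * 2 ^ i) powr p"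
      using assms by (simp add: powr_mult mult_ac)
    then show ?case using Suc pp by (simp add: field_simps)
  next
    case 0
    show ?case using pp by simp
  qed
  show ?thesis
  proof (cases "{j. j < J \<and> \<theta> * 2 ^ j < t} = {}")
    case True
    then show ?thesis using pp by (simp only: sum.empty) simp
  next
    case False
    define i where "i = Max {j. j < J \<and> \<theta> * 2 ^ j < t}"
    have i: "i < J" "\<theta> * 2 ^ i < t"
      using Max_in[of "{j. j < J \<and> \<theta> * 2 ^ j < t}"] False unfolding i_def by auto
    have sub: "{j. j < J \<and> \<theta> * 2 ^ j < t} \<subseteq> {..<Suc i}"
      using Max_ge[of "{j. j < J \<and> \<theta> * 2 ^ j < t}"] unfolding i_def by (auto simp: less_Suc_eq_le)
    have "(\<Sum>j | j < J \<and> \<theta> * 2 ^ j < t. (\<theta> * 2 ^ j) powr p) \<le> (\<Sum>j<Suc i. (\<theta> * 2 ^ j) powr p)"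
      using sub by (intro sum_mono2) auto
    also have "\<dots> \<le> (\<theta> * 2 ^ Suc i) powr p / (2 powr p - 1)"
      by (rule geo)
    also have "\<dots> \<le> (2 * t) powr p / (2 powr p - 1)"
      using less_imp_le[OF pp] i assms by (intro divide_right_mono powr_mono2) auto
    finally show ?thesis .
  qed
qed

context regular_filtration begin

text \<open>
  The reduction to atoms. Each layer of height \<open>t\<close> is a sum of atoms of height \<open>4 * t\<close>, one for each
  stopping cell, and the total size of these cells is at most \<open>R\<close> times the size of the set where the
  maximal function exceeds \<open>t\<close>. Summing \<open>t powr p\<close> over the dyadic heights below the maximal
  function reproduces its \<open>p\<close>-th power.
\<close>
theorem atomic_bound:
  fixes T :: "('a \<Rightarrow> complex) \<Rightarrow> real"
  assumes p: "0 < p" and C: "0 \<le> C" and R: "0 \<le> R"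
    and T_cong: "\<And>f h. (\<And>z. z \<in> \<Omega> \<Longrightarrow> f z = h z) \<Longrightarrow> T f = T h"
    and T_zero: "T (\<lambda>z. 0) = 0"
    and T_add: "\<And>f h. T (\<lambda>z. f z + h z) \<le> T f + T h"
    and T_const: "\<And>c. T (\<lambda>z. c) \<le> C * real (card \<Omega>) * cmod c powr p"
    and T_atom: "\<And>k z A a. \<lbrakk>k < K; z \<in> \<Omega>; \<And>w. w \<notin> cell k z \<Longrightarrow> a w = 0; \<And>w. cmod (a w) \<le> A;
        (\<Sum>w\<in>cell k z. a w) = 0\<rbrakk> \<Longrightarrow> T a \<le> C * real (card (cell k z)) * A powr p"
  shows "T g \<le> C * (1 + R * 8 powr p / (2 powr p - 1)) * (\<Sum>z\<in>\<Omega>. maxf g z powr p)"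
proof -
  have T_sum: "T (\<lambda>z. \<Sum>i\<in>I. F i z) \<le> (\<Sum>i\<in>I. T (F i))" if "finite I" for I :: "'c set" and F
    using that
  proof (induction I)
    case (insert i I)
    then show ?case using T_add[of "F i" "\<lambda>z. \<Sum>i\<in>I. F i z"] by simp
  qed (simp add: T_zero)
  define X where "X t = {z\<in>\<Omega>. t < maxf g z}" for t
  have layer: "T (layer g t) \<le> C * R * 4 powr p * (t powr p * real (card (X t)))" if t: "0 < t" for t
  proof -
    let ?a = "\<lambda>Q z. if z \<in> Q then layer g t z else 0"
    have atom: "T (?a Q) \<le> C * real (card Q) * (4 * t) powr p" if Q: "Q \<in> stopping_cells g t" for Q
    proof -
      obtain n z where Qn: "Q = cell n z" "n < K" "z \<in> \<Omega>"
        using Q unfolding stopping_cells_def by blast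
      have "(\<Sum>w\<in>Q. ?a Q w) = 0"
        using sum_layer_stopping_cell[OF Q] by simp
      moreover have "cmod (?a Q w) \<le> 4 * t" for w
        using cmod_layer_le[of w t g] t Qn cell_subset[of n z] by auto
      ultimately show ?thesis
        unfolding Qn(1) by (intro T_atom Qn) (auto simp: Qn(1))
    qed
    have "T (layer g t) = T (\<lambda>z. \<Sum>Q\<in>stopping_cells g t. ?a Q z)"
      by (rule T_cong) (rule layer_eq_sum_atoms)
    also have "\<dots> \<le> (\<Sum>Q\<in>stopping_cells g t. T (?a Q))"
      by (rule T_sum) (rule finite_stopping_cells)
    also have "\<dots> \<le> (\<Sum>Q\<in>stopping_cells g t. C * (R * real (card {w\<in>Q. t < maxf g w})) * (4 * t) powr p)"
    proof (rule sum_mono)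
      fix Q assume Q: "Q \<in> stopping_cells g t"
      show "T (?a Q) \<le> C * (R * real (card {w\<in>Q. t < maxf g w})) * (4 * t) powr p"
        using atom[OF Q] card_stopping_cell_le[OF Q R] C
        by (meson mult_left_mono mult_right_mono order_trans powr_ge_zero)
    qed
    also have "\<dots> = C * R * (4 * t) powr p * (\<Sum>Q\<in>stopping_cells g t. real (card {w\<in>Q. t < maxf g w}))"
      by (simp add: sum_distrib_left mult_ac)
    finally have bound: "T (layer g t) \<le> \<dots>" .
    have "(\<Sum>Q\<in>stopping_cells g t. real (card {w\<in>Q. t < maxf g w}))
        = real (card (\<Union>Q\<in>stopping_cells g t. {w\<in>Q. t < maxf g w}))"
    proof (subst card_UN_disjoint)
      show "\<forall>Q\<in>stopping_cells g t. finite {w \<in> Q. t < maxf g w}"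
        unfolding stopping_cells_def by auto
      show "\<forall>Q\<in>stopping_cells g t. \<forall>Q'\<in>stopping_cells g t.
          Q \<noteq> Q' \<longrightarrow> {w \<in> Q. t < maxf g w} \<inter> {w \<in> Q'. t < maxf g w} = {}"
        using stopping_cells_disjoint by fastforce
    qed (use finite_stopping_cells in auto)
    also have "\<dots> \<le> real (card (X t))"
    proof -
      have "(\<Union>Q\<in>stopping_cells g t. {w\<in>Q. t < maxf g w}) \<subseteq> X t"
        unfolding X_def stopping_cells_def using cell_subset by auto
      then show ?thesis using fin by (simp add: X_def card_mono)
    qed
    finally have "C * R * (4 * t) powr p * (\<Sum>Q\<in>stopping_cells g t. real (card {w\<in>Q. t < maxf g w}))
        \<le> C * R * (4 * t) powr p * real (card (X t))"
      using C R by (intro mult_left_mono) auto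
    with bound show ?thesis using t by (simp add: powr_mult mult_ac)
  qed

  \<comment> \<open>The martingale takes finitely many values, so the dyadic heights can start below the smallest
      nonzero modulus and stop above the largest one.\<close>
  define V where "V = (\<lambda>(k, w). cmod (cexp k g w)) ` ({..K} \<times> \<Omega>)"
  have fV: "finite V" unfolding V_def using fin by simp
  define \<theta> where "\<theta> = Min (insert 1 {v\<in>V. 0 < v}) / 2"
  have mpos: "0 < Min (insert 1 {v\<in>V. 0 < v})"
    using fV by (subst Min_gr_iff) auto
  then have \<theta>: "0 < \<theta>" unfolding \<theta>_def by simp
  have lo: "cexp k g w = 0" if "k \<le> K" "w \<in> \<Omega>" "cmod (cexp k g w) \<le> \<theta>" for k w
  proof (rule ccontr)
    assume "cexp k g w \<noteq> 0"
    then have "cmod (cexp k g w) \<in> insert 1 {v\<in>V. 0 < v}"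
      unfolding V_def using that by auto
    then have "Min (insert 1 {v\<in>V. 0 < v}) \<le> cmod (cexp k g w)"
      using fV by (intro Min_le) auto
    then show False using that(3) mpos unfolding \<theta>_def by simp
  qed
  obtain J where J: "Max (insert 0 V) / \<theta> < 2 ^ J"
    using real_arch_pow[of 2 "Max (insert 0 V) / \<theta>"] by auto
  have hi: "cmod (cexp k g w) \<le> \<theta> * 2 ^ J" if "k \<le> K" "w \<in> \<Omega>" for k w
  proof -
    have "cmod (cexp k g w) \<le> Max (insert 0 V)"
      using fV that by (intro Max_ge) (auto simp: V_def)
    also have "\<dots> \<le> \<theta> * 2 ^ J" using J \<theta> by (simp add: field_simps)
    finally show ?thesis .
  qed
  have "T g = T (\<lambda>z. cexp 0 g z + (\<Sum>j<J. layer g (\<theta> * 2 ^ j) z))"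
  proof (rule T_cong)
    fix z assume "z \<in> \<Omega>"
    then show "g z = cexp 0 g z + (\<Sum>j<J. layer g (\<theta> * 2 ^ j) z)"
    proof (rule sum_layers)
      show "0 \<le> \<theta>" using \<theta> by simp
    qed (fact lo hi)+
  qed
  also have "\<dots> \<le> T (cexp 0 g) + (\<Sum>j<J. T (layer g (\<theta> * 2 ^ j)))"
    using T_add[of "cexp 0 g" "\<lambda>z. \<Sum>j<J. layer g (\<theta> * 2 ^ j) z"]
      T_sum[of "{..<J}" "\<lambda>j. layer g (\<theta> * 2 ^ j)"] by simp
  finally have split: "T g \<le> \<dots>" .
  have bottom: "T (cexp 0 g) \<le> C * (\<Sum>z\<in>\<Omega>. maxf g z powr p)"
  proof (cases "\<Omega> = {}")
    case True
    have "T (cexp 0 g) = T (\<lambda>z. 0)"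
      by (rule T_cong) (use True in blast)
    also have "\<dots> = 0" by (rule T_zero)
    also have "\<dots> \<le> C * (\<Sum>z\<in>\<Omega>. maxf g z powr p)"
      by (rule mult_nonneg_nonneg[OF C]) (rule sum_nonneg, rule powr_ge_zero)
    finally show ?thesis .
  next
    case False
    then obtain z0 where z0: "z0 \<in> \<Omega>" by blast
    have const: "cexp 0 g z = cexp 0 g z0" if "z \<in> \<Omega>" for z
      using that trivial_bottom[OF that z0] by (intro cexp_cell) (simp add: cell_def)
    have "T (cexp 0 g) = T (\<lambda>z. cexp 0 g z0)" by (rule T_cong) (rule const)
    also have "\<dots> \<le> C * (\<Sum>z\<in>\<Omega>. cmod (cexp 0 g z0) powr p)"
      using T_const by (simp add: mult_ac)
    also have "\<dots> \<le> C * (\<Sum>z\<in>\<Omega>. maxf g z powr p)"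
    proof (intro mult_left_mono sum_mono powr_mono2)
      fix z assume "z \<in> \<Omega>"
      then show "cmod (cexp 0 g z0) \<le> maxf g z"
        using const[of z] cmod_cexp_le_maxf[of 0 g z] by simp
    qed (use p C in auto)
    finally show ?thesis .
  qed
  have "(\<Sum>j<J. T (layer g (\<theta> * 2 ^ j)))
      \<le> (\<Sum>j<J. C * R * 4 powr p * ((\<theta> * 2 ^ j) powr p * real (card (X (\<theta> * 2 ^ j)))))"
    using \<theta> by (intro sum_mono layer) simp
  also have "\<dots> = C * R * 4 powr p * (\<Sum>j<J. \<Sum>z\<in>\<Omega>. if \<theta> * 2 ^ j < maxf g z then (\<theta> * 2 ^ j) powr p else 0)"
  proof -
    have "(\<theta> * 2 ^ j) powr p * real (card (X (\<theta> * 2 ^ j)))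
        = (\<Sum>z\<in>\<Omega>. if \<theta> * 2 ^ j < maxf g z then (\<theta> * 2 ^ j) powr p else 0)" for j
      unfolding X_def using fin by (subst sum.inter_filter[symmetric]) auto
    then show ?thesis by (simp add: sum_distrib_left)
  qed
  also have "\<dots> = C * R * 4 powr p * (\<Sum>z\<in>\<Omega>. \<Sum>j<J. if \<theta> * 2 ^ j < maxf g z then (\<theta> * 2 ^ j) powr p else 0)"
    by (subst sum.swap) simp
  also have "\<dots> \<le> C * R * 4 powr p * (\<Sum>z\<in>\<Omega>. (2 * maxf g z) powr p / (2 powr p - 1))"
  proof (intro mult_left_mono sum_mono)
    fix z
    have "(\<Sum>j<J. if \<theta> * 2 ^ j < maxf g z then (\<theta> * 2 ^ j) powr p else 0)
        = (\<Sum>j | j < J \<and> \<theta> * 2 ^ j < maxf g z. (\<theta> * 2 ^ j) powr p)"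
      by (subst sum.inter_filter[symmetric]) (auto intro!: sum.cong)
    then show "(\<Sum>j<J. if \<theta> * 2 ^ j < maxf g z then (\<theta> * 2 ^ j) powr p else 0)
        \<le> (2 * maxf g z) powr p / (2 powr p - 1)"
      using geometric_threshold_sum[OF \<theta> p maxf_nonneg] by simp
  qed (use C R in auto)
  also have "\<dots> = C * (R * 8 powr p / (2 powr p - 1)) * (\<Sum>z\<in>\<Omega>. maxf g z powr p)"
  proof -
    have "(8::real) powr p = 4 powr p * 2 powr p" by (subst powr_mult[symmetric]) auto
    moreover have "(\<Sum>z\<in>\<Omega>. (2 * maxf g z) powr p / (2 powr p - 1))
        = 2 powr p / (2 powr p - 1) * (\<Sum>z\<in>\<Omega>. maxf g z powr p)"
      using maxf_nonneg by (simp add: powr_mult sum_distrib_left)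
    ultimately show ?thesis by simp
  qed
  finally have "(\<Sum>j<J. T (layer g (\<theta> * 2 ^ j))) \<le> \<dots>" .
  with split bottom show ?thesis by (simp add: algebra_simps)
qed

end

section \<open>Vilenkin characters and the Dirichlet kernel on residues\<close>

lemma sum_shift_lessThan:
  fixes f :: "nat \<Rightarrow> 'a::comm_monoid_add"
  shows "sum f {c..<c + n} = (\<Sum>b<n. f (c + b))"
  by (induction n) (simp_all add: add.commute)

text \<open>
  Residues modulo \<open>M K\<close> stand for points of the group through their digits, and also for frequencies.
  This makes the character table symmetric (\<open>chr_sym\<close>), so that orthogonality in the point and
  orthogonality in the frequency are one fact.
\<close>
locale vilenkin =
  fixes m :: "nat \<Rightarrow> nat"
  assumes m_ge_2: "\<And>k. 2 \<le> m k"
begin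

abbreviation M :: "nat \<Rightarrow> nat" where "M \<equiv> vilenkin_base m"
abbreviation dig :: "nat \<Rightarrow> nat \<Rightarrow> nat" where "dig \<equiv> vilenkin_digit m"

definition chr :: "nat \<Rightarrow> nat \<Rightarrow> complex" where
  "chr n u = vilenkin_fun m n (dig u)"

definition kernel :: "nat \<Rightarrow> nat \<Rightarrow> nat \<Rightarrow> complex" where
  "kernel n x t = (\<Sum>i<n. chr i x * cnj (chr i t))"

lemma m_pos: "0 < m k"
  using m_ge_2[of k] by simp

lemma M_0 [simp]: "M 0 = 1"
  by (simp add: vilenkin_base_def)

lemma M_pos: "0 < M k"
  using vilenkin_base_gt[of m k, OF m_ge_2] by simp

lemma M_dvd: "j \<le> k \<Longrightarrow> M j dvd M k"
  unfolding vilenkin_base_def by (intro prod_dvd_prod_subset) auto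

lemma M_mono: "j \<le> k \<Longrightarrow> M j \<le> M k"
  by (rule dvd_imp_le[OF M_dvd M_pos])

lemma dig_less: "dig n k < m k"
  by (rule vilenkin_digit_less) (rule m_ge_2)

lemma dig_eq_0: "n < M R \<Longrightarrow> R \<le> k \<Longrightarrow> dig n k = 0"
  using less_le_trans[OF _ M_mono, of n R k] by (simp add: vilenkin_digit_def)

lemma dig_mod:
  assumes "k < R" shows "dig (n mod M R) k = dig n k"
proof -
  obtain c where c: "M R = M (Suc k) * c"
    using M_dvd[of "Suc k" R] assms by (auto elim: dvdE)
  have "n mod M R div M k = n div M k mod (m k * c)"
    unfolding c vilenkin_base_Suc mult.commute[of "m k"] mult.assoc mod_mult2_eq
    using M_pos[of k] by simp
  then show ?thesis
    by (simp add: vilenkin_digit_def mod_mod_cancel)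
qed

lemma dig_mod': "R \<le> k \<Longrightarrow> dig (n mod M R) k = 0"
  using M_pos[of R] by (intro dig_eq_0) auto

text \<open>Together with \<open>dig_mod\<close> this splits the digits of \<open>n\<close> at position \<open>R\<close>.\<close>
lemma dig_high:
  "dig (n div M R * M R) k = (if k < R then 0 else dig n k)"
proof (cases "k < R")
  case True
  then obtain c where c: "M R = M (Suc k) * c"
    using M_dvd[of "Suc k" R] by (auto elim: dvdE)
  have "n div M R * M R = M k * (m k * (c * (n div M R)))"
    by (subst (2) c) (simp add: vilenkin_base_Suc mult_ac)
  then have "n div M R * M R div M k = m k * (c * (n div M R))"
    using M_pos[of k] by (metis nonzero_mult_div_cancel_left not_less0)
  then show ?thesis using True by (simp add: vilenkin_digit_def)
next
  case False
  then obtain c where c: "M k = M R * c"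
    using M_dvd[of R k] by (auto elim: dvdE)
  have "n div M R * M R div M k = n div M R div c"
    unfolding c div_mult2_eq using M_pos[of R] by simp
  also have "\<dots> = n div M k" unfolding c div_mult2_eq ..
  finally show ?thesis using False by (simp add: vilenkin_digit_def)
qed

lemma mod_M_eq_iff: "u mod M R = t mod M R \<longleftrightarrow> (\<forall>k<R. dig u k = dig t k)"
proof
  assume "u mod M R = t mod M R"
  then show "\<forall>k<R. dig u k = dig t k" using dig_mod by metis
next
  assume "\<forall>k<R. dig u k = dig t k"
  then have "(\<Sum>j<R. dig u j * M j) = (\<Sum>j<R. dig t j * M j)" by simp
  then show "u mod M R = t mod M R" by (simp only: vilenkin_expansion_mod)
qed

lemma mod_M_antimono:
  assumes "j \<le> k" "u mod M k = t mod M k" shows "u mod M j = t mod M j"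
  using assms M_dvd[OF assms(1)] by (metis mod_mod_cancel)

text \<open>The map from residues modulo \<open>M R\<close> to their digits is a bijection onto the product of digit sets.\<close>
lemma sum_prod_digits:
  fixes h :: "nat \<Rightarrow> nat \<Rightarrow> 'b::comm_semiring_1"
  shows "(\<Sum>i<M R. \<Prod>k<R. h k (dig i k)) = (\<Prod>k<R. \<Sum>d<m k. h k d)"
proof (induction R)
  case (Suc R)
  have "(\<Sum>i<M (Suc R). \<Prod>k<Suc R. h k (dig i k))
      = (\<Sum>d<m R. \<Sum>b<M R. \<Prod>k<Suc R. h k (dig (d * M R + b) k))"
    unfolding vilenkin_base_Suc sum.nat_group[symmetric] sum_shift_lessThan ..
  also have "\<dots> = (\<Sum>d<m R. \<Sum>b<M R. (\<Prod>k<R. h k (dig b k)) * h R d)"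
  proof (intro sum.cong refl)
    fix d b assume d: "d \<in> {..<m R}" and b: "b \<in> {..<M R}"
    have "dig (d * M R + b) k = dig b k" if "k < R" for k
      using dig_mod[OF that, of "d * M R + b"] dig_mod[OF that, of b] by simp
    then have "(\<Prod>k<R. h k (dig (d * M R + b) k)) = (\<Prod>k<R. h k (dig b k))"
      by (intro prod.cong) auto
    moreover have "dig (d * M R + b) R = d"
      using d b M_pos[of R] by (simp add: vilenkin_digit_def)
    ultimately show "(\<Prod>k<Suc R. h k (dig (d * M R + b) k)) = (\<Prod>k<R. h k (dig b k)) * h R d"
      by (simp only: prod.lessThan_Suc)
  qed
  also have "\<dots> = (\<Prod>k<R. \<Sum>d<m k. h k d) * (\<Sum>d<m R. h R d)"
    unfolding Suc[symmetric] sum_product by (rule sum.swap)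
  finally show ?case by (simp only: prod.lessThan_Suc)
qed simp

lemma chr_prod:
  assumes "n < M K"
  shows "chr n u = (\<Prod>k<K. exp (2 * of_real pi * \<i> * of_nat (dig u k) / of_nat (m k)) ^ dig n k)"
proof -
  have "{k. dig n k \<noteq> 0} \<subseteq> {..<K}"
  proof
    fix k assume "k \<in> {k. dig n k \<noteq> 0}"
    then have "\<not> K \<le> k" using dig_eq_0[OF assms, of k] by (metis mem_Collect_eq)
    then show "k \<in> {..<K}" by simp
  qed
  then have "(\<Prod>k | dig n k \<noteq> 0. rademacher m k (dig u) ^ dig n k)
      = (\<Prod>k<K. rademacher m k (dig u) ^ dig n k)"
    by (intro prod.mono_neutral_left) auto
  then show ?thesis by (simp add: chr_def vilenkin_fun_def rademacher_def)
qed

lemma M_unbounded: "\<exists>K. n < M K"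
  using vilenkin_base_gt[of m n, OF m_ge_2] by blast

lemma norm_root_of_unity: "cmod (exp (2 * of_real pi * \<i> * of_nat a / of_nat b)) = 1"
proof -
  have "2 * of_real pi * \<i> * of_nat a / of_nat b = \<i> * complex_of_real (2 * pi * a / b)"
    by simp
  then show ?thesis by (simp only: norm_exp_i_times)
qed

lemma cmod_chr [simp]: "cmod (chr n u) = 1"
proof -
  obtain K where K: "n < M K" using M_unbounded by blast
  show ?thesis
    unfolding chr_prod[OF K] prod_norm[symmetric] norm_power norm_root_of_unity by simp
qed

lemma chr_cnj_self [simp]: "chr n u * cnj (chr n u) = 1" "cnj (chr n u) * chr n u = 1"
proof -
  show "chr n u * cnj (chr n u) = 1"
    by (rule trans[OF complex_norm_square[symmetric]]) simp
  then show "cnj (chr n u) * chr n u = 1" by (simp only: mult.commute)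
qed

lemma chr_sym: "chr n u = chr u n"
proof -
  obtain K where K: "max n u < M K" using M_unbounded by blast
  have swap: "exp (2 * of_real pi * \<i> * of_nat a / of_nat c) ^ b
      = exp (2 * of_real pi * \<i> * of_nat b / of_nat c) ^ a" for a b c
    by (simp add: exp_of_nat_mult[symmetric] mult_ac)
  from K have n: "n < M K" and u: "u < M K" by simp_all
  show ?thesis
    unfolding chr_prod[OF n] chr_prod[OF u] by (rule prod.cong[OF refl swap])
qed

lemma chr_mod:
  assumes "n < M R" shows "chr n (u mod M R) = chr n u"
  unfolding chr_prod[OF assms] by (intro prod.cong) (auto simp: dig_mod)

lemma chr_split: "chr n u = chr (n div M R * M R) u * chr (n mod M R) u"
proof -
  obtain K where K: "max n (M R) < M K" using M_unbounded by blast
  have n1: "n div M R * M R < M K"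
    using K by (metis div_times_less_eq_dividend le_less_trans max_less_iff_conj)
  have n2: "n mod M R < M K"
    using K M_pos[of R] by (meson less_trans max_less_iff_conj mod_less_divisor)
  have n3: "n < M K" using K by simp
  have eq: "dig n k = dig (n div M R * M R) k + dig (n mod M R) k" for k
    by (cases "k < R") (simp_all add: dig_high dig_mod dig_mod')
  then show ?thesis
    unfolding chr_prod[OF n1] chr_prod[OF n2] chr_prod[OF n3] prod.distrib[symmetric] power_add[symmetric]
    by (intro prod.cong refl arg_cong[where f = "\<lambda>j. _ ^ j"] eq)
qed

text \<open>
  The sum factors over the coordinates. At a coordinate where \<open>x\<close> and \<open>t\<close> differ, the factor is the sum
  of all powers of a nontrivial root of unity.
\<close>
lemma sum_chr_eq_0:
  assumes "x mod M R \<noteq> t mod M R"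
  shows "(\<Sum>i<M R. chr i x * cnj (chr i t)) = 0"
proof -
  define \<rho> where "\<rho> k a = exp (2 * of_real pi * \<i> * of_nat a / of_nat (m k))" for k a
  define \<omega> where "\<omega> k = \<rho> k (dig x k) * cnj (\<rho> k (dig t k))" for k
  have unit: "\<rho> k a * cnj (\<rho> k a) = 1" for k a
    unfolding \<rho>_def by (rule trans[OF complex_norm_square[symmetric]]) (simp only: norm_root_of_unity, simp)
  have root: "\<rho> k a ^ m k = 1" for k a
    unfolding \<rho>_def using m_pos[of k] by (intro complex_root_unity) simp
  have "(\<Sum>i<M R. chr i x * cnj (chr i t)) = (\<Sum>i<M R. \<Prod>k<R. \<omega> k ^ dig i k)"
  proof (intro sum.cong refl)
    fix i assume "i \<in> {..<M R}"
    then have i: "i < M R" by simp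
    show "chr i x * cnj (chr i t) = (\<Prod>k<R. \<omega> k ^ dig i k)"
      unfolding chr_prod[OF i] cnj_prod complex_cnj_power prod.distrib[symmetric]
        power_mult_distrib[symmetric] \<omega>_def \<rho>_def ..
  qed
  also have "\<dots> = (\<Prod>k<R. \<Sum>d<m k. \<omega> k ^ d)"
    by (rule sum_prod_digits)
  also have "\<dots> = 0"
  proof -
    obtain k where k: "k < R" "dig x k \<noteq> dig t k"
      using assms mod_M_eq_iff[of x R t] by blast
    have "\<omega> k \<noteq> 1"
    proof
      assume "\<omega> k = 1"
      then have "\<rho> k (dig x k) * (cnj (\<rho> k (dig t k)) * \<rho> k (dig t k)) = \<rho> k (dig t k)"
        unfolding \<omega>_def by (simp add: mult.assoc[symmetric])
      then have "\<rho> k (dig x k) = \<rho> k (dig t k)"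
        using unit[of k "dig t k"] by (simp add: mult.commute)
      then have "dig x k mod m k = dig t k mod m k"
        unfolding \<rho>_def using m_pos[of k] by (subst (asm) complex_root_unity_eq) auto
      then show False using k(2) dig_less by simp
    qed
    moreover have "\<omega> k ^ m k = 1"
      unfolding \<omega>_def power_mult_distrib complex_cnj_power[symmetric] root by simp
    ultimately have "(\<Sum>d<m k. \<omega> k ^ d) = 0"
      by (simp add: geometric_sum)
    then show ?thesis using k(1) by (intro prod_zero) auto
  qed
  finally show ?thesis .
qed

lemma chr_cong:
  assumes "n \<le> M N" "i < n" "t mod M N = s mod M N"
  shows "chr i t = chr i s"
  using chr_mod[of i N] assms by (metis less_le_trans)

text \<open>
  Write \<open>n = c * M R + b\<close> with \<open>b < M R\<close>. The complete blocks of the kernel cancel by \<open>sum_chr_eq_0\<close>.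
  In the incomplete block, the characters of index below \<open>M R\<close> do not distinguish the points of \<open>J\<close>, and
  the common factor of index \<open>c * M R\<close> differs from the character of index \<open>n\<close> only by such a
  character. So on \<open>J\<close> the kernel is a multiple of that character, with a factor at most \<open>M R\<close>.
\<close>
lemma kernel_block:
  assumes R: "R \<le> N" and J: "\<And>t. t \<in> J \<Longrightarrow> t mod M N = t0 mod M N"
    and x: "x mod M R \<noteq> t0 mod M R"
  shows "cmod (\<Sum>t\<in>J. h t * kernel n x t) \<le> real (M R) * cmod (\<Sum>t\<in>J. h t * cnj (chr n t))"
proof -
  define P where "P = M R"
  define c where "c = n div P"
  define b where "b = n mod P"
  have b: "b < P" unfolding b_def P_def using M_pos by simp
  define G where "G = (\<Sum>i<b. chr i x * cnj (chr i t0))"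
  have split: "chr (a * P + i) u = chr (a * P) u * chr i u" if "i < P" for a i u
    using chr_split[of "a * P + i" u R] that M_pos[of R] unfolding P_def by simp
  have ker: "h t * kernel n x t = chr (c * P) x * G * chr b t0 * (h t * cnj (chr n t))" if t: "t \<in> J" for t
  proof -
    have tR: "t mod M R = t0 mod M R" using mod_M_antimono[OF R J[OF t]] .
    have block: "(\<Sum>i<k. chr (a * P + i) x * cnj (chr (a * P + i) t))
        = chr (a * P) x * cnj (chr (a * P) t) * (\<Sum>i<k. chr i x * cnj (chr i t))" if "k \<le> P" for a k
      unfolding sum_distrib_left
    proof (intro sum.cong refl)
      fix i assume "i \<in> {..<k}"
      then have i: "i < P" using that by simp
      show "chr (a * P + i) x * cnj (chr (a * P + i) t)
          = chr (a * P) x * cnj (chr (a * P) t) * (chr i x * cnj (chr i t))"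
        unfolding split[OF i] complex_cnj_mult by (simp only: mult_ac)
    qed
    have "n = c * P + b" unfolding c_def b_def by simp
    then have "kernel n x t = (\<Sum>i<c * P. chr i x * cnj (chr i t)) + (\<Sum>i<b. chr (c * P + i) x * cnj (chr (c * P + i) t))"
      unfolding kernel_def sum_shift_lessThan[symmetric, where f = "\<lambda>i. chr i x * cnj (chr i t)"]
      by (simp only: lessThan_atLeast0 sum.atLeastLessThan_concat[OF le0 le_add1])
    also have "(\<Sum>i<c * P. chr i x * cnj (chr i t))
        = (\<Sum>a<c. \<Sum>i<P. chr (a * P + i) x * cnj (chr (a * P + i) t))"
      unfolding sum.nat_group[symmetric] sum_shift_lessThan ..
    also have "\<dots> = 0"
      using sum_chr_eq_0[of x R t] x tR by (simp add: block P_def[symmetric])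
    also have "(\<Sum>i<b. chr (c * P + i) x * cnj (chr (c * P + i) t)) = chr (c * P) x * cnj (chr (c * P) t) * G"
    proof -
      have "(\<Sum>i<b. chr i x * cnj (chr i t)) = G"
        unfolding G_def using chr_cong[of P R _ t t0] tR b unfolding P_def by (intro sum.cong) auto
      then show ?thesis using block[of b c] b by simp
    qed
    finally have 1: "kernel n x t = chr (c * P) x * cnj (chr (c * P) t) * G" by simp
    have "chr n t = chr (c * P) t * chr b t0"
      using chr_split[of n t R] chr_cong[of P R b t t0] tR b unfolding c_def b_def P_def by simp
    then have "cnj (chr n t) * chr b t0 = cnj (chr (c * P) t) * (cnj (chr b t0) * chr b t0)"
      by (simp add: mult_ac)
    then have 2: "cnj (chr n t) * chr b t0 = cnj (chr (c * P) t)" by simp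
    show ?thesis unfolding 1 2[symmetric] by (simp add: mult_ac)
  qed
  have "(\<Sum>t\<in>J. h t * kernel n x t) = chr (c * P) x * G * chr b t0 * (\<Sum>t\<in>J. h t * cnj (chr n t))"
    unfolding sum_distrib_left using ker by (rule sum.cong[OF refl])
  then have "cmod (\<Sum>t\<in>J. h t * kernel n x t) = cmod G * cmod (\<Sum>t\<in>J. h t * cnj (chr n t))"
    by (simp add: norm_mult)
  also have "cmod G \<le> real P"
  proof -
    have "cmod G \<le> (\<Sum>i<b. cmod (chr i x * cnj (chr i t0)))" unfolding G_def by (rule norm_sum)
    also have "\<dots> = real b" by (simp add: norm_mult)
    finally show ?thesis using b by simp
  qed
  finally show ?thesis unfolding P_def by (simp add: mult_right_mono)
qed

lemma parseval:
  "(\<Sum>n<M K. (cmod (\<Sum>t<M K. h t * cnj (chr n t)))\<^sup>2) = real (M K) * (\<Sum>t<M K. (cmod (h t))\<^sup>2)"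
proof -
  have orth: "(\<Sum>n<M K. cnj (chr n t) * chr n s) = (if s = t then of_nat (M K) else 0)"
    if "t < M K" "s < M K" for t s
    using sum_chr_eq_0[of s K t] that by (auto simp: mult.commute)
  have "complex_of_real (\<Sum>n<M K. (cmod (\<Sum>t<M K. h t * cnj (chr n t)))\<^sup>2)
      = (\<Sum>n<M K. (\<Sum>t<M K. h t * cnj (chr n t)) * cnj (\<Sum>t<M K. h t * cnj (chr n t)))"
    by (simp only: of_real_sum complex_norm_square)
  also have "\<dots> = (\<Sum>n<M K. \<Sum>t<M K. \<Sum>s<M K. h t * cnj (h s) * (cnj (chr n t) * chr n s))"
    by (simp add: sum_product cnj_sum mult_ac)
  also have "\<dots> = (\<Sum>t<M K. \<Sum>s<M K. \<Sum>n<M K. h t * cnj (h s) * (cnj (chr n t) * chr n s))"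
    by (subst sum.swap) (rule sum.cong[OF refl], rule sum.swap)
  also have "\<dots> = (\<Sum>t<M K. \<Sum>s<M K. if s = t then h t * cnj (h s) * of_nat (M K) else 0)"
    by (intro sum.cong refl) (simp add: sum_distrib_left[symmetric] orth)
  also have "\<dots> = (\<Sum>t<M K. h t * cnj (h t) * of_nat (M K))"
    by (intro sum.cong refl) (simp add: sum.delta)
  also have "\<dots> = complex_of_real (real (M K) * (\<Sum>t<M K. (cmod (h t))\<^sup>2))"
    by (simp add: complex_norm_square sum_distrib_left mult_ac del: of_real_power)
  finally show ?thesis by (simp only: of_real_eq_iff)
qed

text \<open>The kernel acts as \<open>M K\<close> times an orthogonal projection; both steps are Parseval's identity.\<close>
lemma sum_kernel_l2_le:
  assumes "n \<le> M K"
  shows "(\<Sum>x<M K. (cmod (\<Sum>t<M K. h t * kernel n x t))\<^sup>2) \<le> (real (M K))\<^sup>2 * (\<Sum>t<M K. (cmod (h t))\<^sup>2)"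
proof -
  define c where "c i = (\<Sum>t<M K. h t * cnj (chr i t))" for i
  define d where "d i = (if i < n then cnj (c i) else 0)" for i
  have "(\<Sum>t<M K. h t * kernel n x t) = cnj (\<Sum>i<M K. d i * cnj (chr x i))" for x
  proof -
    have "(\<Sum>t<M K. h t * kernel n x t) = (\<Sum>i<n. \<Sum>t<M K. h t * (chr i x * cnj (chr i t)))"
      unfolding kernel_def sum_distrib_left by (rule sum.swap)
    also have "\<dots> = (\<Sum>i<n. c i * chr i x)"
      unfolding c_def sum_distrib_right by (simp add: mult_ac)
    also have "\<dots> = (\<Sum>i<M K. if i < n then c i * chr i x else 0)"
      using assms by (intro sum.mono_neutral_cong_left) auto
    also have "\<dots> = cnj (\<Sum>i<M K. d i * cnj (chr x i))"
      unfolding cnj_sum d_def by (intro sum.cong refl) (simp add: chr_sym[of x])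
    finally show ?thesis .
  qed
  then have "(\<Sum>x<M K. (cmod (\<Sum>t<M K. h t * kernel n x t))\<^sup>2)
      = real (M K) * (\<Sum>i<M K. (cmod (d i))\<^sup>2)"
    by (simp only: complex_mod_cnj parseval)
  also have "\<dots> \<le> real (M K) * (\<Sum>i<M K. (cmod (c i))\<^sup>2)"
    by (intro mult_left_mono sum_mono) (auto simp: d_def)
  also have "\<dots> = (real (M K))\<^sup>2 * (\<Sum>t<M K. (cmod (h t))\<^sup>2)"
    unfolding c_def parseval by (simp add: power2_eq_square)
  finally show ?thesis .
qed

end

section \<open>Partial sums of a function supported in one square\<close>

context vilenkin begin

definition residue_class :: "nat \<Rightarrow> nat \<Rightarrow> nat \<Rightarrow> nat set" where
  "residue_class K N t0 = {t. t < M K \<and> t mod M N = t0 mod M N}"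

lemma finite_residue_class [simp]: "finite (residue_class K N t0)"
  by (simp add: residue_class_def)

lemma card_residue_class:
  assumes "N \<le> K"
  shows "real (card (residue_class K N t0)) = real (M K) / real (M N)"
proof -
  define P where "P = M N"
  have P: "0 < P" unfolding P_def by (rule M_pos)
  obtain L where L: "M K = P * L" using M_dvd[OF assms] unfolding P_def by (auto elim: dvdE)
  have "bij_betw (\<lambda>c. c * P + t0 mod P) {..<L} (residue_class K N t0)"
  proof (rule bij_betwI[where g = "\<lambda>t. t div P"])
    show "(\<lambda>c. c * P + t0 mod P) \<in> {..<L} \<rightarrow> residue_class K N t0"
    proof
      fix c assume "c \<in> {..<L}"
      then have "Suc c * P \<le> L * P" by (intro mult_right_mono) auto
      moreover have "t0 mod P < P" using P by simp
      ultimately have "c * P + t0 mod P < M K" by (simp add: L mult.commute[of P])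
      then show "c * P + t0 mod P \<in> residue_class K N t0"
        using P by (simp add: residue_class_def P_def[symmetric])
    qed
    show "(\<lambda>t. t div P) \<in> residue_class K N t0 \<rightarrow> {..<L}"
      using P by (auto simp: residue_class_def L less_mult_imp_div_less mult.commute)
    fix t assume "t \<in> residue_class K N t0"
    then have "t mod P = t0 mod P" by (simp add: residue_class_def P_def)
    then show "t div P * P + t0 mod P = t" by (metis div_mult_mod_eq)
  qed (use P in auto)
  then have "card (residue_class K N t0) = L"
    using bij_betw_same_card by fastforce
  then show ?thesis using P by (simp add: L P_def[symmetric])
qed

text \<open>
  A majorant of the \<open>p\<close>-th power of the kernel outside the cylinder of \<open>t0\<close>. If \<open>r\<close> is the last level
  with \<open>x mod M r = t0 mod M r\<close>, then the term of index \<open>r\<close> bounds the kernel at \<open>x\<close>. The sum over all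
  levels up to \<open>r\<close> is easy to integrate.
\<close>
definition off_weight :: "real \<Rightarrow> nat \<Rightarrow> nat \<Rightarrow> nat \<Rightarrow> real" where
  "off_weight p N t0 x = (\<Sum>r<N. if x mod M r = t0 mod M r then real (M (Suc r)) powr p else 0)"

text \<open>The mean value of \<open>off_weight\<close> (see \<open>sum_off_weight\<close>).\<close>
definition off_mass :: "real \<Rightarrow> nat \<Rightarrow> real" where
  "off_mass p N = (\<Sum>r<N. real (M (Suc r)) powr p / real (M r))"

lemma off_weight_nonneg: "0 \<le> off_weight p N t0 x"
  unfolding off_weight_def by (intro sum_nonneg) auto

lemma off_mass_nonneg: "0 \<le> off_mass p N"
  unfolding off_mass_def by (intro sum_nonneg) auto

lemma sum_off_weight:
  assumes "N \<le> K"
  shows "(\<Sum>x<M K. off_weight p N t0 x) = real (M K) * off_mass p N"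
proof -
  have "(\<Sum>x<M K. off_weight p N t0 x)
      = (\<Sum>r<N. \<Sum>x<M K. if x mod M r = t0 mod M r then real (M (Suc r)) powr p else 0)"
    unfolding off_weight_def by (rule sum.swap)
  also have "\<dots> = (\<Sum>r<N. real (M K) * (real (M (Suc r)) powr p / real (M r)))"
  proof (intro sum.cong refl)
    fix r assume "r \<in> {..<N}"
    then have r: "r \<le> K" using assms by simp
    have "{x \<in> {..<M K}. x mod M r = t0 mod M r} = residue_class K r t0"
      by (auto simp: residue_class_def)
    then show "(\<Sum>x<M K. if x mod M r = t0 mod M r then real (M (Suc r)) powr p else 0)
        = real (M K) * (real (M (Suc r)) powr p / real (M r))"
      using card_residue_class[OF r, of t0]
      by (subst sum.inter_filter[symmetric]) simp_all
  qed
  finally show ?thesis unfolding off_mass_def sum_distrib_left .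
qed

lemma sum_supported_residue_class:
  assumes "\<And>t. t \<notin> residue_class K N t0 \<Longrightarrow> h t = (0::complex)"
  shows "(\<Sum>t<M K. h t * g t) = (\<Sum>t\<in>residue_class K N t0. h t * g t)"
  by (rule sum.mono_neutral_right) (use assms in \<open>auto simp: residue_class_def\<close>)

text \<open>The result \<open>kernel_block\<close>, applied at the first level \<open>R = Suc r\<close> at which \<open>x\<close> leaves the class of \<open>t0\<close>.\<close>
lemma off_diagonal_bound:
  assumes p: "0 < p" and x: "x mod M N \<noteq> t0 mod M N"
    and h: "\<And>t. t \<notin> residue_class K N t0 \<Longrightarrow> h t = 0"
  shows "cmod (\<Sum>t<M K. h t * kernel n x t) powr p
    \<le> off_weight p N t0 x * cmod (\<Sum>t<M K. h t * cnj (chr n t)) powr p"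
proof -
  define R where "R = (LEAST R. x mod M R \<noteq> t0 mod M R)"
  have R: "x mod M R \<noteq> t0 mod M R" unfolding R_def by (rule LeastI) (rule x)
  have RN: "R \<le> N" unfolding R_def by (rule Least_le) (rule x)
  have "R \<noteq> 0"
  proof
    assume "R = 0"
    then show False using R by simp
  qed
  then obtain r where r: "R = Suc r" by (cases R) auto
  have eq: "x mod M r = t0 mod M r"
    using not_less_Least[of r "\<lambda>R. x mod M R \<noteq> t0 mod M R"] r unfolding R_def by auto
  have "cmod (\<Sum>t<M K. h t * kernel n x t)
      \<le> real (M R) * cmod (\<Sum>t<M K. h t * cnj (chr n t))"
  proof -
    have "(\<Sum>t<M K. h t * g t) = (\<Sum>t\<in>residue_class K N t0. h t * g t)" for g
      by (rule sum_supported_residue_class) (rule h)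
    then show ?thesis
      using kernel_block[OF RN _ R, of "residue_class K N t0"] by (simp add: residue_class_def)
  qed
  then have "cmod (\<Sum>t<M K. h t * kernel n x t) powr p
      \<le> (real (M R) * cmod (\<Sum>t<M K. h t * cnj (chr n t))) powr p"
    using p by (intro powr_mono2) auto
  also have "\<dots> = real (M (Suc r)) powr p * cmod (\<Sum>t<M K. h t * cnj (chr n t)) powr p"
    unfolding r by (simp add: powr_mult)
  also have "\<dots> \<le> off_weight p N t0 x * cmod (\<Sum>t<M K. h t * cnj (chr n t)) powr p"
  proof (rule mult_right_mono)
    have "r \<in> {..<N}" using RN r by simp
    then have "(if x mod M r = t0 mod M r then real (M (Suc r)) powr p else 0) \<le> off_weight p N t0 x"
      unfolding off_weight_def by (intro member_le_sum) auto
    then show "real (M (Suc r)) powr p \<le> off_weight p N t0 x" using eq by simp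
  qed simp
  finally show ?thesis .
qed

text \<open>
  These are the square partial sum \<open>S_{n,n}\<close>, without normalization and normalized, and the Fourier coefficient
  of index \<open>(n, n)\<close> without normalization.
\<close>
definition ksum :: "nat \<Rightarrow> nat \<Rightarrow> (nat \<times> nat \<Rightarrow> complex) \<Rightarrow> nat \<Rightarrow> nat \<Rightarrow> complex" where
  "ksum K n a x y = (\<Sum>s<M K. (\<Sum>t<M K. a (t, s) * kernel n x t) * kernel n y s)"

definition psum :: "nat \<Rightarrow> nat \<Rightarrow> (nat \<times> nat \<Rightarrow> complex) \<Rightarrow> nat \<times> nat \<Rightarrow> complex" where
  "psum K n a = (\<lambda>(x, y). ksum K n a x y / (of_nat (M K))\<^sup>2)"

definition dcoeff :: "nat \<Rightarrow> nat \<Rightarrow> (nat \<times> nat \<Rightarrow> complex) \<Rightarrow> complex" where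
  "dcoeff K n a = (\<Sum>s<M K. (\<Sum>t<M K. a (t, s) * cnj (chr n t)) * cnj (chr n s))"

lemma ksum_swap: "ksum K n (\<lambda>(t, s). a (s, t)) y x = ksum K n a x y"
proof -
  have "ksum K n (\<lambda>(t, s). a (s, t)) y x
      = (\<Sum>s<M K. \<Sum>t<M K. a (s, t) * kernel n y t * kernel n x s)"
    unfolding ksum_def sum_distrib_right by simp
  also have "\<dots> = (\<Sum>t<M K. \<Sum>s<M K. a (s, t) * kernel n y t * kernel n x s)"
    by (rule sum.swap)
  also have "\<dots> = ksum K n a x y"
    unfolding ksum_def sum_distrib_right
    by (rule sum.cong[OF refl], rule sum.cong[OF refl]) (simp only: mult_ac)
  finally show ?thesis .
qed

lemma sum_ksum_l2_le:
  assumes n: "n \<le> M K"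
  shows "(\<Sum>x<M K. \<Sum>y<M K. (cmod (ksum K n a x y))\<^sup>2)
    \<le> (real (M K))^4 * (\<Sum>s<M K. \<Sum>t<M K. (cmod (a (t, s)))\<^sup>2)"
proof -
  let ?H = "\<lambda>x s. \<Sum>t<M K. a (t, s) * kernel n x t"
  have "(\<Sum>x<M K. \<Sum>y<M K. (cmod (ksum K n a x y))\<^sup>2)
      \<le> (\<Sum>x<M K. (real (M K))\<^sup>2 * (\<Sum>s<M K. (cmod (?H x s))\<^sup>2))"
    unfolding ksum_def by (intro sum_mono sum_kernel_l2_le n)
  also have "\<dots> = (real (M K))\<^sup>2 * (\<Sum>s<M K. \<Sum>x<M K. (cmod (?H x s))\<^sup>2)"
    unfolding sum_distrib_left[symmetric] by (subst sum.swap) (rule refl)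
  also have "\<dots> \<le> (real (M K))\<^sup>2 * (\<Sum>s<M K. (real (M K))\<^sup>2 * (\<Sum>t<M K. (cmod (a (t, s)))\<^sup>2))"
    by (intro mult_left_mono sum_mono sum_kernel_l2_le n) simp
  also have "\<dots> = (real (M K))^4 * (\<Sum>s<M K. \<Sum>t<M K. (cmod (a (t, s)))\<^sup>2)"
    unfolding sum_distrib_left[symmetric] by (simp add: power2_eq_square power4_eq_xxxx mult.assoc)
  finally show ?thesis .
qed

end

text \<open>
  A function that lives on one square of level \<open>N\<close>. Here \<open>L\<close> is the number of residues in each side
  of the square. Constants are the case \<open>N = 0\<close>.
\<close>
locale vilenkin_atom = vilenkin +
  fixes K N t0 s0 :: nat and A :: real and a :: "nat \<times> nat \<Rightarrow> complex" and p L P :: real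
  assumes NK: "N \<le> K" and p: "0 < p" "p \<le> 1"
    and supp: "\<And>t s. t \<notin> residue_class K N t0 \<or> s \<notin> residue_class K N s0 \<Longrightarrow> a (t, s) = 0"
    and a_le: "\<And>z. cmod (a z) \<le> A"
    and L_eq: "L = real (M K) / real (M N)" and P_eq: "P = real (M N)"
begin

abbreviation "X \<equiv> real (M K)"
abbreviation "J \<equiv> residue_class K N t0"
abbreviation "J' \<equiv> residue_class K N s0"

lemma A_nonneg: "0 \<le> A"
  using a_le[of "(0,0)"] norm_ge_zero order_trans by blast

lemma X_pos: "0 < X" and P_pos: "0 < P" and L_pos: "0 < L" and X_eq: "X = L * P"
  using M_pos[of K] M_pos[of N] unfolding L_eq P_eq by auto

lemma card_J: "real (card J) = L" and card_J': "real (card J') = L"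
  unfolding L_eq by (rule card_residue_class[OF NK])+

lemma sum_class_le:
  assumes "\<And>t. t \<notin> residue_class K N u \<Longrightarrow> h t = 0" "\<And>t. h t \<le> B"
  shows "(\<Sum>t<M K. h t) \<le> L * (B::real)"
proof -
  have "(\<Sum>t<M K. h t) = (\<Sum>t\<in>residue_class K N u. h t)"
    by (rule sum.mono_neutral_right) (use assms(1) in \<open>auto simp: residue_class_def\<close>)
  also have "\<dots> \<le> real (card (residue_class K N u)) * B"
    using assms(2) by (intro sum_bounded_above) auto
  finally show ?thesis unfolding card_residue_class[OF NK] L_eq .
qed

lemma sum_a_square_le: "(\<Sum>s<M K. \<Sum>t<M K. (cmod (a (t, s)))\<^sup>2) \<le> L * (L * A\<^sup>2)"
proof (rule sum_class_le[where u = s0])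
  fix s assume "s \<notin> J'"
  then show "(\<Sum>t<M K. (cmod (a (t, s)))\<^sup>2) = 0" using supp by simp
next
  fix s
  show "(\<Sum>t<M K. (cmod (a (t, s)))\<^sup>2) \<le> L * A\<^sup>2"
    by (rule sum_class_le[where u = t0]) (use supp a_le in \<open>auto intro: power_mono\<close>)
qed

lemma diagonal_block_bound:
  assumes n: "n \<le> M K"
  shows "(\<Sum>x\<in>J. \<Sum>y\<in>J'. cmod (psum K n a (x, y)) powr p) \<le> L\<^sup>2 * A powr p"
proof -
  have JX: "J \<subseteq> {..<M K}" "J' \<subseteq> {..<M K}" by (auto simp: residue_class_def)
  have "(\<Sum>z\<in>J \<times> J'. (cmod (psum K n a z))\<^sup>2) = (\<Sum>x\<in>J. \<Sum>y\<in>J'. (cmod (psum K n a (x, y)))\<^sup>2)"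
    by (simp add: sum.cartesian_product)
  also have "\<dots> \<le> (\<Sum>x<M K. \<Sum>y\<in>J'. (cmod (psum K n a (x, y)))\<^sup>2)"
    using JX by (intro sum_mono2 sum_nonneg) auto
  also have "\<dots> \<le> (\<Sum>x<M K. \<Sum>y<M K. (cmod (psum K n a (x, y)))\<^sup>2)"
    using JX by (intro sum_mono sum_mono2) auto
  also have "\<dots> = (\<Sum>x<M K. \<Sum>y<M K. (cmod (ksum K n a x y))\<^sup>2) / X^4"
    unfolding psum_def by (simp add: norm_divide norm_power power_divide sum_divide_distrib)
  also have "\<dots> \<le> (X^4 * (\<Sum>s<M K. \<Sum>t<M K. (cmod (a (t, s)))\<^sup>2)) / X^4"
    by (intro divide_right_mono sum_ksum_l2_le n) simp
  also have "\<dots> \<le> L * (L * A\<^sup>2)"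
    using X_pos sum_a_square_le by simp
  also have "\<dots> = real (card (J \<times> J')) * A\<^sup>2"
    by (simp add: card_cartesian_product card_J card_J')
  finally have "(\<Sum>z\<in>J \<times> J'. cmod (psum K n a z) powr p) \<le> real (card (J \<times> J')) * A powr p"
    using p A_nonneg by (intro sum_powr_le_of_sum_square_le) auto
  also have "\<dots> = L\<^sup>2 * A powr p"
    by (simp add: card_cartesian_product card_J card_J' power2_eq_square)
  finally show ?thesis by (simp add: sum.cartesian_product)
qed

text \<open>
  In the outer variable \<open>y\<close> the kernel is replaced by the \<open>n\<close>-th character. This leaves the partial sum
  in \<open>x\<close> of a function \<open>b\<close> of one variable, bounded by \<open>L * A\<close>, for which the \<open>L^2\<close> contraction
  on \<open>J\<close> is enough.
\<close>
lemma one_sided_bound: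
  assumes n: "n \<le> M K"
  shows "(\<Sum>x\<in>J. \<Sum>y\<in>{..<M K} - J'. cmod (psum K n a (x, y)) powr p)
    \<le> L\<^sup>2 * A powr p * (off_mass p N * P powr (1 - p))"
proof -
  define b where "b t = (\<Sum>s<M K. a (t, s) * cnj (chr n s))" for t
  define g where "g x = cmod (\<Sum>t<M K. b t * kernel n x t) / X" for x
  have g_nonneg: "0 \<le> g x" for x unfolding g_def by simp
  have b0: "b t = 0" if "t \<notin> J" for t unfolding b_def using supp that by simp
  have b_le: "cmod (b t) \<le> L * A" for t
  proof -
    have "cmod (b t) \<le> (\<Sum>s<M K. cmod (a (t, s) * cnj (chr n s)))" unfolding b_def by (rule norm_sum)
    also have "\<dots> = (\<Sum>s<M K. cmod (a (t, s)))" by (simp add: norm_mult)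
    also have "\<dots> \<le> L * A"
      by (rule sum_class_le[where u = s0]) (use supp a_le in auto)
    finally show ?thesis .
  qed
  have pt: "cmod (psum K n a (x, y)) powr p \<le> off_weight p N s0 y * (g x / X) powr p"
    if "y \<in> {..<M K} - J'" for x y
  proof -
    let ?h = "\<lambda>s. \<Sum>t<M K. a (t, s) * kernel n x t"
    have y: "y mod M N \<noteq> s0 mod M N" using that by (auto simp: residue_class_def)
    have h0: "?h s = 0" if "s \<notin> J'" for s using supp that by simp
    have "(\<Sum>s<M K. ?h s * cnj (chr n s)) = (\<Sum>t<M K. b t * kernel n x t)"
      unfolding b_def sum_distrib_right
      by (subst sum.swap) (rule sum.cong[OF refl], rule sum.cong[OF refl], simp only: mult_ac)
    then have "cmod (ksum K n a x y) powr p
        \<le> off_weight p N s0 y * cmod (\<Sum>t<M K. b t * kernel n x t) powr p"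
      using off_diagonal_bound[where h = ?h and K = K and n = n, OF p(1) y] h0 unfolding ksum_def by simp
    also have "cmod (\<Sum>t<M K. b t * kernel n x t) = g x / X * X\<^sup>2"
      using X_pos by (simp add: g_def power2_eq_square)
    also have "(g x / X * X\<^sup>2) powr p = (g x / X) powr p * (X\<^sup>2) powr p"
      by (simp only: powr_mult)
    finally have "cmod (ksum K n a x y) powr p \<le> off_weight p N s0 y * (g x / X) powr p * (X\<^sup>2) powr p"
      by simp
    moreover have "cmod (psum K n a (x, y)) powr p = cmod (ksum K n a x y) powr p / (X\<^sup>2) powr p"
      unfolding psum_def by (simp add: norm_divide norm_power powr_divide)
    ultimately show ?thesis using X_pos by (simp add: pos_divide_le_eq)
  qed
  have g_sum: "(\<Sum>x\<in>J. g x powr p) \<le> L * (L * A) powr p"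
  proof -
    have "(\<Sum>x\<in>J. (g x)\<^sup>2) \<le> (\<Sum>x<M K. (g x)\<^sup>2)"
      by (rule sum_mono2) (auto simp: residue_class_def)
    also have "\<dots> = (\<Sum>x<M K. (cmod (\<Sum>t<M K. b t * kernel n x t))\<^sup>2) / X\<^sup>2"
      unfolding g_def by (simp add: power_divide sum_divide_distrib)
    also have "\<dots> \<le> (X\<^sup>2 * (\<Sum>t<M K. (cmod (b t))\<^sup>2)) / X\<^sup>2"
      by (intro divide_right_mono sum_kernel_l2_le n) simp
    also have "\<dots> = (\<Sum>t<M K. (cmod (b t))\<^sup>2)" using X_pos by simp
    also have "\<dots> \<le> L * (L * A)\<^sup>2"
      by (rule sum_class_le[where u = t0]) (use b0 b_le in \<open>auto intro: power_mono\<close>)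
    also have "\<dots> = real (card J) * (L * A)\<^sup>2" by (simp add: card_J)
    finally show ?thesis
      using p A_nonneg L_pos g_nonneg sum_powr_le_of_sum_square_le[of J g p "L * A"]
      by (simp add: card_J)
  qed
  have "(\<Sum>x\<in>J. \<Sum>y\<in>{..<M K} - J'. cmod (psum K n a (x, y)) powr p)
      \<le> (\<Sum>x\<in>J. \<Sum>y\<in>{..<M K} - J'. off_weight p N s0 y * (g x / X) powr p)"
    by (intro sum_mono pt)
  also have "\<dots> \<le> (\<Sum>x\<in>J. \<Sum>y<M K. off_weight p N s0 y * (g x / X) powr p)"
    by (intro sum_mono sum_mono2) (auto simp: off_weight_nonneg)
  also have "\<dots> = X * off_mass p N * (\<Sum>x\<in>J. (g x / X) powr p)"
    unfolding sum_distrib_right[symmetric] sum_off_weight[OF NK] by (simp add: sum_distrib_left)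
  also have "(\<Sum>x\<in>J. (g x / X) powr p) = (\<Sum>x\<in>J. g x powr p) / X powr p"
    using g_nonneg by (simp add: powr_divide sum_divide_distrib)
  also have "X * off_mass p N * ((\<Sum>x\<in>J. g x powr p) / X powr p)
      \<le> X * off_mass p N * ((L * (L * A) powr p) / X powr p)"
    using g_sum off_mass_nonneg X_pos by (intro mult_left_mono divide_right_mono) auto
  also have "\<dots> = L\<^sup>2 * A powr p * (off_mass p N * P powr (1 - p))"
  proof -
    have scale: "X / X powr p * L powr p = L * P powr (1 - p)"
      using L_pos P_pos unfolding X_eq by (simp add: powr_mult powr_diff)
    have "X * off_mass p N * ((L * (L * A) powr p) / X powr p)
        = off_mass p N * L * A powr p * (X / X powr p * L powr p)"
      by (simp add: powr_mult mult_ac)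
    then have "X * off_mass p N * ((L * (L * A) powr p) / X powr p)
        = off_mass p N * L * A powr p * (L * P powr (1 - p))"
      unfolding scale .
    then show ?thesis by (simp add: power2_eq_square mult_ac)
  qed
  finally show ?thesis .
qed

text \<open>The kernel is replaced by the \<open>n\<close>-th character in both variables.\<close>
lemma two_sided_bound:
  "(\<Sum>x\<in>{..<M K} - J. \<Sum>y\<in>{..<M K} - J'. cmod (psum K n a (x, y)) powr p)
    \<le> (X * off_mass p N)\<^sup>2 * (cmod (dcoeff K n a) / X\<^sup>2) powr p"
proof -
  have pt: "cmod (psum K n a (x, y)) powr p
      \<le> off_weight p N t0 x * (off_weight p N s0 y * (cmod (dcoeff K n a) / X\<^sup>2) powr p)"
    if "x \<in> {..<M K} - J" "y \<in> {..<M K} - J'" for x y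
  proof -
    let ?h = "\<lambda>s. \<Sum>t<M K. a (t, s) * kernel n x t"
    let ?b = "\<lambda>t. \<Sum>s<M K. a (t, s) * cnj (chr n s)"
    have x: "x mod M N \<noteq> t0 mod M N" and y: "y mod M N \<noteq> s0 mod M N"
      using that by (auto simp: residue_class_def)
    have h0: "?h s = 0" if "s \<notin> J'" for s using supp that by simp
    have b0: "?b t = 0" if "t \<notin> J" for t using supp that by simp
    have e1: "(\<Sum>s<M K. ?h s * cnj (chr n s)) = (\<Sum>t<M K. ?b t * kernel n x t)"
      unfolding sum_distrib_right
      by (subst sum.swap) (rule sum.cong[OF refl], rule sum.cong[OF refl], simp only: mult_ac)
    have e2: "(\<Sum>t<M K. ?b t * cnj (chr n t)) = dcoeff K n a"
      unfolding dcoeff_def sum_distrib_right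
      by (subst sum.swap) (rule sum.cong[OF refl], rule sum.cong[OF refl], simp only: mult_ac)
    have "cmod (ksum K n a x y) powr p
        \<le> off_weight p N s0 y * cmod (\<Sum>t<M K. ?b t * kernel n x t) powr p"
      unfolding ksum_def e1[symmetric] by (rule off_diagonal_bound[OF p(1) y]) (rule h0)
    also have "\<dots> \<le> off_weight p N s0 y * (off_weight p N t0 x * cmod (dcoeff K n a) powr p)"
    proof (rule mult_left_mono)
      show "cmod (\<Sum>t<M K. ?b t * kernel n x t) powr p \<le> off_weight p N t0 x * cmod (dcoeff K n a) powr p"
        unfolding e2[symmetric] by (rule off_diagonal_bound[OF p(1) x]) (rule b0)
    qed (rule off_weight_nonneg)
    finally have "cmod (ksum K n a x y) powr p / (X\<^sup>2) powr p
        \<le> off_weight p N s0 y * (off_weight p N t0 x * cmod (dcoeff K n a) powr p) / (X\<^sup>2) powr p"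
      by (rule divide_right_mono) simp
    then show ?thesis
      unfolding psum_def by (simp add: norm_divide norm_power powr_divide mult_ac)
  qed
  have "(\<Sum>x\<in>{..<M K} - J. \<Sum>y\<in>{..<M K} - J'. cmod (psum K n a (x, y)) powr p)
      \<le> (\<Sum>x\<in>{..<M K} - J. \<Sum>y\<in>{..<M K} - J'.
            off_weight p N t0 x * (off_weight p N s0 y * (cmod (dcoeff K n a) / X\<^sup>2) powr p))"
    by (intro sum_mono pt)
  also have "\<dots> \<le> (\<Sum>x<M K. \<Sum>y\<in>{..<M K} - J'.
            off_weight p N t0 x * (off_weight p N s0 y * (cmod (dcoeff K n a) / X\<^sup>2) powr p))"
    by (intro sum_mono2 sum_nonneg) (auto simp: off_weight_nonneg)
  also have "\<dots> \<le> (\<Sum>x<M K. \<Sum>y<M K.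
            off_weight p N t0 x * (off_weight p N s0 y * (cmod (dcoeff K n a) / X\<^sup>2) powr p))"
    by (intro sum_mono sum_mono2) (auto simp: off_weight_nonneg)
  also have "\<dots> = (X * off_mass p N)\<^sup>2 * (cmod (dcoeff K n a) / X\<^sup>2) powr p"
    unfolding sum_distrib_left[symmetric] sum_distrib_right[symmetric] sum_off_weight[OF NK]
    by (simp only: power2_eq_square mult_ac)
  finally show ?thesis .
qed

lemma swapped: "vilenkin_atom m K N s0 t0 A (\<lambda>(t, s). a (s, t)) p L P"
proof (unfold_locales)
  fix t s
  show "t \<notin> J' \<or> s \<notin> J \<Longrightarrow> (case (t, s) of (t, s) \<Rightarrow> a (s, t)) = 0"
    using supp[of s t] by auto
next
  fix z show "cmod (case z of (t, s) \<Rightarrow> a (s, t)) \<le> A"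
    using a_le by (cases z) simp
qed (use NK p L_eq P_eq in auto)

lemma atom_term_bound:
  assumes n: "n \<le> M K"
  shows "(\<Sum>z\<in>{..<M K} \<times> {..<M K}. cmod (psum K n a z) powr p)
    \<le> L\<^sup>2 * A powr p * (1 + 2 * (off_mass p N * P powr (1 - p)))
      + (X * off_mass p N)\<^sup>2 * (cmod (dcoeff K n a) / X\<^sup>2) powr p"
proof -
  let ?f = "\<lambda>x y. cmod (psum K n a (x, y)) powr p"
  have J: "{..<M K} = J \<union> ({..<M K} - J)" and J': "{..<M K} = J' \<union> ({..<M K} - J')"
    by (auto simp: residue_class_def)
  have split: "(\<Sum>x<M K. F x) = (\<Sum>x\<in>J. F x) + (\<Sum>x\<in>{..<M K} - J. F x)"
    and split': "(\<Sum>x<M K. F x) = (\<Sum>x\<in>J'. F x) + (\<Sum>x\<in>{..<M K} - J'. F x)" for F :: "nat \<Rightarrow> real"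
    by (subst J, rule sum.union_disjoint; auto) (subst J', rule sum.union_disjoint; auto)
  have "(\<Sum>z\<in>{..<M K} \<times> {..<M K}. cmod (psum K n a z) powr p) = (\<Sum>x<M K. \<Sum>y<M K. ?f x y)"
    by (simp add: sum.cartesian_product)
  also have "\<dots> = (\<Sum>x\<in>J. \<Sum>y<M K. ?f x y) + (\<Sum>x\<in>{..<M K} - J. \<Sum>y<M K. ?f x y)"
    by (rule split)
  also have "\<dots> = (\<Sum>x\<in>J. \<Sum>y\<in>J'. ?f x y) + (\<Sum>x\<in>J. \<Sum>y\<in>{..<M K} - J'. ?f x y)
      + ((\<Sum>x\<in>{..<M K} - J. \<Sum>y\<in>J'. ?f x y) + (\<Sum>x\<in>{..<M K} - J. \<Sum>y\<in>{..<M K} - J'. ?f x y))"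
    by (simp only: split' sum.distrib)
  finally have eq: "(\<Sum>z\<in>{..<M K} \<times> {..<M K}. cmod (psum K n a z) powr p) = \<dots>" .
  have "(\<Sum>x\<in>{..<M K} - J. \<Sum>y\<in>J'. ?f x y) \<le> L\<^sup>2 * A powr p * (off_mass p N * P powr (1 - p))"
  proof -
    have "(\<Sum>x\<in>{..<M K} - J. \<Sum>y\<in>J'. ?f x y) = (\<Sum>y\<in>J'. \<Sum>x\<in>{..<M K} - J. ?f x y)"
      by (rule sum.swap)
    also have "\<dots> = (\<Sum>y\<in>J'. \<Sum>x\<in>{..<M K} - J. cmod (psum K n (\<lambda>(t, s). a (s, t)) (y, x)) powr p)"
      by (simp only: psum_def case_prod_conv ksum_swap)
    finally show ?thesis
      using vilenkin_atom.one_sided_bound[OF swapped n] by simp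
  qed
  then show ?thesis
    unfolding eq using diagonal_block_bound[OF n] one_sided_bound[OF n] two_sided_bound[of n]
    by (simp add: algebra_simps)
qed

lemma cmod_dcoeff_le: "cmod (dcoeff K n a) \<le> L * (L * A)"
proof -
  have "cmod (dcoeff K n a) \<le> (\<Sum>s<M K. cmod ((\<Sum>t<M K. a (t, s) * cnj (chr n t)) * cnj (chr n s)))"
    unfolding dcoeff_def by (rule norm_sum)
  also have "\<dots> = (\<Sum>s<M K. cmod (\<Sum>t<M K. a (t, s) * cnj (chr n t)))" by (simp add: norm_mult)
  also have "\<dots> \<le> (\<Sum>s<M K. \<Sum>t<M K. cmod (a (t, s) * cnj (chr n t)))"
    by (intro sum_mono norm_sum)
  also have "\<dots> = (\<Sum>s<M K. \<Sum>t<M K. cmod (a (t, s)))" by (simp add: norm_mult)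
  also have "\<dots> \<le> L * (L * A)"
  proof (rule sum_class_le[where u = s0])
    fix s assume "s \<notin> J'"
    then show "(\<Sum>t<M K. cmod (a (t, s))) = 0" using supp by simp
  next
    fix s show "(\<Sum>t<M K. cmod (a (t, s))) \<le> L * A"
      by (rule sum_class_le[where u = t0]) (use supp a_le in auto)
  qed
  finally show ?thesis .
qed

text \<open>
  For fixed \<open>s\<close>, Parseval in \<open>t\<close> gives square summability over \<open>n\<close>. The factor \<open>cnj (chr n s)\<close> has
  modulus one, so the sum over \<open>s \<in> J'\<close> costs only a factor \<open>L\<close> by Cauchy-Schwarz.
\<close>
lemma sum_dcoeff_square_le: "(\<Sum>n<M K. (cmod (dcoeff K n a))\<^sup>2) \<le> L^3 * X * A\<^sup>2"
proof -
  let ?c = "\<lambda>n s. \<Sum>t<M K. a (t, s) * cnj (chr n t)"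
  have "(cmod (dcoeff K n a))\<^sup>2 \<le> L * (\<Sum>s<M K. (cmod (?c n s))\<^sup>2)" for n
  proof -
    have sub: "J' \<subseteq> {..<M K}" by (auto simp: residue_class_def)
    have "dcoeff K n a = (\<Sum>s\<in>J'. ?c n s * cnj (chr n s))"
      unfolding dcoeff_def by (rule sum_supported_residue_class) (use supp in simp)
    then have "cmod (dcoeff K n a) \<le> (\<Sum>s\<in>J'. cmod (?c n s * cnj (chr n s)))"
      by (simp only: norm_sum)
    also have "\<dots> = (\<Sum>s\<in>J'. 1 * cmod (?c n s))" by (simp add: norm_mult)
    finally have "(cmod (dcoeff K n a))\<^sup>2 \<le> (\<Sum>s\<in>J'. 1 * cmod (?c n s))\<^sup>2"
      by (rule power_mono) simp
    also have "\<dots> \<le> (\<Sum>s\<in>J'. 1\<^sup>2) * (\<Sum>s\<in>J'. (cmod (?c n s))\<^sup>2)"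
      by (rule Cauchy_Schwarz_ineq_sum)
    also have "\<dots> = L * (\<Sum>s\<in>J'. (cmod (?c n s))\<^sup>2)" by (simp add: card_J')
    also have "\<dots> \<le> L * (\<Sum>s<M K. (cmod (?c n s))\<^sup>2)"
      using L_pos sub by (intro mult_left_mono sum_mono2) auto
    finally show ?thesis .
  qed
  then have "(\<Sum>n<M K. (cmod (dcoeff K n a))\<^sup>2) \<le> (\<Sum>n<M K. L * (\<Sum>s<M K. (cmod (?c n s))\<^sup>2))"
    by (rule sum_mono)
  also have "\<dots> = L * (\<Sum>s<M K. \<Sum>n<M K. (cmod (?c n s))\<^sup>2)"
    unfolding sum_distrib_left[symmetric] by (subst sum.swap) (rule refl)
  also have "\<dots> = L * (X * (\<Sum>s<M K. \<Sum>t<M K. (cmod (a (t, s)))\<^sup>2))"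
    unfolding parseval sum_distrib_left[symmetric] ..
  also have "\<dots> \<le> L * (X * (L * (L * A\<^sup>2)))"
    using L_pos X_pos sum_a_square_le by (intro mult_left_mono) auto
  finally show ?thesis by (simp add: power3_eq_cube mult_ac)
qed

text \<open>On the support of \<open>a\<close> the kernel of order \<open>n \<le> M N\<close> is constant, so only the mean value remains.\<close>
lemma psum_eq_0:
  assumes mean: "(\<Sum>s<M K. \<Sum>t<M K. a (t, s)) = 0" and n: "n \<le> M N"
  shows "psum K n a z = 0"
proof -
  obtain x y where z: "z = (x, y)" by (cases z)
  have const: "kernel n x t = kernel n x u" if "t mod M N = u mod M N" for x t u
    unfolding kernel_def using chr_cong[OF n _ that] by (intro sum.cong) auto
  have "ksum K n a x y = (\<Sum>s<M K. (\<Sum>t<M K. a (t, s)) * (kernel n x t0 * kernel n y s0))"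
    unfolding ksum_def
  proof (rule sum.cong[OF refl])
    fix s
    have "(\<Sum>t<M K. a (t, s) * kernel n x t) = (\<Sum>t<M K. a (t, s) * kernel n x t0)"
    proof (rule sum.cong[OF refl])
      fix t
      show "a (t, s) * kernel n x t = a (t, s) * kernel n x t0"
        using supp[of t s] const[of t t0 x] by (cases "t \<in> J") (auto simp: residue_class_def)
    qed
    moreover have "(\<Sum>t<M K. a (t, s)) * kernel n y s = (\<Sum>t<M K. a (t, s)) * kernel n y s0"
      using supp[of _ s] const[of s s0 y] by (cases "s \<in> J'") (auto simp: residue_class_def)
    ultimately show "(\<Sum>t<M K. a (t, s) * kernel n x t) * kernel n y s
        = (\<Sum>t<M K. a (t, s)) * (kernel n x t0 * kernel n y s0)"
      unfolding sum_distrib_right[symmetric] by (simp only: mult_ac)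
  qed
  also have "\<dots> = 0" unfolding sum_distrib_right[symmetric] mean by simp
  finally show ?thesis unfolding z psum_def by simp
qed

end

section \<open>Strong sums of atoms\<close>

definition strong_weight :: "real \<Rightarrow> nat \<Rightarrow> real" where
  "strong_weight p n = 1 / (real n powr (3 - 2 * p) * ln (real n + 1) ^ (2 * nat \<lfloor>p\<rfloor>))"

lemma strong_weight_nonneg: "0 \<le> strong_weight p n"
  unfolding strong_weight_def by simp

lemma strong_weight_less_1:
  assumes "0 < p" "p < 1"
  shows "strong_weight p n = real n powr - (1 + (2 - 2 * p))"
proof -
  have "nat \<lfloor>p\<rfloor> = 0" using assms by (simp add: floor_eq_iff)
  then show ?thesis unfolding strong_weight_def powr_minus by (simp add: divide_inverse)
qed

lemma strong_weight_1: "strong_weight 1 n = 1 / (real n * (ln (real n + 1))\<^sup>2)"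
  unfolding strong_weight_def by simp

lemma sum_strong_weight_bounded:
  assumes p: "0 < p" "p \<le> 1"
  shows "\<exists>W\<ge>0. \<forall>X. (\<Sum>n\<in>{1..<X}. strong_weight p n) \<le> W"
proof (cases "p < 1")
  case True
  have "(\<Sum>n\<in>{1..<X}. strong_weight p n) \<le> 1 + 1 / (2 - 2 * p)" for X
  proof -
    have "(\<Sum>n\<in>{1..<X}. strong_weight p n) \<le> (\<Sum>n\<in>insert 1 {1<..<X}. strong_weight p n)"
      by (rule sum_mono2) (auto simp: strong_weight_nonneg)
    also have "\<dots> = strong_weight p 1 + (\<Sum>n\<in>{1<..<X}. strong_weight p n)" by simp
    also have "\<dots> \<le> 1 + 1 / (2 - 2 * p)"
      using sum_powr_tail_le[of "2 - 2 * p" 1 X] True p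
      by (simp add: strong_weight_less_1)
    finally show ?thesis .
  qed
  moreover have "0 \<le> 1 + 1 / (2 - 2 * p)" using True by simp
  ultimately show ?thesis by blast
next
  case False
  then have p1: "p = 1" using p by simp
  have "(\<Sum>n\<in>{1..<X}. strong_weight p n)
      \<le> strong_weight 1 1 + strong_weight 1 2 + 2 / ln 2" for X
  proof -
    have "(\<Sum>n\<in>{1..<X}. strong_weight p n) \<le> (\<Sum>n\<in>insert 1 (insert 2 {2<..<X}). strong_weight p n)"
      by (rule sum_mono2) (auto simp: strong_weight_nonneg)
    also have "\<dots> = strong_weight 1 1 + strong_weight 1 2 + (\<Sum>n\<in>{2<..<X}. strong_weight 1 n)"
      by (simp add: p1)
    also have "\<dots> \<le> strong_weight 1 1 + strong_weight 1 2 + 2 / ln 2"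
      using sum_log_tail_le[of 2 X] unfolding strong_weight_1 by simp
    finally show ?thesis .
  qed
  moreover have "0 \<le> strong_weight 1 1 + strong_weight 1 2 + 2 / ln 2"
    by (intro add_nonneg_nonneg strong_weight_nonneg) simp
  ultimately show ?thesis by blast
qed

context vilenkin begin

text \<open>
  The part of the left-hand side of the theorem with \<open>n < M K\<close>, except that the integrals are
  replaced by sums over residues, that is, multiplied by \<open>(M K)\<^sup>2\<close>.
\<close>
definition strong_total :: "real \<Rightarrow> nat \<Rightarrow> (nat \<times> nat \<Rightarrow> complex) \<Rightarrow> real" where
  "strong_total p K a =
     (\<Sum>n\<in>{1..<M K}. strong_weight p n * (\<Sum>z\<in>{..<M K} \<times> {..<M K}. cmod (psum K n a z) powr p))"

lemma power2_le_M: "2 ^ N \<le> M N"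
  by (induction N) (simp_all add: vilenkin_base_Suc m_ge_2 mult_mono)

text \<open>The terms are at most \<open>B * M r powr (p - 1)\<close>, hence dominated by a geometric series.\<close>
lemma off_mass_le_of_less_1:
  assumes p: "0 < p" "p < 1" and B: "\<And>k. m k \<le> B"
  shows "off_mass p N \<le> real B / (1 - 2 powr (p - 1))"
proof -
  define \<theta> :: real where "\<theta> = 2 powr (p - 1)"
  have \<theta>: "0 < \<theta>" "\<theta> < 1" using p powr_less_mono[of "p - 1" 0 2] unfolding \<theta>_def by auto
  have "off_mass p N \<le> (\<Sum>r<N. real B * \<theta> ^ r)"
    unfolding off_mass_def
  proof (rule sum_mono)
    fix r
    have Mr: "0 < real (M r)" using M_pos[of r] by simp
    have "real (M (Suc r)) powr p / real (M r) = real (m r) powr p * (real (M r) powr (p - 1))"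
      using Mr by (simp add: vilenkin_base_Suc powr_mult powr_diff)
    also have "\<dots> \<le> real B * \<theta> ^ r"
    proof (rule mult_mono)
      have "real (m r) powr p \<le> real (m r) powr 1"
        using p m_ge_2[of r] by (intro powr_mono) auto
      also have "\<dots> = real (m r)" by simp
      also have "\<dots> \<le> real B" using B[of r] by simp
      finally show "real (m r) powr p \<le> real B" .
      have "2 ^ r \<le> real (M r)"
        using power2_le_M[of r] by (metis of_nat_le_iff of_nat_numeral of_nat_power)
      then have "real (M r) powr (p - 1) \<le> (2 ^ r) powr (p - 1)"
        using p by (intro powr_mono2') auto
      also have "(2 ^ r) powr (p - 1) = (\<theta> ^ r)"
        unfolding \<theta>_def by (simp add: powr_powr powr_power mult.commute flip: powr_realpow)
      finally show "real (M r) powr (p - 1) \<le> \<theta> ^ r" .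
    qed auto
    finally show "real (M (Suc r)) powr p / real (M r) \<le> real B * \<theta> ^ r" .
  qed
  also have "\<dots> = real B * ((1 - \<theta> ^ N) / (1 - \<theta>))"
    using \<theta> by (simp add: sum_distrib_left[symmetric] sum_gp_strict)
  also have "\<dots> \<le> real B * (1 / (1 - \<theta>))"
    using \<theta> by (intro mult_left_mono divide_right_mono) auto
  finally show ?thesis unfolding \<theta>_def by simp
qed

lemma off_mass_1_le:
  assumes B: "\<And>k. m k \<le> B"
  shows "off_mass 1 N \<le> real B * real N"
proof -
  have "off_mass 1 N = (\<Sum>r<N. real (m r))"
    unfolding off_mass_def using M_pos by (intro sum.cong) (auto simp: vilenkin_base_Suc)
  also have "\<dots> \<le> real (card {..<N}) * real B"
    using B by (intro sum_bounded_above) auto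
  finally show ?thesis by (simp add: mult.commute)
qed

end

context vilenkin_atom begin

lemma strong_total_mean_zero:
  assumes "(\<Sum>s<M K. \<Sum>t<M K. a (t, s)) = 0"
  shows "strong_total p K a
    = (\<Sum>n\<in>{M N<..<M K}. strong_weight p n * (\<Sum>z\<in>{..<M K} \<times> {..<M K}. cmod (psum K n a z) powr p))"
  unfolding strong_total_def
proof (rule sum.mono_neutral_right)
  show "\<forall>n\<in>{1..<M K} - {M N<..<M K}.
      strong_weight p n * (\<Sum>z\<in>{..<M K} \<times> {..<M K}. cmod (psum K n a z) powr p) = 0"
  proof
    fix n assume "n \<in> {1..<M K} - {M N<..<M K}"
    then have "n \<le> M N" by auto
    then show "strong_weight p n * (\<Sum>z\<in>{..<M K} \<times> {..<M K}. cmod (psum K n a z) powr p) = 0"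
      by (simp add: psum_eq_0[OF assms])
  qed
qed auto

lemma strong_total_top_le:
  assumes N: "N = 0" and W: "(\<Sum>n\<in>{1..<M K}. strong_weight p n) \<le> W"
  shows "strong_total p K a \<le> W * (L\<^sup>2 * A powr p)"
proof -
  have 0: "off_mass p N = 0" unfolding off_mass_def N by simp
  have "strong_total p K a \<le> (\<Sum>n\<in>{1..<M K}. strong_weight p n * (L\<^sup>2 * A powr p))"
    unfolding strong_total_def
  proof (intro sum_mono mult_left_mono)
    fix n assume "n \<in> {1..<M K}"
    then have "n \<le> M K" by simp
    then show "(\<Sum>z\<in>{..<M K} \<times> {..<M K}. cmod (psum K n a z) powr p) \<le> L\<^sup>2 * A powr p"
      using atom_term_bound[of n] unfolding 0 by simp
  qed (simp add: strong_weight_nonneg)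
  also have "\<dots> = (\<Sum>n\<in>{1..<M K}. strong_weight p n) * (L\<^sup>2 * A powr p)"
    by (simp only: sum_distrib_right)
  also have "\<dots> \<le> W * (L\<^sup>2 * A powr p)"
    using W by (intro mult_right_mono) auto
  finally show ?thesis .
qed

text \<open>
  By the trivial bound for the diagonal coefficient, the three regions combine to the square of
  \<open>1 + off_mass p N * P powr (1 - p)\<close>. This grows like \<open>P powr (2 - 2 * p)\<close>, which is exactly what the tail
  of the weights beyond \<open>P\<close> compensates.
\<close>
lemma strong_total_atom_less_1:
  assumes p1: "p < 1" and mean: "(\<Sum>s<M K. \<Sum>t<M K. a (t, s)) = 0"
    and C: "off_mass p N \<le> C"
  shows "strong_total p K a \<le> (1 + C)\<^sup>2 / (2 - 2 * p) * (L\<^sup>2 * A powr p)"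
proof -
  define q where "q = 2 - 2 * p"
  have q: "0 < q" unfolding q_def using p1 by simp
  have P1: "1 \<le> P" using M_pos[of N] unfolding P_eq by (simp add: Suc_le_eq)
  have C0: "0 \<le> C" using C off_mass_nonneg[of p N] by linarith
  have Pq: "(P powr (1 - p))\<^sup>2 = P powr q"
    using P_pos unfolding q_def by (simp add: power2_eq_square powr_add[symmetric])
  have each: "(\<Sum>z\<in>{..<M K} \<times> {..<M K}. cmod (psum K n a z) powr p)
      \<le> (1 + C)\<^sup>2 * P powr q * (L\<^sup>2 * A powr p)" if n: "n \<le> M K" for n
  proof -
    have "(cmod (dcoeff K n a) / X\<^sup>2) powr p \<le> (A / P\<^sup>2) powr p"
    proof (rule powr_mono2)
      have "cmod (dcoeff K n a) / X\<^sup>2 \<le> L * (L * A) / X\<^sup>2"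
        by (rule divide_right_mono) (use cmod_dcoeff_le in auto)
      also have "\<dots> = A / P\<^sup>2"
        using L_pos unfolding X_eq by (simp add: power2_eq_square)
      finally show "cmod (dcoeff K n a) / X\<^sup>2 \<le> A / P\<^sup>2" .
    qed (use p in auto)
    then have "(X * off_mass p N)\<^sup>2 * (cmod (dcoeff K n a) / X\<^sup>2) powr p
        \<le> (X * off_mass p N)\<^sup>2 * (A / P\<^sup>2) powr p"
      by (rule mult_left_mono) simp
    also have "\<dots> = L\<^sup>2 * A powr p * (off_mass p N * P powr (1 - p))\<^sup>2"
    proof -
      have scale: "P\<^sup>2 / (P\<^sup>2) powr p = (P powr (1 - p))\<^sup>2"
        using P_pos by (simp add: power2_eq_square powr_mult powr_diff)
      have "(X * off_mass p N)\<^sup>2 * (A / P\<^sup>2) powr p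
          = L\<^sup>2 * (off_mass p N)\<^sup>2 * A powr p * (P\<^sup>2 / (P\<^sup>2) powr p)"
        unfolding X_eq by (simp add: power_mult_distrib powr_divide)
      also have "\<dots> = L\<^sup>2 * A powr p * (off_mass p N * P powr (1 - p))\<^sup>2"
        unfolding scale by (simp add: power_mult_distrib)
      finally show ?thesis .
    qed
    finally have "(\<Sum>z\<in>{..<M K} \<times> {..<M K}. cmod (psum K n a z) powr p)
        \<le> L\<^sup>2 * A powr p * (1 + 2 * (off_mass p N * P powr (1 - p)))
          + L\<^sup>2 * A powr p * (off_mass p N * P powr (1 - p))\<^sup>2"
      using atom_term_bound[OF n] by linarith
    also have "\<dots> = (1 + off_mass p N * P powr (1 - p))\<^sup>2 * (L\<^sup>2 * A powr p)"
      by (simp add: power2_eq_square algebra_simps)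
    also have "\<dots> \<le> ((1 + C) * P powr (1 - p))\<^sup>2 * (L\<^sup>2 * A powr p)"
    proof (intro mult_right_mono power_mono)
      have "1 \<le> P powr (1 - p)" using P1 p1 by (intro ge_one_powr_ge_zero) auto
      moreover have "off_mass p N * P powr (1 - p) \<le> C * P powr (1 - p)"
        using C by (intro mult_right_mono) auto
      ultimately show "1 + off_mass p N * P powr (1 - p) \<le> (1 + C) * P powr (1 - p)"
        by (simp add: distrib_right)
    qed (use off_mass_nonneg in auto)
    finally show ?thesis by (simp only: power_mult_distrib Pq)
  qed
  have "strong_total p K a \<le> (\<Sum>n\<in>{M N<..<M K}. strong_weight p n * ((1 + C)\<^sup>2 * P powr q * (L\<^sup>2 * A powr p)))"
    unfolding strong_total_mean_zero[OF mean]
    by (intro sum_mono mult_left_mono each) (auto simp: strong_weight_nonneg)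
  also have "\<dots> = (\<Sum>n\<in>{M N<..<M K}. real n powr - (1 + q)) * ((1 + C)\<^sup>2 * P powr q * (L\<^sup>2 * A powr p))"
    unfolding q_def sum_distrib_right strong_weight_less_1[OF p(1) p1] ..
  also have "\<dots> \<le> (P powr - q / q) * ((1 + C)\<^sup>2 * P powr q * (L\<^sup>2 * A powr p))"
    unfolding P_eq using q M_pos[of N]
    by (intro mult_right_mono sum_powr_tail_le) (auto simp: Suc_le_eq)
  also have "\<dots> = (1 + C)\<^sup>2 / q * (L\<^sup>2 * A powr p)"
    using P_pos by (simp add: powr_minus)
  finally show ?thesis unfolding q_def .
qed

text \<open>
  For \<open>p = 1\<close> the mass outside the square grows like \<open>N\<close> in each variable, while \<open>ln P\<close> is at least
  \<open>N * ln 2\<close>. The three summands of the constant correspond to the three regions. In the second one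
  the factor \<open>N\<close> is compensated by the tail \<open>2 / ln P\<close> of the weights. In the last one the factor \<open>N\<^sup>2\<close>
  is compensated by the two logarithms, and the sum of the coefficients divided by \<open>n\<close> is controlled by the
  Cauchy-Schwarz inequality and \<open>sum_dcoeff_square_le\<close>.
\<close>
lemma strong_total_atom_1:
  assumes p1: "p = 1" and mean: "(\<Sum>s<M K. \<Sum>t<M K. a (t, s)) = 0"
    and C: "off_mass p N \<le> C * real N" and N: "N \<noteq> 0"
    and W: "(\<Sum>n\<in>{1..<M K}. strong_weight p n) \<le> W"
  shows "strong_total p K a \<le> (W + 4 * C / ln 2 + C\<^sup>2 / (ln 2)\<^sup>2) * (L\<^sup>2 * A powr p)"
proof -
  define \<Lambda> where "\<Lambda> = off_mass p N"
  have \<Lambda>: "0 \<le> \<Lambda>" "\<Lambda> \<le> C * real N" unfolding \<Lambda>_def using C off_mass_nonneg by auto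
  have P2: "2 ^ N \<le> P"
    using power2_le_M[of N] unfolding P_eq by (metis of_nat_le_iff of_nat_numeral of_nat_power)
  have "(2::nat) ^ 1 \<le> 2 ^ N" using N by (intro power_increasing) auto
  then have MN2: "2 \<le> M N" using power2_le_M[of N] by simp
  have lnP: "real N * ln 2 \<le> ln P"
  proof -
    have "ln ((2::real) ^ N) \<le> ln P" using P2 P_pos by (subst ln_le_cancel_iff) auto
    then show ?thesis by (simp add: ln_realpow)
  qed
  have Nln: "0 < real N * ln 2" using N by simp
  let ?I = "{M N<..<M K}"
  have weight_le: "strong_weight p n \<le> 1 / (real N * ln 2)\<^sup>2 * (1 / real n)" if n: "n \<in> ?I" for n
  proof -
    have "ln P \<le> ln (real n + 1)" using n P_pos unfolding P_eq by (subst ln_le_cancel_iff) auto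
    then have "(real N * ln 2)\<^sup>2 \<le> (ln (real n + 1))\<^sup>2"
      using lnP Nln by (intro power_mono) auto
    then have "1 / (ln (real n + 1))\<^sup>2 \<le> 1 / (real N * ln 2)\<^sup>2"
    proof (intro divide_left_mono mult_pos_pos)
      show "0 < (real N * ln 2)\<^sup>2" using Nln by (rule zero_less_power)
      then show "0 < (ln (real n + 1))\<^sup>2"
        using \<open>(real N * ln 2)\<^sup>2 \<le> (ln (real n + 1))\<^sup>2\<close> by linarith
    qed simp_all
    then have "1 / (ln (real n + 1))\<^sup>2 * (1 / real n) \<le> 1 / (real N * ln 2)\<^sup>2 * (1 / real n)"
      by (intro mult_right_mono) auto
    then show ?thesis unfolding p1 strong_weight_1 by (simp add: mult.commute)
  qed
  have part1: "(\<Sum>n\<in>?I. strong_weight p n) \<le> W"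
  proof -
    have "(\<Sum>n\<in>?I. strong_weight p n) \<le> (\<Sum>n\<in>{1..<M K}. strong_weight p n)"
      by (rule sum_mono2) (auto simp: strong_weight_nonneg)
    then show ?thesis using W by simp
  qed
  have part2: "(\<Sum>n\<in>?I. strong_weight p n) * (2 * \<Lambda>) \<le> 4 * C / ln 2"
  proof -
    have "(\<Sum>n\<in>?I. strong_weight p n) \<le> 2 / ln P"
      unfolding p1 strong_weight_1 P_eq by (rule sum_log_tail_le[OF MN2])
    also have "\<dots> \<le> 2 / (real N * ln 2)"
      using lnP by (rule divide_left_mono) (use mult_pos_pos[OF less_le_trans[OF Nln lnP] Nln] in simp_all)
    finally have "(\<Sum>n\<in>?I. strong_weight p n) * (2 * \<Lambda>) \<le> 2 / (real N * ln 2) * (2 * (C * real N))"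
      using \<Lambda> Nln by (intro mult_mono) auto
    also have "\<dots> = 4 * C / ln 2" using N by simp
    finally show ?thesis .
  qed
  have part3: "(\<Sum>n\<in>?I. strong_weight p n * cmod (dcoeff K n a)) \<le> 1 / (real N * ln 2)\<^sup>2 * (L\<^sup>2 * A)"
  proof -
    have "(\<Sum>n\<in>?I. 1 / real n * cmod (dcoeff K n a)) \<le> L\<^sup>2 * A"
    proof (rule power2_le_imp_le)
      have "(\<Sum>n\<in>?I. 1 / real n * cmod (dcoeff K n a))\<^sup>2
          \<le> (\<Sum>n\<in>?I. (1 / real n)\<^sup>2) * (\<Sum>n\<in>?I. (cmod (dcoeff K n a))\<^sup>2)"
        by (rule Cauchy_Schwarz_ineq_sum)
      also have "\<dots> \<le> (1 / P) * (L^3 * X * A\<^sup>2)"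
      proof (rule mult_mono)
        have "(\<Sum>n\<in>?I. (1 / real n)\<^sup>2) = (\<Sum>n\<in>?I. real n powr - (1 + 1))"
          by (intro sum.cong) (auto simp: powr_minus power2_eq_square divide_inverse powr_numeral)
        also have "\<dots> \<le> real (M N) powr - 1 / 1"
          using MN2 by (intro sum_powr_tail_le) auto
        also have "\<dots> = 1 / P" unfolding P_eq using MN2 by (simp add: powr_minus divide_inverse)
        finally show "(\<Sum>n\<in>?I. (1 / real n)\<^sup>2) \<le> 1 / P" .
        have "(\<Sum>n\<in>?I. (cmod (dcoeff K n a))\<^sup>2) \<le> (\<Sum>n<M K. (cmod (dcoeff K n a))\<^sup>2)"
          by (rule sum_mono2) auto
        then show "(\<Sum>n\<in>?I. (cmod (dcoeff K n a))\<^sup>2) \<le> L^3 * X * A\<^sup>2"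
          using sum_dcoeff_square_le by linarith
      qed (use P_pos in \<open>auto intro: sum_nonneg\<close>)
      also have "\<dots> = (L\<^sup>2 * A)\<^sup>2"
        using P_pos unfolding X_eq by (simp add: power2_eq_square power3_eq_cube)
      finally show "(\<Sum>n\<in>?I. 1 / real n * cmod (dcoeff K n a))\<^sup>2 \<le> (L\<^sup>2 * A)\<^sup>2" .
    qed (use A_nonneg in simp)
    then have "1 / (real N * ln 2)\<^sup>2 * (\<Sum>n\<in>?I. 1 / real n * cmod (dcoeff K n a))
        \<le> 1 / (real N * ln 2)\<^sup>2 * (L\<^sup>2 * A)"
      by (rule mult_left_mono) simp
    moreover have "(\<Sum>n\<in>?I. strong_weight p n * cmod (dcoeff K n a))
        \<le> (\<Sum>n\<in>?I. 1 / (real N * ln 2)\<^sup>2 * (1 / real n) * cmod (dcoeff K n a))"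
      by (intro sum_mono mult_right_mono weight_le) auto
    moreover have "\<dots> = 1 / (real N * ln 2)\<^sup>2 * (\<Sum>n\<in>?I. 1 / real n * cmod (dcoeff K n a))"
      by (simp only: sum_distrib_left mult.assoc)
    ultimately show ?thesis by linarith
  qed
  have part3': "\<Lambda>\<^sup>2 * (\<Sum>n\<in>?I. strong_weight p n * cmod (dcoeff K n a)) \<le> C\<^sup>2 / (ln 2)\<^sup>2 * (L\<^sup>2 * A)"
  proof -
    have "\<Lambda>\<^sup>2 * (\<Sum>n\<in>?I. strong_weight p n * cmod (dcoeff K n a))
        \<le> (C * real N)\<^sup>2 * (1 / (real N * ln 2)\<^sup>2 * (L\<^sup>2 * A))"
      using \<Lambda> part3 by (intro mult_mono power_mono sum_nonneg mult_nonneg_nonneg strong_weight_nonneg) auto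
    also have "\<dots> = C\<^sup>2 / (ln 2)\<^sup>2 * (L\<^sup>2 * A)"
      using N by (simp add: power_mult_distrib)
    finally show ?thesis .
  qed
  have "strong_total p K a \<le> (\<Sum>n\<in>?I. strong_weight p n * (L\<^sup>2 * A * (1 + 2 * \<Lambda>) + \<Lambda>\<^sup>2 * cmod (dcoeff K n a)))"
    unfolding strong_total_mean_zero[OF mean]
  proof (intro sum_mono mult_left_mono)
    fix n assume "n \<in> ?I"
    then have n: "n \<le> M K" by simp
    have "(X * off_mass p N)\<^sup>2 * (cmod (dcoeff K n a) / X\<^sup>2) powr p = \<Lambda>\<^sup>2 * cmod (dcoeff K n a)"
      using X_pos unfolding p1 \<Lambda>_def by (simp add: power_mult_distrib)
    then show "(\<Sum>z\<in>{..<M K} \<times> {..<M K}. cmod (psum K n a z) powr p)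
        \<le> L\<^sup>2 * A * (1 + 2 * \<Lambda>) + \<Lambda>\<^sup>2 * cmod (dcoeff K n a)"
      using atom_term_bound[OF n] A_nonneg P_pos unfolding p1 \<Lambda>_def by simp
  qed (auto simp: strong_weight_nonneg)
  also have "\<dots> = (\<Sum>n\<in>?I. strong_weight p n) * (L\<^sup>2 * A) + (\<Sum>n\<in>?I. strong_weight p n) * (2 * \<Lambda>) * (L\<^sup>2 * A)
      + \<Lambda>\<^sup>2 * (\<Sum>n\<in>?I. strong_weight p n * cmod (dcoeff K n a))"
    by (simp add: sum_distrib_left sum_distrib_right sum.distrib algebra_simps)
  also have "\<dots> \<le> W * (L\<^sup>2 * A) + 4 * C / ln 2 * (L\<^sup>2 * A) + C\<^sup>2 / (ln 2)\<^sup>2 * (L\<^sup>2 * A)"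
    using part1 part2 part3' A_nonneg by (intro add_mono mult_right_mono) auto
  also have "\<dots> = (W + 4 * C / ln 2 + C\<^sup>2 / (ln 2)\<^sup>2) * (L\<^sup>2 * A powr p)"
    using A_nonneg by (simp only: p1 powr_one distrib_right)
  finally show ?thesis .
qed

end

section \<open>The strong inequality on a finite level\<close>

context vilenkin begin

definition square_label :: "nat \<Rightarrow> nat \<times> nat \<Rightarrow> nat \<times> nat" where
  "square_label k = (\<lambda>(u, v). (u mod M k, v mod M k))"

lemma square_class:
  "{w \<in> {..<M K} \<times> {..<M K}. square_label k w = square_label k (u, v)}
    = residue_class K k u \<times> residue_class K k v"
  unfolding square_label_def residue_class_def by auto

lemma regular_filtration_squares:
  assumes B: "\<And>k. m k \<le> B"
  shows "regular_filtration ({..<M K} \<times> {..<M K}) square_label K ((real B)\<^sup>2)"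
proof
  fix z w :: "nat \<times> nat"
  show "square_label 0 z = square_label 0 w"
    unfolding square_label_def by (simp add: case_prod_beta)
next
  fix k and z w :: "nat \<times> nat"
  assume "square_label (Suc k) z = square_label (Suc k) w"
  then have "fst z mod M (Suc k) = fst w mod M (Suc k)" "snd z mod M (Suc k) = snd w mod M (Suc k)"
    unfolding square_label_def by (simp_all add: case_prod_beta)
  then have "fst z mod M k = fst w mod M k" "snd z mod M k = snd w mod M k"
    using mod_M_antimono[OF le_SucI[OF order_refl]] by blast+
  then show "square_label k z = square_label k w"
    unfolding square_label_def case_prod_beta by (simp only:)
next
  fix z w :: "nat \<times> nat"
  assume "z \<in> {..<M K} \<times> {..<M K}" "w \<in> {..<M K} \<times> {..<M K}" "square_label K z = square_label K w"
  then show "z = w" unfolding square_label_def by auto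
next
  fix k and z :: "nat \<times> nat"
  assume k: "k < K"
  obtain u v where z: "z = (u, v)" by (cases z)
  have card: "real (card {w \<in> {..<M K} \<times> {..<M K}. square_label j w = square_label j z})
      = (real (M K) / real (M j))\<^sup>2" if "j \<le> K" for j
    unfolding z square_class using card_residue_class[OF that]
    by (simp add: card_cartesian_product power2_eq_square)
  have "real (M K) / real (M k) = real (m k) * (real (M K) / real (M (Suc k)))"
    using m_pos[of k] by (simp add: vilenkin_base_Suc)
  also have "\<dots> \<le> real B * (real (M K) / real (M (Suc k)))"
    using B[of k] by (intro mult_right_mono) auto
  finally have "(real (M K) / real (M k))\<^sup>2 \<le> (real B * (real (M K) / real (M (Suc k))))\<^sup>2"
    by (intro power_mono) auto
  then show "real (card {w \<in> {..<M K} \<times> {..<M K}. square_label k w = square_label k z})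
      \<le> (real B)\<^sup>2 * real (card {w \<in> {..<M K} \<times> {..<M K}. square_label (Suc k) w = square_label (Suc k) z})"
    unfolding card[OF less_imp_le[OF k]] card[OF Suc_leI[OF k]] power_mult_distrib .
qed simp

lemma psum_add: "psum K n (\<lambda>z. f z + h z) z = psum K n f z + psum K n h z"
proof (cases z)
  case (Pair x y)
  show ?thesis
    unfolding Pair psum_def ksum_def prod.case distrib_right sum.distrib add_divide_distrib ..
qed

lemma psum_cong:
  assumes "\<And>z. z \<in> {..<M K} \<times> {..<M K} \<Longrightarrow> f z = h z"
  shows "psum K n f = psum K n h"
  unfolding psum_def ksum_def using assms by (intro ext) (auto intro!: sum.cong)

lemma strong_total_cong:
  assumes "\<And>z. z \<in> {..<M K} \<times> {..<M K} \<Longrightarrow> f z = h z"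
  shows "strong_total p K f = strong_total p K h"
proof -
  have "psum K n f = psum K n h" for n
    by (rule psum_cong) (rule assms)
  then show ?thesis unfolding strong_total_def by (simp only:)
qed

lemma strong_total_add:
  assumes p: "0 < p" "p \<le> 1"
  shows "strong_total p K (\<lambda>z. f z + h z) \<le> strong_total p K f + strong_total p K h"
proof -
  have "cmod (psum K n (\<lambda>z. f z + h z) z) powr p \<le> cmod (psum K n f z) powr p + cmod (psum K n h z) powr p" for n z
  proof -
    have "cmod (psum K n (\<lambda>z. f z + h z) z) powr p \<le> (cmod (psum K n f z) + cmod (psum K n h z)) powr p"
      using p unfolding psum_add by (intro powr_mono2 norm_triangle_ineq) auto
    also have "\<dots> \<le> cmod (psum K n f z) powr p + cmod (psum K n h z) powr p"
      using p by (intro powr_add_le_add_powr) auto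
    finally show ?thesis .
  qed
  then have "strong_total p K (\<lambda>z. f z + h z)
      \<le> (\<Sum>n\<in>{1..<M K}. strong_weight p n * (\<Sum>z\<in>{..<M K} \<times> {..<M K}.
            cmod (psum K n f z) powr p + cmod (psum K n h z) powr p))"
    unfolding strong_total_def by (intro sum_mono mult_left_mono strong_weight_nonneg)
  also have "\<dots> = strong_total p K f + strong_total p K h"
    unfolding strong_total_def sum.distrib distrib_left ..
  finally show ?thesis .
qed

lemma vilenkin_atom_restrict:
  assumes "N \<le> K" "0 < p" "p \<le> 1" "\<And>z. cmod (a z) \<le> A"
    "\<And>w. w \<notin> residue_class K N u \<times> residue_class K N v \<Longrightarrow> a w = 0"
  shows "vilenkin_atom m K N u v A a p (real (M K) / real (M N)) (real (M N))"
  by unfold_locales (use assms in auto)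

text \<open>
  The finite form of the theorem, with a constant that does not depend on the level \<open>K\<close>: the estimates
  for atoms are inserted into \<open>atomic_bound\<close>.
\<close>
theorem strong_total_le:
  assumes p: "0 < p" "p \<le> 1" and B: "\<And>k. m k \<le> B"
  shows "\<exists>C\<ge>0. \<forall>K g. strong_total p K g
    \<le> C * (\<Sum>z\<in>{..<M K} \<times> {..<M K}. regular_filtration.maxf ({..<M K} \<times> {..<M K}) square_label K g z powr p)"
proof -
  obtain W where W: "0 \<le> W" "\<And>X. (\<Sum>n\<in>{1..<X}. strong_weight p n) \<le> W"
    using sum_strong_weight_bounded[OF p] by blast
  define C where "C = (if p < 1 then W + (1 + real B / (1 - 2 powr (p - 1)))\<^sup>2 / (2 - 2 * p)
      else W + 4 * real B / ln 2 + (real B)\<^sup>2 / (ln 2)\<^sup>2)"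
  have CW: "W \<le> C" unfolding C_def using W(1) by auto
  have top: "strong_total p K a \<le> C * ((real (M K))\<^sup>2 * A powr p)"
    if "\<And>z. cmod (a z) \<le> A" "\<And>w. w \<notin> {..<M K} \<times> {..<M K} \<Longrightarrow> a w = 0" for K A a
  proof -
    interpret vilenkin_atom m K 0 0 0 A a p "real (M K) / real (M 0)" "real (M 0)"
      by (rule vilenkin_atom_restrict) (use p that in \<open>auto simp: residue_class_def\<close>)
    have "strong_total p K a \<le> W * ((real (M K))\<^sup>2 * A powr p)"
      using strong_total_top_le[OF _ W(2)] by simp
    also have "\<dots> \<le> C * ((real (M K))\<^sup>2 * A powr p)"
      using CW by (intro mult_right_mono) auto
    finally show ?thesis .
  qed
  have atom: "strong_total p K a \<le> C * ((real (M K) / real (M N))\<^sup>2 * A powr p)"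
    if NK: "N \<le> K" and A: "\<And>z. cmod (a z) \<le> A"
      and supp: "\<And>w. w \<notin> residue_class K N u \<times> residue_class K N v \<Longrightarrow> a w = 0"
      and mean: "(\<Sum>w\<in>residue_class K N u \<times> residue_class K N v. a w) = 0" for K N A a u v
  proof -
    interpret vilenkin_atom m K N u v A a p "real (M K) / real (M N)" "real (M N)"
      by (rule vilenkin_atom_restrict[OF NK p A supp])
    have "(\<Sum>s<M K. \<Sum>t<M K. a (t, s)) = (\<Sum>t<M K. \<Sum>s<M K. a (t, s))" by (rule sum.swap)
    also have "\<dots> = (\<Sum>w\<in>{..<M K} \<times> {..<M K}. a w)" by (simp add: sum.cartesian_product)
    also have "\<dots> = (\<Sum>w\<in>residue_class K N u \<times> residue_class K N v. a w)"
      by (rule sum.mono_neutral_right) (use supp in \<open>auto simp: residue_class_def\<close>)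
    finally have mean': "(\<Sum>s<M K. \<Sum>t<M K. a (t, s)) = 0" using mean by simp
    show ?thesis
    proof (cases "p < 1")
      case True
      have "strong_total p K a \<le> (1 + real B / (1 - 2 powr (p - 1)))\<^sup>2 / (2 - 2 * p)
          * ((real (M K) / real (M N))\<^sup>2 * A powr p)"
        by (rule strong_total_atom_less_1[OF True mean' off_mass_le_of_less_1[OF p(1) True B]])
      also have "\<dots> \<le> C * ((real (M K) / real (M N))\<^sup>2 * A powr p)"
        unfolding C_def using True W(1) by (intro mult_right_mono) auto
      finally show ?thesis .
    next
      case False
      then have p1: "p = 1" using p by simp
      show ?thesis
      proof (cases "N = 0")
        case True
        have "strong_total p K a \<le> W * ((real (M K) / real (M N))\<^sup>2 * A powr p)"
          by (rule strong_total_top_le[OF True W(2)])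
        also have "\<dots> \<le> C * ((real (M K) / real (M N))\<^sup>2 * A powr p)"
          using CW by (intro mult_right_mono) auto
        finally show ?thesis .
      next
        case N0: False
        have "off_mass p N \<le> real B * real N" using off_mass_1_le[OF B] p1 by simp
        then show ?thesis
          using strong_total_atom_1[OF p1 mean' _ N0 W(2)] False unfolding C_def by simp
      qed
    qed
  qed
  define C' where "C' = C * (1 + (real B)\<^sup>2 * 8 powr p / (2 powr p - 1))"
  have C0: "0 \<le> C" using W(1) CW by linarith
  have pp: "1 < (2::real) powr p" using p by simp
  have C'0: "0 \<le> C'"
    unfolding C'_def using C0 less_imp_le[OF pp] by (intro mult_nonneg_nonneg add_nonneg_nonneg divide_nonneg_nonneg) auto
  have "strong_total p K g
      \<le> C' * (\<Sum>z\<in>{..<M K} \<times> {..<M K}. regular_filtration.maxf ({..<M K} \<times> {..<M K}) square_label K g z powr p)"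
    for K g
  proof -
    interpret regular_filtration "{..<M K} \<times> {..<M K}" square_label K "(real B)\<^sup>2"
      by (rule regular_filtration_squares[OF B])
    have cell: "cell k (u, v) = residue_class K k u \<times> residue_class K k v" for k u v
      unfolding cell_def square_class ..
    have card_cell: "real (card (cell k z)) = (real (M K) / real (M k))\<^sup>2" if "k \<le> K" for k z
      using card_residue_class[OF that]
      by (cases z) (simp add: cell card_cartesian_product power2_eq_square)
    show ?thesis
      unfolding C'_def
    proof (rule atomic_bound[OF p(1) C0])
      show "strong_total p K f = strong_total p K h"
        if "\<And>z. z \<in> {..<M K} \<times> {..<M K} \<Longrightarrow> f z = h z" for f h
        using that by (rule strong_total_cong)
      show "strong_total p K (\<lambda>z. 0) = 0"
        unfolding strong_total_def psum_def ksum_def by (simp add: case_prod_beta)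
      show "strong_total p K (\<lambda>z. f z + h z) \<le> strong_total p K f + strong_total p K h" for f h
        by (rule strong_total_add[OF p])
      show "strong_total p K (\<lambda>z. c) \<le> C * real (card ({..<M K} \<times> {..<M K})) * cmod c powr p" for c
      proof -
        have "strong_total p K (\<lambda>z. c) = strong_total p K (\<lambda>z. if z \<in> {..<M K} \<times> {..<M K} then c else 0)"
          by (rule strong_total_cong) simp
        also have "\<dots> \<le> C * ((real (M K))\<^sup>2 * cmod c powr p)"
          by (rule top) auto
        finally show ?thesis by (simp add: card_cartesian_product power2_eq_square mult.assoc)
      qed
    next
      fix k z A a
      assume k: "k < K" and supp: "\<And>w. w \<notin> cell k z \<Longrightarrow> a w = 0"
        and A: "\<And>w. cmod (a w) \<le> A" and mean: "(\<Sum>w\<in>cell k z. a w) = 0"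
      obtain u v where z: "z = (u, v)" by (cases z)
      have "strong_total p K a \<le> C * ((real (M K) / real (M k))\<^sup>2 * A powr p)"
        using k supp mean unfolding z cell by (intro atom[where u = u and v = v] A) auto
      then show "strong_total p K a \<le> C * real (card (cell k z)) * A powr p"
        using card_cell[of k z] k by (simp only: less_imp_le mult.assoc)
    qed simp
  qed
  then show ?thesis using C'0 by blast
qed

end

section \<open>From the Vilenkin group to residues\<close>

lemma epowr_ennreal: "0 \<le> r \<Longrightarrow> ennreal r epowr a = ennreal (r powr a)"
  unfolding ennreal_powr_def by simp

lemma epowr_mono:
  assumes "x \<le> y" "0 < a" shows "x epowr a \<le> y epowr a"
proof (cases "y = \<infinity>")
  case False
  then have "x \<noteq> \<infinity>" "enn2real x \<le> enn2real y"
    using assms(1) by (auto simp: top_unique intro!: enn2real_mono simp: less_top)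
  then show ?thesis
    unfolding ennreal_powr_def using False assms(2) by (auto intro!: ennreal_leI powr_mono2)
qed (simp add: ennreal_powr_def)

lemma Lp_norm_epowr:
  assumes "0 < p"
  shows "Lp_norm p M g epowr p = (\<integral>\<^sup>+z. g z epowr p \<partial>M)"
proof -
  have "(x epowr (1 / p)) epowr p = x" for x
    unfolding ennreal_powr_def using assms by (auto simp: powr_powr less_top)
  then show ?thesis unfolding Lp_norm_def .
qed

context vilenkin begin

abbreviation G :: "(nat \<Rightarrow> nat) measure" where "G \<equiv> vilenkin_measure m"

abbreviation cyl :: "nat \<Rightarrow> nat \<Rightarrow> (nat \<Rightarrow> nat) set" where
  "cyl n u \<equiv> vilenkin_interval m n (dig u)"

definition square :: "nat \<Rightarrow> nat \<times> nat \<Rightarrow> ((nat \<Rightarrow> nat) \<times> (nat \<Rightarrow> nat)) set" where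
  "square n = (\<lambda>(u, v). cyl n u \<times> cyl n v)"

definition point :: "nat \<times> nat \<Rightarrow> (nat \<Rightarrow> nat) \<times> (nat \<Rightarrow> nat)" where
  "point = (\<lambda>(u, v). (dig u, dig v))"

text \<open>
  \<open>point\<close> selects a representative of each square, and \<open>cellwise n F\<close> says that \<open>F\<close> is constant on
  the squares of level \<open>n\<close>. For such functions all integrals are finite sums.
\<close>
definition cellwise :: "nat \<Rightarrow> ((nat \<Rightarrow> nat) \<times> (nat \<Rightarrow> nat) \<Rightarrow> 'c) \<Rightarrow> bool" where
  "cellwise n F \<longleftrightarrow> (\<forall>w. \<forall>z\<in>square n w. F z = F (point w))"

lemma cellwiseD: "cellwise n F \<Longrightarrow> z \<in> square n w \<Longrightarrow> F z = F (point w)"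
  unfolding cellwise_def by blast

lemma space_G: "space G = {x. \<forall>k. x k < m k}"
  unfolding vilenkin_measure_def by (auto simp: space_PiM PiE_iff space_uniform_count_measure)

lemma dig_in_space: "dig u \<in> space G"
  unfolding space_G using dig_less by simp

lemma prob_factor: "prob_space (uniform_count_measure {..<m k})"
  using m_pos[of k] by (intro prob_space_uniform_count_measure) auto

sublocale G: prob_space "vilenkin_measure m"
  unfolding vilenkin_measure_def by (rule prob_space_PiM) (rule prob_factor)

sublocale GG: pair_prob_space "vilenkin_measure m" "vilenkin_measure m" ..

lemma interval_eq_emb:
  assumes "x \<in> space G"
  shows "vilenkin_interval m n x
    = prod_emb UNIV (\<lambda>k. uniform_count_measure {..<m k}) {..<n} (Pi\<^sub>E {..<n} (\<lambda>k. {x k}))"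
proof -
  have "(\<Pi>\<^sub>E k\<in>UNIV. space (uniform_count_measure {..<m k})) = space G"
    unfolding vilenkin_measure_def space_PiM ..
  then show ?thesis
    unfolding vilenkin_interval_def prod_emb_def by auto
qed

lemma sets_interval:
  assumes x: "x \<in> space G" shows "vilenkin_interval m n x \<in> sets G"
proof -
  have "x k < m k" for k using x by (simp add: space_G)
  then show ?thesis
    unfolding interval_eq_emb[OF x] unfolding vilenkin_measure_def
    by (intro sets_PiM_I) (auto simp: sets_uniform_count_measure)
qed

lemma emeasure_interval:
  assumes x: "x \<in> space G"
  shows "emeasure G (vilenkin_interval m n x) = ennreal (1 / real (M n))"
proof -
  have "emeasure G (vilenkin_interval m n x) = (\<Prod>k<n. emeasure (uniform_count_measure {..<m k}) {x k})"
    unfolding interval_eq_emb[OF x] unfolding vilenkin_measure_def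
    by (rule emeasure_PiM_emb[OF prob_factor])
      (use x in \<open>auto simp: space_G sets_uniform_count_measure\<close>)
  also have "\<dots> = (\<Prod>k<n. ennreal (1 / real (m k)))"
    using x by (intro prod.cong refl) (simp add: emeasure_uniform_count_measure space_G)
  also have "\<dots> = ennreal (\<Prod>k<n. 1 / real (m k))"
    by (rule prod_ennreal) simp
  also have "(\<Prod>k<n. 1 / real (m k)) = 1 / real (M n)"
    unfolding vilenkin_base_def by (simp add: prod_dividef)
  finally show ?thesis .
qed

lemma sets_square: "square n w \<in> sets (vilenkin_measure2 m)"
  unfolding square_def by (auto simp: case_prod_beta intro!: pair_measureI sets_interval dig_in_space)

lemma emeasure_square: "emeasure (vilenkin_measure2 m) (square n w) = ennreal (1 / (real (M n))\<^sup>2)"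
proof -
  obtain u v where w: "w = (u, v)" by (cases w)
  have "emeasure (vilenkin_measure2 m) (square n w) = emeasure G (cyl n u) * emeasure G (cyl n v)"
    unfolding w square_def prod.case
    by (rule G.emeasure_pair_measure_Times) (intro sets_interval dig_in_space)+
  also have "\<dots> = ennreal (1 / (real (M n))\<^sup>2)"
    unfolding emeasure_interval[OF dig_in_space]
    by (subst ennreal_mult[symmetric]) (auto simp: power2_eq_square)
  finally show ?thesis .
qed

lemma measure_square: "measure (vilenkin_measure2 m) (square n w) = 1 / (real (M n))\<^sup>2"
  by (simp add: measure_def emeasure_square)

lemma point_in_square: "point w \<in> square n w"
  unfolding point_def square_def vilenkin_interval_def using dig_in_space by (auto simp: case_prod_beta)

lemma in_cyl_iff: "x \<in> cyl n u \<longleftrightarrow> x \<in> space G \<and> (\<forall>k<n. x k = dig u k)"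
  unfolding vilenkin_interval_def by simp

lemma square_subset_space: "square n w \<subseteq> space (vilenkin_measure2 m)"
  using sets.sets_into_space[OF sets_square] .

lemma cyl_cover:
  assumes x: "x \<in> space G" shows "\<exists>!u. u < M n \<and> x \<in> cyl n u"
proof (rule ex_ex1I)
  define u where "u = (\<Sum>j<n. x j * M j)"
  have xm: "x k < m k" for k using x by (simp add: space_G)
  have "u < M n" unfolding u_def by (rule vilenkin_partial_less[OF xm])
  moreover have "dig u k = x k" if "k < n" for k
    using vilenkin_digit_unique[of x m u n k, OF xm u_def that] .
  ultimately show "\<exists>u. u < M n \<and> x \<in> cyl n u" using x by (auto simp: in_cyl_iff)
next
  fix u v assume u: "u < M n \<and> x \<in> cyl n u" and v: "v < M n \<and> x \<in> cyl n v"
  then have "\<forall>k<n. dig u k = dig v k" by (simp add: in_cyl_iff)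
  then have "u mod M n = v mod M n" by (simp add: mod_M_eq_iff)
  then show "u = v" using u v by simp
qed

lemma square_cover:
  assumes z: "z \<in> space (vilenkin_measure2 m)"
  shows "\<exists>!w. w \<in> {..<M n} \<times> {..<M n} \<and> z \<in> square n w"
proof -
  obtain x y where xy: "z = (x, y)" "x \<in> space G" "y \<in> space G"
    using z by (auto simp: space_pair_measure)
  obtain u where u: "u < M n" "x \<in> cyl n u" "\<And>u'. u' < M n \<Longrightarrow> x \<in> cyl n u' \<Longrightarrow> u' = u"
    using cyl_cover[OF xy(2)] by blast
  obtain v where v: "v < M n" "y \<in> cyl n v" "\<And>v'. v' < M n \<Longrightarrow> y \<in> cyl n v' \<Longrightarrow> v' = v"
    using cyl_cover[OF xy(3)] by blast
  show ?thesis
  proof (rule ex1I[of _ "(u, v)"])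
    show "(u, v) \<in> {..<M n} \<times> {..<M n} \<and> z \<in> square n (u, v)"
      using u(1,2) v(1,2) xy by (simp add: square_def)
    fix w assume w: "w \<in> {..<M n} \<times> {..<M n} \<and> z \<in> square n w"
    obtain u' v' where w': "w = (u', v')" by (cases w)
    have "u' = u" by (rule u(3)) (use w xy in \<open>simp_all add: w' square_def\<close>)
    moreover have "v' = v" by (rule v(3)) (use w xy in \<open>simp_all add: w' square_def\<close>)
    ultimately show "w = (u, v)" using w' by simp
  qed
qed

lemma sum_over_squares:
  fixes \<phi> :: "nat \<times> nat \<Rightarrow> 'c::comm_monoid_add"
  assumes z: "z \<in> space (vilenkin_measure2 m)"
    and w: "w \<in> {..<M n} \<times> {..<M n}" "z \<in> square n w"
  shows "(\<Sum>w'\<in>{..<M n} \<times> {..<M n}. if z \<in> square n w' then \<phi> w' else 0) = \<phi> w"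
proof -
  have iff: "z \<in> square n w' \<longleftrightarrow> w' = w" if "w' \<in> {..<M n} \<times> {..<M n}" for w'
    using square_cover[OF z, of n] w that by blast
  have "(\<Sum>w'\<in>{..<M n} \<times> {..<M n}. if z \<in> square n w' then \<phi> w' else 0)
      = (\<Sum>w'\<in>{..<M n} \<times> {..<M n}. if w' = w then \<phi> w' else 0)"
    by (rule sum.cong[OF refl]) (simp only: iff)
  also have "\<dots> = \<phi> w" using w(1) by (subst sum.delta) auto
  finally show ?thesis .
qed

lemma nn_integral_cellwise:
  assumes F: "cellwise n F"
  shows "(\<integral>\<^sup>+z. F z \<partial>vilenkin_measure2 m)
    = (\<Sum>w\<in>{..<M n} \<times> {..<M n}. F (point w) * ennreal (1 / (real (M n))\<^sup>2))"
proof -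
  have "(\<integral>\<^sup>+z. F z \<partial>vilenkin_measure2 m)
      = (\<integral>\<^sup>+z. (\<Sum>w\<in>{..<M n} \<times> {..<M n}. F (point w) * indicator (square n w) z) \<partial>vilenkin_measure2 m)"
  proof (rule nn_integral_cong)
    fix z assume z: "z \<in> space (vilenkin_measure2 m)"
    obtain w where w: "w \<in> {..<M n} \<times> {..<M n}" "z \<in> square n w"
      using ex1_implies_ex[OF square_cover[OF z, of n]] by blast
    have "(\<Sum>w\<in>{..<M n} \<times> {..<M n}. F (point w) * indicator (square n w) z)
        = (\<Sum>w'\<in>{..<M n} \<times> {..<M n}. if z \<in> square n w' then F (point w') else 0)"
      by (intro sum.cong refl) (auto simp: indicator_def)
    also have "\<dots> = F (point w)" by (rule sum_over_squares[OF z w])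
    also have "\<dots> = F z" by (rule cellwiseD[OF F w(2), symmetric])
    finally show "F z = (\<Sum>w\<in>{..<M n} \<times> {..<M n}. F (point w) * indicator (square n w) z)" by simp
  qed
  also have "\<dots> = (\<Sum>w\<in>{..<M n} \<times> {..<M n}. \<integral>\<^sup>+z. F (point w) * indicator (square n w) z \<partial>vilenkin_measure2 m)"
    by (rule nn_integral_sum) (intro borel_measurable_times_ennreal borel_measurable_const borel_measurable_indicator sets_square)
  also have "\<dots> = (\<Sum>w\<in>{..<M n} \<times> {..<M n}. F (point w) * ennreal (1 / (real (M n))\<^sup>2))"
    by (intro sum.cong refl) (simp add: nn_integral_cmult_indicator[OF sets_square] emeasure_square)
  finally show ?thesis .
qed

lemma integral_mult_cellwise:
  fixes f h :: "(nat \<Rightarrow> nat) \<times> (nat \<Rightarrow> nat) \<Rightarrow> complex"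
  assumes f: "integrable (vilenkin_measure2 m) f" and h: "cellwise n h"
  shows "(LINT z|vilenkin_measure2 m. f z * h z)
    = (\<Sum>w\<in>{..<M n} \<times> {..<M n}. h (point w) * (LINT z:square n w|vilenkin_measure2 m. f z))"
proof -
  have int: "integrable (vilenkin_measure2 m) (\<lambda>z. indicator (square n w) z *\<^sub>R f z)" for w
    by (rule integrable_mult_indicator[OF sets_square f])
  have "(LINT z|vilenkin_measure2 m. f z * h z)
      = (LINT z|vilenkin_measure2 m. (\<Sum>w\<in>{..<M n} \<times> {..<M n}. h (point w) * (indicator (square n w) z *\<^sub>R f z)))"
  proof (rule Bochner_Integration.integral_cong[OF refl])
    fix z assume z: "z \<in> space (vilenkin_measure2 m)"
    obtain w where w: "w \<in> {..<M n} \<times> {..<M n}" "z \<in> square n w"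
      using ex1_implies_ex[OF square_cover[OF z, of n]] by blast
    have "(\<Sum>w\<in>{..<M n} \<times> {..<M n}. h (point w) * (indicator (square n w) z *\<^sub>R f z))
        = (\<Sum>w'\<in>{..<M n} \<times> {..<M n}. if z \<in> square n w' then h (point w') * f z else 0)"
      by (intro sum.cong refl) (auto simp: indicator_def)
    also have "\<dots> = h (point w) * f z" by (rule sum_over_squares[OF z w])
    also have "\<dots> = f z * h z" unfolding cellwiseD[OF h w(2)] by (rule mult.commute)
    finally show "f z * h z = (\<Sum>w\<in>{..<M n} \<times> {..<M n}. h (point w) * (indicator (square n w) z *\<^sub>R f z))" by simp
  qed
  also have "\<dots> = (\<Sum>w\<in>{..<M n} \<times> {..<M n}. LINT z|vilenkin_measure2 m. h (point w) * (indicator (square n w) z *\<^sub>R f z))"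
    by (rule Bochner_Integration.integral_sum) (intro integrable_mult_right int)
  also have "\<dots> = (\<Sum>w\<in>{..<M n} \<times> {..<M n}. h (point w) * (LINT z:square n w|vilenkin_measure2 m. f z))"
    unfolding set_lebesgue_integral_def by (intro sum.cong refl integral_mult_right_zero)
  finally show ?thesis .
qed

lemma set_integral_square_cellwise:
  fixes f :: "(nat \<Rightarrow> nat) \<times> (nat \<Rightarrow> nat) \<Rightarrow> complex"
  assumes f: "cellwise n f"
  shows "(LINT z:square n w|vilenkin_measure2 m. f z) = f (point w) / (of_nat (M n))\<^sup>2"
proof -
  have "(LINT z:square n w|vilenkin_measure2 m. f z)
      = (LINT z|vilenkin_measure2 m. indicator (square n w) z *\<^sub>R f (point w))"
    unfolding set_lebesgue_integral_def
    by (rule Bochner_Integration.integral_cong[OF refl]) (auto simp: indicator_def cellwiseD[OF f, of _ w])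
  also have "\<dots> = measure (vilenkin_measure2 m) (square n w) *\<^sub>R f (point w)"
    using sets_square[of n w] square_subset_space[of n w]
    by (subst integral_scaleR_left) (auto simp: Int_absorb2 emeasure_square intro!: integrable_real_indicator)
  finally show ?thesis by (simp add: measure_square scaleR_conv_of_real)
qed

lemma space_square_algebra: "space (square_algebra m n) = space (vilenkin_measure2 m)"
  unfolding square_algebra_def by (rule space_measure_of_conv)

lemma sets_square_algebra:
  "sets (square_algebra m n) = sigma_sets (space (vilenkin_measure2 m))
     {vilenkin_interval m n x \<times> vilenkin_interval m n y | x y. x \<in> space G \<and> y \<in> space G}"
  unfolding square_algebra_def
  by (rule sets_measure_of) (auto simp: space_pair_measure vilenkin_interval_def)

lemma subalgebra_square_algebra: "subalgebra (vilenkin_measure2 m) (square_algebra m n)"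
  unfolding subalgebra_def
proof
  show "sets (square_algebra m n) \<subseteq> sets (vilenkin_measure2 m)"
    unfolding sets_square_algebra by (rule sets.sigma_sets_subset) (auto intro!: pair_measureI sets_interval)
qed (rule space_square_algebra)

lemma square_in_algebra: "square n w \<in> sets (square_algebra m n)"
  unfolding sets_square_algebra square_def
  by (rule sigma_sets.Basic) (auto simp: case_prod_beta intro: dig_in_space)

text \<open>The sets that do not separate points of a square form a sigma-algebra containing the generators.\<close>
lemma square_algebra_saturated:
  assumes "A \<in> sets (square_algebra m n)" "z \<in> square n w" "z' \<in> square n w"
  shows "z \<in> A \<longleftrightarrow> z' \<in> A"
  using assms(1) unfolding sets_square_algebra
proof (induction rule: sigma_sets.induct)
  case (Basic B)
  then show ?case using assms(2,3) unfolding square_def by (auto simp: case_prod_beta vilenkin_interval_def)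
next
  case (Compl B)
  then show ?case using assms(2,3) square_subset_space by blast
qed auto

lemma cellwise_of_measurable:
  fixes f :: "(nat \<Rightarrow> nat) \<times> (nat \<Rightarrow> nat) \<Rightarrow> complex"
  assumes f: "f \<in> borel_measurable (square_algebra m n)"
  shows "cellwise n f"
  unfolding cellwise_def
proof (intro allI ballI)
  fix w z assume z: "z \<in> square n w"
  have "f -` {f z} \<inter> space (square_algebra m n) \<in> sets (square_algebra m n)"
    using f by (rule measurable_sets) simp
  moreover have "z \<in> f -` {f z} \<inter> space (square_algebra m n)"
    using z square_subset_space[of n w] by (auto simp: space_square_algebra)
  ultimately have "point w \<in> f -` {f z} \<inter> space (square_algebra m n)"
    using square_algebra_saturated[OF _ z point_in_square] by blast
  then show "f z = f (point w)" by simp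
qed

lemma set_integral_cond_exp:
  assumes f: "integrable (vilenkin_measure2 m) f"
  shows "(LINT z:square n w|vilenkin_measure2 m. f z)
    = Complex (LINT z:square n w|vilenkin_measure2 m. real_cond_exp (vilenkin_measure2 m) (square_algebra m n) (\<lambda>w. Re (f w)) z)
        (LINT z:square n w|vilenkin_measure2 m. real_cond_exp (vilenkin_measure2 m) (square_algebra m n) (\<lambda>w. Im (f w)) z)"
proof -
  interpret fs: finite_measure_subalgebra "vilenkin_measure2 m" "square_algebra m n"
    by unfold_locales (rule subalgebra_square_algebra)
  have int: "integrable (vilenkin_measure2 m) (\<lambda>z. indicator (square n w) z *\<^sub>R f z)"
    by (rule integrable_mult_indicator[OF sets_square f])
  have fRe: "integrable (vilenkin_measure2 m) (\<lambda>z. Re (f z))"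
    and fIm: "integrable (vilenkin_measure2 m) (\<lambda>z. Im (f z))"
    using f by auto
  have "Re (LINT z:square n w|vilenkin_measure2 m. f z) = (LINT z:square n w|vilenkin_measure2 m. Re (f z))"
    unfolding set_lebesgue_integral_def
    by (subst integral_bounded_linear[OF bounded_linear_Re int, symmetric]) simp
  moreover have "Im (LINT z:square n w|vilenkin_measure2 m. f z) = (LINT z:square n w|vilenkin_measure2 m. Im (f z))"
    unfolding set_lebesgue_integral_def
    by (subst integral_bounded_linear[OF bounded_linear_Im int, symmetric]) simp
  ultimately show ?thesis
    by (intro complex_eqI)
      (simp_all only: complex.sel fs.real_cond_exp_intA[OF fRe square_in_algebra] fs.real_cond_exp_intA[OF fIm square_in_algebra])
qed

text \<open>
  The martingale property is an identity almost everywhere between conditional expectations. Integration over a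
  square turns it into an identity of numbers.
\<close>
lemma martingale_set_integral:
  assumes f: "square_martingale m f" and "n \<le> k"
  shows "(LINT z:square n w|vilenkin_measure2 m. f k z) = (LINT z:square n w|vilenkin_measure2 m. f n z)"
proof -
  let ?N = "vilenkin_measure2 m"
  let ?re = "real_cond_exp ?N (square_algebra m n) (\<lambda>w. Re (f k w))"
  let ?im = "real_cond_exp ?N (square_algebra m n) (\<lambda>w. Im (f k w))"
  have int: "integrable ?N (f j)" for j using f unfolding square_martingale_def by blast
  have ae: "AE z in ?N. Complex (?re z) (?im z) = f n z"
    using f assms(2) unfolding square_martingale_def complex_cond_exp_def by blast
  have aeRe: "AE z in ?N. ?re z = Re (f n z)"
    using ae by (rule eventually_mono) (metis complex.sel(1))
  have aeIm: "AE z in ?N. ?im z = Im (f n z)"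
    using ae by (rule eventually_mono) (metis complex.sel(2))
  have intn: "integrable ?N (\<lambda>z. indicator (square n w) z *\<^sub>R f n z)"
    by (rule integrable_mult_indicator[OF sets_square int])
  have [measurable]: "square n w \<in> sets ?N" "f n \<in> borel_measurable ?N"
    using sets_square int by auto
  have meas: "?re \<in> borel_measurable ?N" "?im \<in> borel_measurable ?N"
    using measurable_from_subalg[OF subalgebra_square_algebra] borel_measurable_cond_exp borel_measurable_cond_exp2 by blast+
  have "(LINT z:square n w|?N. ?re z) = (LINT z:square n w|?N. Re (f n z))"
    unfolding set_lebesgue_integral_def
    by (rule integral_cong_AE) (use aeRe meas in \<open>auto elim!: eventually_mono\<close>)
  also have "\<dots> = Re (LINT z:square n w|?N. f n z)"
    unfolding set_lebesgue_integral_def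
    by (subst integral_bounded_linear[OF bounded_linear_Re intn, symmetric]) simp
  finally have 1: "(LINT z:square n w|?N. ?re z) = Re (LINT z:square n w|?N. f n z)" .
  have "(LINT z:square n w|?N. ?im z) = (LINT z:square n w|?N. Im (f n z))"
    unfolding set_lebesgue_integral_def
    by (rule integral_cong_AE) (use aeIm meas in \<open>auto elim!: eventually_mono\<close>)
  also have "\<dots> = Im (LINT z:square n w|?N. f n z)"
    unfolding set_lebesgue_integral_def
    by (subst integral_bounded_linear[OF bounded_linear_Im intn, symmetric]) simp
  finally have 2: "(LINT z:square n w|?N. ?im z) = Im (LINT z:square n w|?N. f n z)" .
  show ?thesis unfolding set_integral_cond_exp[OF int[of k]] 1 2 by (simp add: complex_eq_iff)
qed

lemma martingale_cellwise: "square_martingale m f \<Longrightarrow> cellwise n (f n)"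
  unfolding square_martingale_def by (intro cellwise_of_measurable) blast

lemma martingale_square_average:
  assumes f: "square_martingale m f" and "n \<le> k"
  shows "(LINT z:square n w|vilenkin_measure2 m. f k z) = f n (point w) / (of_nat (M n))\<^sup>2"
  unfolding martingale_set_integral[OF assms] by (rule set_integral_square_cellwise[OF martingale_cellwise[OF f]])

lemma vilenkin_fun_cyl:
  assumes i: "i < M K" and x: "x \<in> cyl K u"
  shows "vilenkin_fun m i x = chr i u"
proof -
  have "k < K" if "dig i k \<noteq> 0" for k
  proof (rule ccontr)
    assume "\<not> k < K"
    then have "dig i k = 0" using dig_eq_0[OF i] by simp
    then show False using that by simp
  qed
  then have "rademacher m k x = rademacher m k (dig u)" if "dig i k \<noteq> 0" for k
    using x that unfolding rademacher_def by (simp add: in_cyl_iff)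
  then show ?thesis
    unfolding chr_def vilenkin_fun_def by (intro prod.cong) auto
qed

lemma vilenkin_fun_square:
  assumes "i < M K" "(x, y) \<in> square K (u, v)"
  shows "vilenkin_fun m i x = chr i u" "vilenkin_fun m i y = chr i v"
  using assms(2) vilenkin_fun_cyl[OF assms(1)] by (auto simp: square_def)

text \<open>
  For \<open>k \<ge> K\<close> the integrals in the definition do not depend on \<open>k\<close>, since the two characters are
  constant on squares of level \<open>K\<close> and the averages of \<open>f k\<close> over these squares are the values of \<open>f K\<close>.
\<close>
lemma fourier_coeff_martingale:
  assumes f: "square_martingale m f" and i: "i < M K" and j: "j < M K"
  shows "fourier_coeff m f i j
    = (\<Sum>(t, s)\<in>{..<M K} \<times> {..<M K}. f K (point (t, s)) * cnj (chr i t) * cnj (chr j s)) / (of_nat (M K))\<^sup>2"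
    (is "_ = ?c")
proof -
  define h where "h = (\<lambda>(x, y). cnj (vilenkin_fun m i x) * cnj (vilenkin_fun m j y))"
  have h_square: "h z = cnj (chr i u) * cnj (chr j v)" if "z \<in> square K (u, v)" for z u v
    using that vilenkin_fun_square(1)[OF i] vilenkin_fun_square(2)[OF j]
    unfolding h_def by (cases z) auto
  have h: "cellwise K h"
    unfolding cellwise_def
  proof (intro allI ballI)
    fix w z assume "z \<in> square K w"
    then show "h z = h (point w)"
      using h_square[of z "fst w" "snd w"] h_square[OF point_in_square, of "fst w" "snd w"] by simp
  qed
  have "(LINT (x, y)|vilenkin_measure2 m.
      f k (x, y) * cnj (vilenkin_fun m i x) * cnj (vilenkin_fun m j y)) = ?c" if k: "K \<le> k" for k
  proof -
    have int: "integrable (vilenkin_measure2 m) (f k)" using f unfolding square_martingale_def by blast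
    have "(LINT (x, y)|vilenkin_measure2 m. f k (x, y) * cnj (vilenkin_fun m i x) * cnj (vilenkin_fun m j y))
        = (LINT z|vilenkin_measure2 m. f k z * h z)"
      unfolding h_def by (rule Bochner_Integration.integral_cong[OF refl]) (simp add: case_prod_beta mult.assoc)
    also have "\<dots> = (\<Sum>w\<in>{..<M K} \<times> {..<M K}. h (point w) * (f K (point w) / (of_nat (M K))\<^sup>2))"
      unfolding integral_mult_cellwise[OF int h] martingale_square_average[OF f k] ..
    also have "\<dots> = ?c"
      unfolding sum_divide_distrib
    proof (intro sum.cong refl)
      fix w :: "nat \<times> nat"
      obtain t s where w: "w = (t, s)" by (cases w)
      show "h (point w) * (f K (point w) / (of_nat (M K))\<^sup>2)
          = (case w of (t, s) \<Rightarrow> f K (point (t, s)) * cnj (chr i t) * cnj (chr j s)) / (of_nat (M K))\<^sup>2"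
        unfolding w h_square[OF point_in_square] by simp
    qed
    finally show ?thesis .
  qed
  then show ?thesis
    unfolding fourier_coeff_def
    by (intro limI tendsto_eventually) (auto simp: eventually_sequentially)
qed

lemma partial_sum_square:
  assumes f: "square_martingale m f" and n: "n \<le> M K" and z: "z \<in> square K w"
  shows "partial_sum m n n f z = psum K n (\<lambda>w. f K (point w)) w"
proof -
  obtain x y where xy: "z = (x, y)" by (cases z)
  obtain u v where w: "w = (u, v)" by (cases w)
  let ?g = "\<lambda>w. f K (point w)"
  have "partial_sum m n n f z = (\<Sum>i<n. \<Sum>j<n.
      (\<Sum>t<M K. \<Sum>s<M K. ?g (t, s) * cnj (chr i t) * cnj (chr j s)) / (of_nat (M K))\<^sup>2 * chr i u * chr j v)"
    unfolding xy partial_sum_def prod.case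
  proof (intro sum.cong refl)
    fix i j assume "i \<in> {..<n}" "j \<in> {..<n}"
    then have i: "i < M K" and j: "j < M K" using n by auto
    show "fourier_coeff m f i j * vilenkin_fun m i x * vilenkin_fun m j y
        = (\<Sum>t<M K. \<Sum>s<M K. ?g (t, s) * cnj (chr i t) * cnj (chr j s)) / (of_nat (M K))\<^sup>2 * chr i u * chr j v"
      unfolding fourier_coeff_martingale[OF f i j] vilenkin_fun_square(1)[OF i z[unfolded xy w]]
        vilenkin_fun_square(2)[OF j z[unfolded xy w]] sum.cartesian_product ..
  qed
  also have "\<dots> = (\<Sum>i<n. \<Sum>j<n. \<Sum>t<M K. \<Sum>s<M K.
      ?g (t, s) * (chr i u * cnj (chr i t)) * (chr j v * cnj (chr j s))) / (of_nat (M K))\<^sup>2"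
    unfolding sum_divide_distrib sum_distrib_right
    by (intro sum.cong refl) (simp add: mult_ac)
  also have "(\<Sum>i<n. \<Sum>j<n. \<Sum>t<M K. \<Sum>s<M K. ?g (t, s) * (chr i u * cnj (chr i t)) * (chr j v * cnj (chr j s)))
      = (\<Sum>i<n. \<Sum>t<M K. \<Sum>j<n. \<Sum>s<M K. ?g (t, s) * (chr i u * cnj (chr i t)) * (chr j v * cnj (chr j s)))"
    by (rule sum.cong[OF refl], rule sum.swap)
  also have "\<dots> = (\<Sum>i<n. \<Sum>t<M K. \<Sum>s<M K. \<Sum>j<n. ?g (t, s) * (chr i u * cnj (chr i t)) * (chr j v * cnj (chr j s)))"
    by (rule sum.cong[OF refl], rule sum.cong[OF refl], rule sum.swap)
  also have "\<dots> = (\<Sum>i<n. \<Sum>s<M K. \<Sum>t<M K. \<Sum>j<n. ?g (t, s) * (chr i u * cnj (chr i t)) * (chr j v * cnj (chr j s)))"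
    by (rule sum.cong[OF refl], rule sum.swap)
  also have "\<dots> = (\<Sum>s<M K. \<Sum>i<n. \<Sum>t<M K. \<Sum>j<n. ?g (t, s) * (chr i u * cnj (chr i t)) * (chr j v * cnj (chr j s)))"
    by (rule sum.swap)
  also have "\<dots> = (\<Sum>s<M K. \<Sum>t<M K. \<Sum>i<n. \<Sum>j<n. ?g (t, s) * (chr i u * cnj (chr i t)) * (chr j v * cnj (chr j s)))"
    by (rule sum.cong[OF refl], rule sum.swap)
  also have "\<dots> = ksum K n ?g u v"
    unfolding ksum_def
  proof (rule sum.cong[OF refl])
    fix s
    show "(\<Sum>t<M K. \<Sum>i<n. \<Sum>j<n. ?g (t, s) * (chr i u * cnj (chr i t)) * (chr j v * cnj (chr j s)))
        = (\<Sum>t<M K. ?g (t, s) * kernel n u t) * kernel n v s"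
      unfolding kernel_def sum_distrib_left[symmetric] sum_distrib_right[symmetric] ..
  qed
  finally show ?thesis unfolding w psum_def by simp
qed

text \<open>
  The martingale of the finite model that is generated by \<open>f K\<close> is the given one, so the two
  maximal functions can be compared.
\<close>
lemma cexp_martingale:
  assumes f: "square_martingale m f" and B: "\<And>k. m k \<le> B" and k: "k \<le> K"
    and w: "w \<in> {..<M K} \<times> {..<M K}"
  shows "regular_filtration.cexp ({..<M K} \<times> {..<M K}) square_label k (\<lambda>w. f K (point w)) w = f k (point w)"
proof -
  interpret rf: regular_filtration "{..<M K} \<times> {..<M K}" square_label K "(real B)\<^sup>2"
    by (rule regular_filtration_squares[OF B])
  obtain u v where uv: "w = (u, v)" by (cases w)
  have cell: "rf.cell k w = residue_class K k u \<times> residue_class K k v"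
    unfolding rf.cell_def uv square_class ..
  have card: "real (card (rf.cell k w)) = (real (M K) / real (M k))\<^sup>2"
    unfolding cell using card_residue_class[OF k] by (simp add: card_cartesian_product power2_eq_square)
  define h :: "(nat \<Rightarrow> nat) \<times> (nat \<Rightarrow> nat) \<Rightarrow> complex" where "h z = (if z \<in> square k w then 1 else 0)" for z
  have h_square: "h z = (if w' \<in> rf.cell k w then 1 else 0)"
    if z: "z \<in> square K w'" and w': "w' \<in> {..<M K} \<times> {..<M K}" for z w'
  proof -
    obtain x y where xy: "z = (x, y)" by (cases z)
    obtain u' v' where uv': "w' = (u', v')" by (cases w')
    have cyl_iff: "x \<in> cyl k a \<longleftrightarrow> b mod M k = a mod M k" if "x \<in> cyl K b" for x a b
      using that k unfolding in_cyl_iff mod_M_eq_iff by (auto dest: less_le_trans)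
    have "z \<in> square k w \<longleftrightarrow> u' mod M k = u mod M k \<and> v' mod M k = v mod M k"
      using z cyl_iff[of x u' u] cyl_iff[of y v' v] unfolding xy uv uv' square_def by simp
    also have "\<dots> \<longleftrightarrow> w' \<in> rf.cell k w"
      using w' unfolding cell uv' residue_class_def by auto
    finally show ?thesis unfolding h_def by (simp only:)
  qed
  have int: "integrable (vilenkin_measure2 m) (f K)" using f unfolding square_martingale_def by blast
  have hcw: "cellwise K h"
    unfolding cellwise_def
  proof (intro allI ballI)
    fix w' z assume z: "z \<in> square K w'"
    have cyl_iff: "x \<in> cyl k a \<longleftrightarrow> x' \<in> cyl k a" if "x \<in> cyl K b" "x' \<in> cyl K b" for x x' a b
      using that k unfolding in_cyl_iff by (auto dest: less_le_trans)
    obtain x y where xy: "z = (x, y)" by (cases z)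
    obtain u' v' where uv': "w' = (u', v')" by (cases w')
    have "z \<in> square k w \<longleftrightarrow> point w' \<in> square k w"
      using z point_in_square[of w' K] cyl_iff[of x u' "dig u'" u] cyl_iff[of y v' "dig v'" v]
      unfolding xy uv uv' square_def point_def by simp
    then show "h z = h (point w')" unfolding h_def by (simp only:)
  qed
  have "f k (point w) / (of_nat (M k))\<^sup>2 = (LINT z:square k w|vilenkin_measure2 m. f K z)"
    by (rule martingale_square_average[OF f k, symmetric])
  also have "\<dots> = (LINT z|vilenkin_measure2 m. f K z * h z)"
    unfolding set_lebesgue_integral_def
    by (rule Bochner_Integration.integral_cong[OF refl]) (simp add: h_def indicator_def)
  also have "\<dots> = (\<Sum>w'\<in>{..<M K} \<times> {..<M K}. h (point w') * (f K (point w') / (of_nat (M K))\<^sup>2))"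
    unfolding integral_mult_cellwise[OF int hcw] martingale_square_average[OF f order_refl] ..
  also have "\<dots> = (\<Sum>w'\<in>{..<M K} \<times> {..<M K}. if w' \<in> rf.cell k w then f K (point w') / (of_nat (M K))\<^sup>2 else 0)"
    by (intro sum.cong refl) (simp add: h_square[OF point_in_square])
  also have "\<dots> = (\<Sum>w'\<in>rf.cell k w. f K (point w') / (of_nat (M K))\<^sup>2)"
    using rf.cell_subset[of k w] by (subst sum.inter_restrict[symmetric]) (auto simp: Int_absorb1)
  also have "\<dots> = (\<Sum>w'\<in>rf.cell k w. f K (point w')) / (of_nat (M K))\<^sup>2"
    by (rule sum_divide_distrib[symmetric])
  finally have eq: "f k (point w) / (of_nat (M k))\<^sup>2 = (\<Sum>w'\<in>rf.cell k w. f K (point w')) / (of_nat (M K))\<^sup>2" .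
  have "complex_of_nat (card (rf.cell k w)) = complex_of_real (real (card (rf.cell k w)))" by simp
  also have "\<dots> = (of_nat (M K))\<^sup>2 / (of_nat (M k))\<^sup>2" unfolding card by (simp add: power_divide)
  finally have cc: "complex_of_nat (card (rf.cell k w)) = (of_nat (M K))\<^sup>2 / (of_nat (M k))\<^sup>2" .
  have "(of_nat (M k))\<^sup>2 \<noteq> (0::complex)" "(of_nat (M K))\<^sup>2 \<noteq> (0::complex)" using M_pos[of k] M_pos[of K] by auto
  then show ?thesis
    unfolding rf.cexp_def cc using eq by (simp add: field_simps)
qed

end


section \<open>The strong convergence theorem\<close>

theorem theorem1:
  fixes m :: "nat \<Rightarrow> nat" and p :: real
  assumes "\<And>k. 2 \<le> m k" and "bdd_above (range m)"
    and "0 < p" and "p \<le> 1"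
  shows "\<exists>c::real. c > 0 \<and> (\<forall>f \<in> hardy_space m p.
    (\<Sum>\<^sub>\<infinity>n\<in>{1..}.
        Lp_norm p (vilenkin_measure2 m) (\<lambda>z. ennreal (cmod (partial_sum m n n f z))) epowr p /
        ennreal (real n powr (3 - 2 * p) * ln (real n + 1) ^ (2 * nat \<lfloor>p\<rfloor>)))
    \<le> ennreal c * hardy_norm m p f epowr p)"
proof -
  interpret vilenkin m by unfold_locales (rule assms(1))
  obtain B where B: "\<And>k. m k \<le> B"
    using assms(2) unfolding bdd_above_def by auto
  obtain C where C: "0 \<le> C" "\<And>K g. strong_total p K g
      \<le> C * (\<Sum>z\<in>{..<M K} \<times> {..<M K}. regular_filtration.maxf ({..<M K} \<times> {..<M K}) square_label K g z powr p)"
    using strong_total_le[OF assms(3,4) B] by blast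
  have bound: "(\<Sum>\<^sub>\<infinity>n\<in>{1..}.
        Lp_norm p (vilenkin_measure2 m) (\<lambda>z. ennreal (cmod (partial_sum m n n f z))) epowr p /
        ennreal (real n powr (3 - 2 * p) * ln (real n + 1) ^ (2 * nat \<lfloor>p\<rfloor>)))
    \<le> ennreal C * hardy_norm m p f epowr p" (is "infsum ?s _ \<le> _") if "f \<in> hardy_space m p" for f
  proof (rule infsum_le_finite_sums)
    have f: "square_martingale m f" using that unfolding hardy_space_def by blast
    fix F :: "nat set" assume F: "finite F" "F \<subseteq> {1..}"
    \<comment> \<open>A level that resolves all frequencies in the chosen finite part of the series. The inserted \<open>0\<close>
        makes the maximum meaningful for empty \<open>F\<close>.\<close>
    obtain K where K: "Max (insert 0 F) < M K" using M_unbounded by blast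
    have FK: "F \<subseteq> {1..<M K}"
    proof
      fix n assume n: "n \<in> F"
      then have "n \<le> Max (insert 0 F)" using F by (intro Max_ge) auto
      then show "n \<in> {1..<M K}" using n F K by auto
    qed
    define \<Omega> where "\<Omega> = {..<M K} \<times> {..<M K}"
    define d where "d = 1 / (real (M K))\<^sup>2"
    have d: "0 \<le> d" unfolding d_def by simp
    define g where "g = (\<lambda>w. f K (point w))"
    interpret rf: regular_filtration \<Omega> square_label K "(real B)\<^sup>2"
      unfolding \<Omega>_def by (rule regular_filtration_squares[OF B])
    have lhs: "?s n = ennreal (strong_weight p n * (\<Sum>w\<in>\<Omega>. cmod (psum K n g w) powr p) * d)"
      if n: "n \<in> {1..<M K}" for n
    proof -
      have nK: "n \<le> M K" using n by simp
      have cw: "cellwise K (\<lambda>z. ennreal (cmod (partial_sum m n n f z)) epowr p)"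
        unfolding cellwise_def using partial_sum_square[OF f nK] point_in_square by metis
      have "Lp_norm p (vilenkin_measure2 m) (\<lambda>z. ennreal (cmod (partial_sum m n n f z))) epowr p
          = (\<Sum>w\<in>\<Omega>. ennreal (cmod (partial_sum m n n f (point w))) epowr p * ennreal d)"
        unfolding Lp_norm_epowr[OF assms(3)] nn_integral_cellwise[OF cw] \<Omega>_def d_def ..
      also have "\<dots> = (\<Sum>w\<in>\<Omega>. ennreal (cmod (psum K n g w) powr p * d))"
        unfolding partial_sum_square[OF f nK point_in_square] g_def
        by (intro sum.cong refl) (simp add: epowr_ennreal ennreal_mult d)
      also have "\<dots> = ennreal (\<Sum>w\<in>\<Omega>. cmod (psum K n g w) powr p * d)"
        by (rule sum_ennreal) (simp add: d)
      finally have num: "Lp_norm p (vilenkin_measure2 m) (\<lambda>z. ennreal (cmod (partial_sum m n n f z))) epowr p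
          = ennreal ((\<Sum>w\<in>\<Omega>. cmod (psum K n g w) powr p) * d)"
        unfolding sum_distrib_right .
      have "0 < real n powr (3 - 2 * p) * ln (real n + 1) ^ (2 * nat \<lfloor>p\<rfloor>)"
        using n by (intro mult_pos_pos zero_less_power) auto
      then show ?thesis
        unfolding num strong_weight_def
        by (subst divide_ennreal) (auto intro!: mult_nonneg_nonneg sum_nonneg d)
    qed
    \<comment> \<open>The maximal function up to level \<open>K\<close> is constant on the squares of that level and bounded by \<open>f*\<close>.\<close>
    have rhs: "ennreal ((\<Sum>w\<in>\<Omega>. rf.maxf g w powr p) * d) \<le> hardy_norm m p f epowr p"
    proof -
      define H where "H z = (MAX k\<in>{..K}. cmod (f k z))" for z
      have H: "H (point w) = rf.maxf g w" if "w \<in> \<Omega>" for w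
      proof -
        have "(\<lambda>k. cmod (f k (point w))) ` {..K} = (\<lambda>k. cmod (rf.cexp k g w)) ` {..K}"
          by (rule image_cong[OF refl])
            (use cexp_martingale[OF f B] that in \<open>simp add: \<Omega>_def g_def\<close>)
        then show ?thesis unfolding H_def rf.maxf_def by (simp only:)
      qed
      have H0: "0 \<le> H z" for z
      proof -
        have "cmod (f 0 z) \<le> H z" unfolding H_def by (rule Max_ge) auto
        then show ?thesis using norm_ge_zero order_trans by blast
      qed
      have Hcw: "cellwise K (\<lambda>z. ennreal (H z) epowr p)"
        unfolding cellwise_def
      proof (intro allI ballI)
        fix w z assume z: "z \<in> square K w"
        have "f k z = f k (point w)" if "k \<le> K" for k
        proof -
          have "square K w \<subseteq> square k w"
            using that unfolding square_def by (cases w) (auto simp: in_cyl_iff)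
          then show ?thesis using cellwiseD[OF martingale_cellwise[OF f], of z k w] z by blast
        qed
        then have "(\<lambda>k. cmod (f k z)) ` {..K} = (\<lambda>k. cmod (f k (point w))) ` {..K}"
          by (intro image_cong refl) simp
        then show "ennreal (H z) epowr p = ennreal (H (point w)) epowr p"
          unfolding H_def by (simp only:)
      qed
      have "ennreal ((\<Sum>w\<in>\<Omega>. rf.maxf g w powr p) * d) = (\<Sum>w\<in>\<Omega>. ennreal (H (point w)) epowr p * ennreal d)"
      proof -
        have "(\<Sum>w\<in>\<Omega>. ennreal (H (point w)) epowr p * ennreal d) = (\<Sum>w\<in>\<Omega>. ennreal (rf.maxf g w powr p * d))"
          by (intro sum.cong refl) (simp add: epowr_ennreal H0 H ennreal_mult d rf.maxf_nonneg)
        also have "\<dots> = ennreal (\<Sum>w\<in>\<Omega>. rf.maxf g w powr p * d)"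
          by (rule sum_ennreal) (simp add: d)
        finally show ?thesis unfolding sum_distrib_right by simp
      qed
      also have "\<dots> = (\<integral>\<^sup>+z. ennreal (H z) epowr p \<partial>vilenkin_measure2 m)"
        unfolding nn_integral_cellwise[OF Hcw] \<Omega>_def d_def ..
      also have "\<dots> \<le> (\<integral>\<^sup>+z. maximal_fun f z epowr p \<partial>vilenkin_measure2 m)"
      proof (intro nn_integral_mono epowr_mono)
        fix z
        have "H z \<in> (\<lambda>k. cmod (f k z)) ` {..K}" unfolding H_def by (rule Max_in) auto
        then obtain k where "H z = cmod (f k z)" by blast
        then show "ennreal (H z) \<le> maximal_fun f z"
          unfolding maximal_fun_def by (simp only:) (rule SUP_upper, simp)
      qed (rule assms(3))
      also have "\<dots> = hardy_norm m p f epowr p"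
        unfolding hardy_norm_def by (rule Lp_norm_epowr[OF assms(3), symmetric])
      finally show ?thesis .
    qed
    have "sum ?s F \<le> sum ?s {1..<M K}"
      using FK by (intro sum_mono2) auto
    also have "\<dots> = (\<Sum>n\<in>{1..<M K}. ennreal (strong_weight p n * (\<Sum>w\<in>\<Omega>. cmod (psum K n g w) powr p) * d))"
      using lhs by (rule sum.cong[OF refl])
    also have "\<dots> = ennreal (\<Sum>n\<in>{1..<M K}. strong_weight p n * (\<Sum>w\<in>\<Omega>. cmod (psum K n g w) powr p) * d)"
      by (rule sum_ennreal) (intro mult_nonneg_nonneg sum_nonneg strong_weight_nonneg powr_ge_zero d)
    also have "\<dots> = ennreal (strong_total p K g * d)"
      unfolding strong_total_def sum_distrib_right \<Omega>_def ..
    also have "\<dots> \<le> ennreal (C * ((\<Sum>w\<in>\<Omega>. rf.maxf g w powr p) * d))"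
      using mult_right_mono[OF C(2)[of K g] d] by (intro ennreal_leI) (simp add: \<Omega>_def mult.assoc)
    also have "\<dots> = ennreal C * ennreal ((\<Sum>w\<in>\<Omega>. rf.maxf g w powr p) * d)"
      by (rule ennreal_mult) (intro C(1) mult_nonneg_nonneg sum_nonneg powr_ge_zero d)+
    also have "\<dots> \<le> ennreal C * hardy_norm m p f epowr p"
      by (rule mult_left_mono[OF rhs]) simp
    finally show "sum ?s F \<le> ennreal C * hardy_norm m p f epowr p" .
  qed (rule nonneg_summable_on_complete, simp)
  show ?thesis
  proof (intro exI[of _ "C + 1"] conjI ballI)
    fix f assume "f \<in> hardy_space m p"
    note bound[OF this]
    also have "ennreal C * hardy_norm m p f epowr p \<le> ennreal (C + 1) * hardy_norm m p f epowr p"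
      using C(1) by (intro mult_right_mono ennreal_leI) auto
    finally show "(\<Sum>\<^sub>\<infinity>n\<in>{1..}.
        Lp_norm p (vilenkin_measure2 m) (\<lambda>z. ennreal (cmod (partial_sum m n n f z))) epowr p /
        ennreal (real n powr (3 - 2 * p) * ln (real n + 1) ^ (2 * nat \<lfloor>p\<rfloor>)))
      \<le> ennreal (C + 1) * hardy_norm m p f epowr p" .
  qed (use C(1) in simp)
qed

end
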